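(* Let $n_1,n_2$ be positive integers. For $i=1,2$ let $p_i\in(1,\infty)$ and $q_i=p_i'$, that is, $\frac1{p_i}+\frac1{q_i}=1$. Then the following three statements are equivalent: (i) $\mathbb R^{n_1}\times\mathbb R^{n_2}$ is $L^{p_2}(L^{p_1})$-parabolic. (ii) $\mathbb R^{n_1}\times\mathbb R^{n_2}$ admits the $L^{q_2}(L^{q_1})$-Liouville property. (iii) The effective dimension $D_{\rm eff}:=\frac{n_1}{p_1}+\frac{n_2}{p_2}$ satisfies $D_{\rm eff}\le2$.
   Context: Let $M=M_1\times M_2$ with $M_i=\mathbb R^{n_i}$ (Euclidean metric, Lebesgue measure $V_i$, $V=V_1\otimes V_2$). $p_t^M$ is the heat kernel of the Laplacian on $M$ (the kernel of $e^{t\Delta}$), $G^M(x;y)=\int_0^\infty p_t^M(x,y)\,dt\in[0,\infty]$ and $G^Mf(x)=\int_MG^M(x;y)f(y)\,dV(y)$. $\|f\|_{L^{p_2}(L^{p_1})(M)}=\left(\int_{M_2}\left(\int_{M_1}|f(x_1,x_2)|^{p_1}dV_1(x_1)\right)^{p_2/p_1}dV_2(x_2)\right)^{1/p_2}$. For $E\subset M$, $\operatorname{cap}_{p_1,p_2}(E)=\inf\{\|f\|^{p_2}_{L^{p_2}(L^{p_1})(M)}: 0\le f\in L^{p_2}(L^{p_1})(M),\ G^Mf\ge\mathbf 1_E\}$. $M$ is $L^{p_2}(L^{p_1})$-parabolic if $\operatorname{cap}_{p_1,p_2}(\overline E)=0$ for every precompact open $E\subset M$. $u\in W^{1,2}_{\rm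 loc}(M)$ is superharmonic if $\int_M\nabla u\cdot\nabla\phi\,dV\ge0$ for all $0\le\phi\in\mathcal C_c^\infty(M)$. $M$ admits the $L^{q_2}(L^{q_1})$-Liouville property if every nonnegative superharmonic $u$ on $M$ with $u\in L^{q_2}(L^{q_1})(M)$ is constant. *)

theory Defs
  imports "HOL-Probability.Probability"
begin

subsection \<open>Heat kernel and Green kernel of Euclidean space\<close>

text \<open>
  The Gauss--Weierstrass kernel. The lemmas \<open>heat_kernel_heat_equation\<close>, \<open>nn_integral_heat_kernel\<close>
  and \<open>heat_kernel_initial_value\<close> confirm that the normalization is the one of the heat equation
  for the Laplacian itself (and not for half of it). On a product type the norm is the
  Euclidean product norm, so for \<^typ>\<open>'a \<times> 'b\<close> this is the heat kernel of the Riemannian product.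
\<close>

definition heat_kernel :: "real \<Rightarrow> 'a::euclidean_space \<Rightarrow> 'a \<Rightarrow> real" where
  "heat_kernel t x y = exp (- (dist x y)\<^sup>2 / (4 * t)) / (4 * pi * t) powr (DIM('a) / 2)"

definition green_kernel :: "'a::euclidean_space \<Rightarrow> 'a \<Rightarrow> ennreal" where
  "green_kernel x y = (\<integral>\<^sup>+t\<in>{0<..}. ennreal (heat_kernel t x y) \<partial>lborel)"

text \<open>Only meant for nonnegative functions: \<^const>\<open>ennreal\<close> truncates negative values to 0.\<close>

definition green_potential :: "('a::euclidean_space \<Rightarrow> real) \<Rightarrow> 'a \<Rightarrow> ennreal" where
  "green_potential f x = (\<integral>\<^sup>+y. green_kernel x y * ennreal (f y) \<partial>lborel)"


subsection \<open>Mixed-norm spaces, capacity, parabolicity\<close>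

text \<open>Real powers of extended nonnegative reals, for exponents \<open>r > 0\<close>.\<close>

definition ennreal_powr :: "ennreal \<Rightarrow> real \<Rightarrow> ennreal" where
  "ennreal_powr a r = (if a = \<infinity> then \<infinity> else ennreal (enn2real a powr r))"

definition mixed_norm ::
  "real \<Rightarrow> real \<Rightarrow> ('a::euclidean_space \<times> 'b::euclidean_space \<Rightarrow> real) \<Rightarrow> ennreal" where
  "mixed_norm p1 p2 f =
     ennreal_powr
       (\<integral>\<^sup>+x2. ennreal_powr (\<integral>\<^sup>+x1. ennreal (\<bar>f (x1, x2)\<bar> powr p1) \<partial>lborel) (p2 / p1) \<partial>lborel)
       (1 / p2)"

text \<open>
  Elements of the function spaces are classes modulo null sets. They are represented by Borel
  functions (every Lebesgue measurable function agrees almost everywhere with one), and pointwise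
  conditions on them are imposed almost everywhere.
\<close>

definition mixed_Lp ::
  "real \<Rightarrow> real \<Rightarrow> ('a::euclidean_space \<times> 'b::euclidean_space \<Rightarrow> real) set" where
  "mixed_Lp p1 p2 = {f \<in> borel_measurable lborel. mixed_norm p1 p2 f < \<infinity>}"

text \<open>The inequality between the potential and the indicator function is required at every point.\<close>

definition mixed_capacity ::
  "real \<Rightarrow> real \<Rightarrow> ('a::euclidean_space \<times> 'b::euclidean_space) set \<Rightarrow> ennreal" where
  "mixed_capacity p1 p2 E =
     (INF f \<in> {f \<in> mixed_Lp p1 p2.
                (AE x in lborel. 0 \<le> f x) \<and> (\<forall>x. indicator E x \<le> green_potential f x)}.
        ennreal_powr (mixed_norm p1 p2 f) p2)"

definition mixed_parabolic ::
  "('a::euclidean_space \<times> 'b::euclidean_space) itself \<Rightarrow> real \<Rightarrow> real \<Rightarrow> bool" where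
  "mixed_parabolic M p1 p2 \<longleftrightarrow>
     (\<forall>E :: ('a \<times> 'b) set. open E \<and> compact (closure E) \<longrightarrow> mixed_capacity p1 p2 (closure E) = 0)"


subsection \<open>Weakly superharmonic functions and the Liouville property\<close>

primrec k_times_cont_diff :: "nat \<Rightarrow> ('a::euclidean_space \<Rightarrow> real) \<Rightarrow> bool" where
  "k_times_cont_diff 0 f \<longleftrightarrow> continuous_on UNIV f"
| "k_times_cont_diff (Suc k) f \<longleftrightarrow>
     (\<forall>x. f differentiable (at x)) \<and>
     (\<forall>v. k_times_cont_diff k (\<lambda>x. frechet_derivative f (at x) v))"

definition test_functions :: "('a::euclidean_space \<Rightarrow> real) set" where
  "test_functions = {\<phi>. (\<forall>k. k_times_cont_diff k \<phi>) \<and> compact (closure {x. \<phi> x \<noteq> 0})}"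

definition grad :: "('a::euclidean_space \<Rightarrow> real) \<Rightarrow> 'a \<Rightarrow> 'a" where
  "grad \<phi> x = (\<Sum>b\<in>Basis. frechet_derivative \<phi> (at x) b *\<^sub>R b)"

definition L2_loc :: "('a::euclidean_space \<Rightarrow> 'c::euclidean_space) set" where
  "L2_loc = {f \<in> borel_measurable lborel.
               \<forall>K. compact K \<longrightarrow> set_integrable lborel K (\<lambda>x. (norm (f x))\<^sup>2)}"

definition weak_gradient :: "('a::euclidean_space \<Rightarrow> real) \<Rightarrow> ('a \<Rightarrow> 'a) \<Rightarrow> bool" where
  "weak_gradient u g \<longleftrightarrow>
     (\<forall>\<phi>\<in>test_functions. (\<integral>x. u x *\<^sub>R grad \<phi> x \<partial>lborel) = - (\<integral>x. \<phi> x *\<^sub>R g x \<partial>lborel))"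

text \<open>
  The existence of \<open>g\<close> says that \<open>u\<close> lies in \<open>W\<^sup>1\<^sup>,\<^sup>2\<close> locally. As weak gradients are unique up to
  null sets, the choice of \<open>g\<close> does not matter.
\<close>

definition superharmonic :: "('a::euclidean_space \<Rightarrow> real) \<Rightarrow> bool" where
  "superharmonic u \<longleftrightarrow>
     u \<in> L2_loc \<and>
     (\<exists>g\<in>L2_loc. weak_gradient u g \<and>
        (\<forall>\<phi>\<in>test_functions. (\<forall>x. 0 \<le> \<phi> x) \<longrightarrow> 0 \<le> (\<integral>x. g x \<bullet> grad \<phi> x \<partial>lborel)))"

definition mixed_Liouville ::
  "('a::euclidean_space \<times> 'b::euclidean_space) itself \<Rightarrow> real \<Rightarrow> real \<Rightarrow> bool" where
  "mixed_Liouville M q1 q2 \<longleftrightarrow>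
     (\<forall>u :: 'a \<times> 'b \<Rightarrow> real.
        superharmonic u \<and> (AE x in lborel. 0 \<le> u x) \<and> u \<in> mixed_Lp q1 q2 \<longrightarrow>
        (\<exists>c. AE x in lborel. u x = c))"


subsection \<open>The Gauss--Weierstrass kernel is the fundamental solution of the heat equation\<close>

lemma heat_kernel_nonneg: "0 \<le> heat_kernel t x y"
  by (simp add: heat_kernel_def)

lemma heat_kernel_heat_equation:
  fixes x y :: "'a::euclidean_space"
  assumes t: "0 < t"
  shows "((\<lambda>s. heat_kernel s x y) has_real_derivative
            (\<Sum>b\<in>Basis. (deriv ^^ 2) (\<lambda>s. heat_kernel t (x + s *\<^sub>R b) y) 0)) (at t)"
proof -
  define z where "z = x - y"
  define C where "C = (4 * pi * t) powr (DIM('a) / 2)"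
  have C: "C > 0" using t by (simp add: C_def)
  define K where "K = heat_kernel t x y"
  have sq: "(dist (x + s *\<^sub>R b) y)\<^sup>2 = (norm z)\<^sup>2 + 2 * s * (z \<bullet> b) + s\<^sup>2"
    if "b \<in> Basis" for b s
  proof -
    have "x + s *\<^sub>R b - y = z + s *\<^sub>R b" by (simp add: z_def algebra_simps)
    then show ?thesis
      using that by (simp add: dist_norm power2_norm_eq_inner inner_add_left inner_add_right
          inner_commute power2_eq_square[of s] algebra_simps)
  qed
  have second: "(deriv ^^ 2) (\<lambda>s. heat_kernel t (x + s *\<^sub>R b) y) 0
                 = K * ((z \<bullet> b)\<^sup>2 / (4 * t\<^sup>2) - 1 / (2 * t))" if b: "b \<in> Basis" for b
  proof -
    define h where "h = (\<lambda>s. exp (- ((norm z)\<^sup>2 + 2 * s * (z \<bullet> b) + s\<^sup>2) / (4 * t)) / C)"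
    have eq: "(\<lambda>s. heat_kernel t (x + s *\<^sub>R b) y) = h"
      by (simp add: heat_kernel_def sq[OF b] h_def C_def fun_eq_iff)
    have h1: "(h has_real_derivative h s * (- (z \<bullet> b + s) / (2 * t))) (at s)" for s
      unfolding h_def using t C
      by (auto intro!: derivative_eq_intros simp: field_simps)
    have d1: "deriv h = (\<lambda>s. h s * (- (z \<bullet> b + s) / (2 * t)))"
      using DERIV_imp_deriv[OF h1] by auto
    have "((\<lambda>s. h s * (- (z \<bullet> b + s) / (2 * t))) has_real_derivative
             h 0 * (- (z \<bullet> b + 0) / (2 * t)) * (- (z \<bullet> b + 0) / (2 * t)) + h 0 * (- 1 / (2 * t))) (at 0)"
      using t by (auto intro!: derivative_eq_intros h1[of 0] simp: field_simps)
    then have "deriv (deriv h) 0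
        = h 0 * (- (z \<bullet> b + 0) / (2 * t)) * (- (z \<bullet> b + 0) / (2 * t)) + h 0 * (- 1 / (2 * t))"
      unfolding d1 by (rule DERIV_imp_deriv)
    also have "\<dots> = h 0 * ((z \<bullet> b)\<^sup>2 / (4 * t\<^sup>2) - 1 / (2 * t))"
      by (simp add: power2_eq_square right_diff_distrib)
    finally have "deriv (deriv h) 0 = h 0 * ((z \<bullet> b)\<^sup>2 / (4 * t\<^sup>2) - 1 / (2 * t))" .
    moreover have "h 0 = K" using eq[symmetric] by (simp add: K_def)
    ultimately show ?thesis by (simp add: eq numeral_2_eq_2)
  qed
  have "(\<Sum>b\<in>Basis. (deriv ^^ 2) (\<lambda>s. heat_kernel t (x + s *\<^sub>R b) y) 0)
      = (\<Sum>b\<in>Basis. K * ((z \<bullet> b)\<^sup>2 / (4 * t\<^sup>2) - 1 / (2 * t)))"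
    by (intro sum.cong refl second)
  also have "\<dots> = K * ((norm z)\<^sup>2 / (4 * t\<^sup>2) - DIM('a) / (2 * t))"
    by (simp add: sum_distrib_left[symmetric] sum_subtractf sum_divide_distrib[symmetric]
        euclidean_inner[of z z] power2_norm_eq_inner power2_eq_square[of "z \<bullet> _"])
  finally have lap: "(\<Sum>b\<in>Basis. (deriv ^^ 2) (\<lambda>s. heat_kernel t (x + s *\<^sub>R b) y) 0)
      = K * ((norm z)\<^sup>2 / (4 * t\<^sup>2) - DIM('a) / (2 * t))" .
  define n where "n = real DIM('a) / 2"
  have "((\<lambda>s. exp (- (norm z)\<^sup>2 / (4 * s)) * (4 * pi * s) powr (- n)) has_real_derivative
           exp (- (norm z)\<^sup>2 / (4 * t)) * (4 * pi * t) powr (- n) *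
             ((norm z)\<^sup>2 / (4 * t\<^sup>2) - n / t)) (at t)"
    using t by (auto intro!: derivative_eq_intros simp: powr_diff powr_minus)
      (simp add: field_simps power2_eq_square)
  moreover have "heat_kernel s x y = exp (- (norm z)\<^sup>2 / (4 * s)) * (4 * pi * s) powr (- n)" for s
    unfolding heat_kernel_def z_def dist_norm n_def by (simp only: powr_minus divide_inverse)
  moreover have "n / t = DIM('a) / (2 * t)" by (simp add: n_def)
  ultimately show ?thesis
    unfolding lap K_def by (simp only:)
qed

lemma heat_kernel_eq_prod_normal_density:
  fixes x y :: "'a::euclidean_space"
  assumes t: "0 < t"
  shows "heat_kernel t x y = (\<Prod>b\<in>Basis. normal_density (x \<bullet> b) (sqrt (2 * t)) (y \<bullet> b))"
proof -
  have "(\<Prod>b\<in>Basis. normal_density (x \<bullet> b) (sqrt (2 * t)) (y \<bullet> b))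
      = (\<Prod>b\<in>(Basis :: 'a set). 1 / sqrt (4 * pi * t)) *
        (\<Prod>b\<in>(Basis :: 'a set). exp (- ((y \<bullet> b - x \<bullet> b)\<^sup>2 / (4 * t))))"
    using t by (simp add: normal_density_def prod.distrib[symmetric] mult.assoc del: prod_constant)
  also have "(\<Prod>b\<in>(Basis :: 'a set). exp (- ((y \<bullet> b - x \<bullet> b)\<^sup>2 / (4 * t))))
      = exp (- (dist x y)\<^sup>2 / (4 * t))"
  proof -
    have "(dist x y)\<^sup>2 = (\<Sum>b\<in>Basis. (y \<bullet> b - x \<bullet> b)\<^sup>2)"
      by (subst dist_commute, unfold dist_norm power2_norm_eq_inner, subst euclidean_inner)
        (simp add: inner_diff_left power2_eq_square)
    then show ?thesis
      by (simp add: exp_sum[symmetric] sum_negf sum_divide_distrib)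
  qed
  also have "(\<Prod>b\<in>(Basis :: 'a set). (1 / sqrt (4 * pi * t))) = 1 / (4 * pi * t) powr (DIM('a) / 2)"
    using t by (simp add: powr_half_sqrt[symmetric] powr_realpow[symmetric] powr_powr power_one_over)
  finally show ?thesis by (simp add: heat_kernel_def)
qed

lemma nn_integral_heat_kernel:
  fixes x :: "'a::euclidean_space"
  assumes t: "0 < t"
  shows "(\<integral>\<^sup>+y. ennreal (heat_kernel t x y) \<partial>lborel) = 1"
proof -
  have "(\<integral>\<^sup>+y. ennreal (heat_kernel t x y) \<partial>lborel)
      = (\<integral>\<^sup>+y. (\<Prod>b\<in>Basis. ennreal (normal_density (x \<bullet> b) (sqrt (2 * t)) (y \<bullet> b))) \<partial>lborel)"
    by (simp add: heat_kernel_eq_prod_normal_density[OF t] prod_ennreal)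
  also have "\<dots> = (\<Prod>b\<in>Basis. \<integral>\<^sup>+s. ennreal (normal_density (x \<bullet> b) (sqrt (2 * t)) s) \<partial>lborel)"
    by (rule nn_integral_lborel_prod) auto
  also have "\<dots> = 1"
    using t by (intro prod.neutral) (simp add: nn_integral_eq_integral)
  finally show ?thesis .
qed

lemma heat_kernel_initial_value:
  fixes f :: "'a::euclidean_space \<Rightarrow> real"
  assumes cont: "continuous_on UNIV f" and bdd: "\<And>y. \<bar>f y\<bar> \<le> B"
  shows "((\<lambda>t. \<integral>y. heat_kernel t x y * f y \<partial>lborel) \<longlongrightarrow> f x) (at_right 0)"
proof -
  have [measurable]: "f \<in> borel_measurable borel"
    using cont by (rule borel_measurable_continuous_onI)
  have [measurable]: "heat_kernel s w \<in> borel_measurable borel" for s and w :: 'a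
    unfolding heat_kernel_def by measurable
  have mass: "has_bochner_integral lborel (heat_kernel 1 (0::'a)) 1"
    by (rule has_bochner_integral_nn_integral)
      (auto simp: nn_integral_heat_kernel heat_kernel_nonneg)
  have scale: "(\<integral>y. heat_kernel t x y * f y \<partial>lborel)
      = (\<integral>w. heat_kernel 1 0 w * f (x + sqrt t *\<^sub>R w) \<partial>lborel)" if t: "0 < t" for t
  proof -
    have pw: "sqrt t ^ DIM('a) * heat_kernel t x (x + sqrt t *\<^sub>R w) = heat_kernel 1 0 w" for w :: 'a
      using t by (simp add: heat_kernel_def dist_norm power_mult_distrib powr_mult
          powr_half_sqrt[symmetric] powr_realpow[symmetric] powr_powr)
    have "(\<integral>y. heat_kernel t x y * f y \<partial>lborel)
        = (\<integral>y. heat_kernel t x y * f y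
             \<partial>density (distr lborel borel (\<lambda>w. x + sqrt t *\<^sub>R w)) (\<lambda>_. \<bar>sqrt t\<bar> ^ DIM('a)))"
      using t by (subst lborel_affine[of "sqrt t" x]) (auto simp: ennreal_power)
    also have "\<dots> = (\<integral>w. sqrt t ^ DIM('a) * (heat_kernel t x (x + sqrt t *\<^sub>R w)
                       * f (x + sqrt t *\<^sub>R w)) \<partial>lborel)"
      using t by (simp add: integral_density integral_distr)
    also have "\<dots> = (\<integral>w. heat_kernel 1 0 w * f (x + sqrt t *\<^sub>R w) \<partial>lborel)"
      by (simp add: pw[symmetric] mult.assoc)
    finally show ?thesis .
  qed
  have "((\<lambda>t. \<integral>w. heat_kernel 1 0 w * f (x + sqrt t *\<^sub>R w) \<partial>lborel) \<longlongrightarrow> f x) (at_right 0)"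
  proof (rule tendsto_at_right_sequentially[where b = 1])
    fix S :: "nat \<Rightarrow> real" assume S: "S \<longlonglongrightarrow> 0"
    have "(\<lambda>n. \<integral>w. heat_kernel 1 0 w * f (x + sqrt (S n) *\<^sub>R w) \<partial>lborel)
            \<longlonglongrightarrow> (\<integral>w. heat_kernel 1 (0::'a) w * f x \<partial>lborel)"
    proof (rule integral_dominated_convergence[where w = "\<lambda>w. heat_kernel 1 0 w * B"])
      show "integrable lborel (\<lambda>w::'a. heat_kernel 1 0 w * B)"
        using mass by (auto simp: has_bochner_integral_iff)
      show "AE w in lborel. (\<lambda>n. heat_kernel 1 0 w * f (x + sqrt (S n) *\<^sub>R w))
              \<longlonglongrightarrow> heat_kernel 1 0 w * f x"
      proof (rule AE_I2)
        fix w :: 'a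
        have "(\<lambda>n. x + sqrt (S n) *\<^sub>R w) \<longlonglongrightarrow> x + sqrt 0 *\<^sub>R w"
          by (intro tendsto_intros S)
        then have "(\<lambda>n. f (x + sqrt (S n) *\<^sub>R w)) \<longlonglongrightarrow> f x"
          using continuous_on_tendsto_compose[OF cont] by auto
        then show "(\<lambda>n. heat_kernel 1 0 w * f (x + sqrt (S n) *\<^sub>R w))
              \<longlonglongrightarrow> heat_kernel 1 0 w * f x"
          by (intro tendsto_intros)
      qed
      show "AE w in lborel. norm (heat_kernel 1 0 w * f (x + sqrt (S n) *\<^sub>R w))
              \<le> heat_kernel 1 0 w * B" for n
        using bdd by (auto simp: abs_mult heat_kernel_nonneg intro!: mult_left_mono)
    qed auto
    also have "(\<integral>w. heat_kernel 1 (0::'a) w * f x \<partial>lborel) = f x"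
      using mass by (simp add: has_bochner_integral_iff)
    finally show "(\<lambda>n. \<integral>w. heat_kernel 1 0 w * f (x + sqrt (S n) *\<^sub>R w) \<partial>lborel) \<longlonglongrightarrow> f x" .
  qed auto
  moreover have "eventually (\<lambda>t. (\<integral>w. heat_kernel 1 0 w * f (x + sqrt t *\<^sub>R w) \<partial>lborel)
      = (\<integral>y. heat_kernel t x y * f y \<partial>lborel)) (at_right 0)"
    using eventually_at_right_less[of 0] by eventually_elim (simp add: scale)
  ultimately show ?thesis by (rule Lim_transform_eventually)
qed

end

theory Submission
  imports Defs
begin

text \<open>
  Let \<open>n = n1 + n2\<close> be the dimension of the product and \<open>D = n1 / p1 + n2 / p2\<close> its effective
  dimension. Both parabolicity and the Liouville property are compared with the condition
  \<open>D \<le> 2\<close>, which gives four implications. Behind all of them is the same scaling: the norm of the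
  Gaussian \<open>exp (- a * (x \<bullet> x))\<close> in the mixed space with exponents \<open>p1, p2\<close> is a constant
  times \<open>a powr (- D / 2)\<close>, and with the conjugate exponents a constant times
  \<open>a powr (- (n - D) / 2)\<close> (\<open>mixed_norm_gaussian_pairing\<close>).

  If \<open>D > 2\<close>, then the pairing of \<open>f\<close> with the heat kernel at time \<open>t\<close> decays like the
  integrable function \<open>t powr (- D / 2)\<close>, so that a potential which is large on a ball forces
  \<open>f\<close> to have a large norm, and the capacity of the ball is positive (\<open>not_mixed_parabolic\<close>).
  The Liouville property fails because the superharmonic function
  \<open>(1 + x \<bullet> x) powr (- (n - 2) / 2)\<close> decays fast enough (\<open>not_mixed_Liouville\<close>).

  If \<open>D \<le> 2\<close>, then every dyadic scale can contribute a fixed amount to the potential at a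
  bounded cost. As the costs of \<open>N\<close> scales add up in the sense of the \<open>p2\<close>-th powers of the
  norms, spreading the potential over many scales makes the capacity arbitrarily small
  (\<open>mixed_parabolicI\<close>). For the Liouville property, let \<open>u \<ge> 0\<close> be superharmonic. Its
  pairing \<open>U a\<close> with \<open>exp (- a * (x \<bullet> x))\<close> satisfies a differential inequality, for which
  \<open>D \<le> 2\<close> is needed, and which forces \<open>U a\<close> to grow at least like \<open>a powr (- n / 2)\<close>
  as \<open>a\<close> tends to 0 unless \<open>u\<close> vanishes. The Hoelder inequality gives the upper bound
  \<open>a powr (- D / 2)\<close>, and \<open>D < n\<close> because \<open>p1\<close> and \<open>p2\<close> exceed 1
  (\<open>mixed_LiouvilleI\<close>).
\<close>


section \<open>Mixed norms\<close>

lemma ennreal_powr_ennreal: "0 \<le> x \<Longrightarrow> ennreal_powr (ennreal x) r = ennreal (x powr r)"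
  by (simp add: ennreal_powr_def)

lemma ennreal_powr_0: "ennreal_powr 0 r = 0"
  by (simp add: ennreal_powr_def)

lemma ennreal_powr_mono: "a \<le> b \<Longrightarrow> 0 \<le> r \<Longrightarrow> ennreal_powr a r \<le> ennreal_powr b r"
  by (cases a; cases b) (auto simp: ennreal_powr_def top_unique intro!: powr_mono2 ennreal_leI)

lemma ennreal_powr_eq_0_iff: "ennreal_powr a r = 0 \<longleftrightarrow> a = 0"
  by (cases a) (auto simp: ennreal_powr_def top_unique)

lemma ennreal_powr_less_top_iff: "ennreal_powr a r < \<infinity> \<longleftrightarrow> a < \<infinity>"
  by (cases a) (auto simp: ennreal_powr_def)

lemma ennreal_powr_powr: "ennreal_powr (ennreal_powr a r) s = ennreal_powr a (r * s)"
  by (cases a) (auto simp: ennreal_powr_def powr_powr)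

lemma ennreal_powr_one: "ennreal_powr a 1 = a"
  by (cases a) (auto simp: ennreal_powr_def)

lemma measurable_ennreal_powr [measurable (raw)]:
  assumes [measurable]: "f \<in> borel_measurable M"
  shows "(\<lambda>x. ennreal_powr (f x) r) \<in> borel_measurable M"
  unfolding ennreal_powr_def by measurable

lemma nn_integral_lborel_fubini:
  fixes f :: "'a::euclidean_space \<times> 'b::euclidean_space \<Rightarrow> ennreal"
  assumes [measurable]: "f \<in> borel_measurable borel"
  shows "(\<integral>\<^sup>+z. f z \<partial>lborel) = (\<integral>\<^sup>+y. \<integral>\<^sup>+x. f (x, y) \<partial>lborel \<partial>lborel)"
proof -
  have "f \<in> borel_measurable (lborel \<Otimes>\<^sub>M lborel)"
    by (simp add: lborel_prod)
  then show ?thesis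
    using lborel_pair.nn_integral_snd[of f] by (simp add: lborel_prod)
qed

text \<open>
  Dividing by the two norms reduces the inequality to Young's inequality at every point. The
  function \<open>f\<close> is allowed to be infinite, since it will be an inner norm; the weight has
  a finite positive norm, so that the degenerate cases concern \<open>f\<close> alone.
\<close>

lemma nn_integral_Hoelder:
  fixes f :: "'a \<Rightarrow> ennreal" and w :: "'a \<Rightarrow> real"
  assumes [measurable]: "f \<in> borel_measurable M" "w \<in> borel_measurable M"
    and w0: "\<And>x. 0 \<le> w x" and p: "1 < p" "1 < q" "1 / p + 1 / q = 1"
    and W: "(\<integral>\<^sup>+x. ennreal (w x powr p) \<partial>M) = ennreal W" "0 < W"
  shows "(\<integral>\<^sup>+x. f x * ennreal (w x) \<partial>M)
    \<le> ennreal_powr (\<integral>\<^sup>+x. ennreal_powr (f x) q \<partial>M) (1 / q) * ennreal (W powr (1 / p))"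
proof (cases "\<integral>\<^sup>+x. ennreal_powr (f x) q \<partial>M")
  case top
  then show ?thesis using W by (simp add: ennreal_powr_def ennreal_top_mult)
next
  case (real A)
  show ?thesis
  proof (cases "A = 0")
    case True
    then have "(\<integral>\<^sup>+x. ennreal_powr (f x) q \<partial>M) = 0"
      using real by simp
    then have "AE x in M. ennreal_powr (f x) q = 0"
      by (subst (asm) nn_integral_0_iff_AE) auto
    then have "AE x in M. f x * ennreal (w x) = 0"
      by eventually_elim (simp add: ennreal_powr_eq_0_iff)
    then have "(\<integral>\<^sup>+x. f x * ennreal (w x) \<partial>M) = (\<integral>\<^sup>+x. 0 \<partial>M)"
      by (intro nn_integral_cong_AE)
    then show ?thesis by simp
  next
    case False
    then have A: "A > 0" using real by simp
    define C where "C = A powr (1 / q) * W powr (1 / p)"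
    have C: "C > 0" using A W by (simp add: C_def)
    have pt: "f x * ennreal (w x)
       \<le> ennreal (C / (q * A)) * ennreal_powr (f x) q + ennreal (C / (p * W)) * ennreal (w x powr p)" for x
    proof (cases "f x")
      case top
      then show ?thesis
        using A C p by (simp add: ennreal_powr_def ennreal_mult_top)
    next
      case (real s)
      define a where "a = s / A powr (1 / q)"
      define b where "b = w x / W powr (1 / p)"
      have "a * b \<le> a powr q / q + b powr p / p"
        using p real w0[of x] by (intro Youngs_inequality) (auto simp: a_def b_def add.commute)
      also have "a powr q = s powr q / A"
        using real A p by (simp add: a_def powr_divide powr_powr)
      also have "b powr p = w x powr p / W"
        using w0[of x] W p by (simp add: b_def powr_divide powr_powr)
      finally have "C * (a * b) \<le> C * (s powr q / A / q + w x powr p / W / p)"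
        using C by (intro mult_left_mono) auto
      moreover have "C * (a * b) = s * w x"
        using A W by (simp add: C_def a_def b_def)
      ultimately have "s * w x \<le> C / (q * A) * s powr q + C / (p * W) * w x powr p"
        by (simp add: algebra_simps)
      then show ?thesis
        using real w0[of x] A W C p
        by (simp add: ennreal_powr_ennreal ennreal_mult[symmetric] ennreal_plus[symmetric] del: ennreal_plus)
    qed
    have "(\<integral>\<^sup>+x. f x * ennreal (w x) \<partial>M)
      \<le> (\<integral>\<^sup>+x. ennreal (C / (q * A)) * ennreal_powr (f x) q + ennreal (C / (p * W)) * ennreal (w x powr p) \<partial>M)"
      by (intro nn_integral_mono pt)
    also have "\<dots> = ennreal (C / (q * A)) * ennreal A + ennreal (C / (p * W)) * ennreal W"
      by (simp add: nn_integral_add nn_integral_cmult real W)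
    also have "\<dots> = ennreal (C / (q * A) * A + C / (p * W) * W)"
      using A W C p by (simp add: ennreal_mult[symmetric] ennreal_plus[symmetric] del: ennreal_plus)
    also have "C / (q * A) * A + C / (p * W) * W = C * (1 / p + 1 / q)"
      using A W by (simp add: field_simps)
    also have "\<dots> = C" using p by simp
    also have "ennreal C = ennreal_powr (\<integral>\<^sup>+x. ennreal_powr (f x) q \<partial>M) (1 / q) * ennreal (W powr (1 / p))"
      using real A by (simp add: C_def ennreal_powr_ennreal ennreal_mult)
    finally show ?thesis .
  qed
qed

text \<open>
  For a product weight this is the previous lemma in the first variable, followed by the same
  lemma for the inner norms in the second variable.
\<close>

lemma mixed_Hoelder_product_weight:
  fixes u :: "'a::euclidean_space \<times> 'b::euclidean_space \<Rightarrow> real"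
  assumes [measurable]: "u \<in> borel_measurable borel" "w1 \<in> borel_measurable borel"
      "w2 \<in> borel_measurable borel"
    and w0: "\<And>x. 0 \<le> w1 x" "\<And>y. 0 \<le> w2 y"
    and p: "1 < p1" "1 < q1" "1 / p1 + 1 / q1 = 1" "1 < p2" "1 < q2" "1 / p2 + 1 / q2 = 1"
    and W1: "(\<integral>\<^sup>+x. ennreal (w1 x powr p1) \<partial>lborel) = ennreal W1" "0 < W1"
    and W2: "(\<integral>\<^sup>+y. ennreal (w2 y powr p2) \<partial>lborel) = ennreal W2" "0 < W2"
  shows "(\<integral>\<^sup>+z. ennreal \<bar>u z\<bar> * ennreal (w1 (fst z) * w2 (snd z)) \<partial>lborel)
    \<le> mixed_norm q1 q2 u * ennreal (W1 powr (1 / p1) * W2 powr (1 / p2))"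
proof -
  define N where "N y = ennreal_powr (\<integral>\<^sup>+x. ennreal (\<bar>u (x, y)\<bar> powr q1) \<partial>lborel) (1 / q1)" for y
  have [measurable]: "N \<in> borel_measurable borel"
    unfolding N_def by measurable
  have fst_snd: "fst \<in> borel \<rightarrow>\<^sub>M (borel :: 'a measure)" "snd \<in> borel \<rightarrow>\<^sub>M (borel :: 'b measure)"
    by (intro borel_measurable_continuous_onI continuous_intros)+
  have [measurable]: "(\<lambda>z::'a \<times> 'b. w1 (fst z)) \<in> borel_measurable borel"
      "(\<lambda>z::'a \<times> 'b. w2 (snd z)) \<in> borel_measurable borel"
    using fst_snd by (auto intro: measurable_compose)
  have inner: "(\<integral>\<^sup>+x. ennreal \<bar>u (x, y)\<bar> * ennreal (w1 x) \<partial>lborel) \<le> N y * ennreal (W1 powr (1 / p1))" for y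
    using nn_integral_Hoelder[of "\<lambda>x. ennreal \<bar>u (x, y)\<bar>" lborel w1 p1 q1 W1] p w0 W1
    by (simp add: N_def ennreal_powr_ennreal)
  have "(\<integral>\<^sup>+z. ennreal \<bar>u z\<bar> * ennreal (w1 (fst z) * w2 (snd z)) \<partial>lborel)
      = (\<integral>\<^sup>+y. (\<integral>\<^sup>+x. ennreal \<bar>u (x, y)\<bar> * ennreal (w1 x) \<partial>lborel) * ennreal (w2 y) \<partial>lborel)"
    using w0 by (subst nn_integral_lborel_fubini)
      (auto simp: nn_integral_multc[symmetric] ennreal_mult mult.assoc intro!: nn_integral_cong)
  also have "\<dots> \<le> (\<integral>\<^sup>+y. ennreal (W1 powr (1 / p1)) * (N y * ennreal (w2 y)) \<partial>lborel)"
    using inner by (intro nn_integral_mono) (metis mult.assoc mult.commute mult_right_mono zero_le)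
  also have "\<dots> = ennreal (W1 powr (1 / p1)) * (\<integral>\<^sup>+y. N y * ennreal (w2 y) \<partial>lborel)"
    by (simp add: nn_integral_cmult)
  also have "\<dots> \<le> ennreal (W1 powr (1 / p1)) *
      (ennreal_powr (\<integral>\<^sup>+y. ennreal_powr (N y) q2 \<partial>lborel) (1 / q2) * ennreal (W2 powr (1 / p2)))"
    by (intro mult_left_mono nn_integral_Hoelder) (use p w0 W2 in auto)
  also have "ennreal_powr (\<integral>\<^sup>+y. ennreal_powr (N y) q2 \<partial>lborel) (1 / q2) = mixed_norm q1 q2 u"
    by (simp add: N_def mixed_norm_def ennreal_powr_powr)
  finally show ?thesis
    by (simp add: ennreal_mult ac_simps)
qed

lemma nn_integral_gaussian:
  assumes a: "0 < a"
  shows "(\<integral>\<^sup>+(x::'a::euclidean_space). ennreal (exp (- a * (norm x)\<^sup>2)) \<partial>lborel)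
    = ennreal ((pi / a) powr (DIM('a) / 2))"
proof -
  define t where "t = 1 / (4 * a)"
  have t: "t > 0" using a by (simp add: t_def)
  have "exp (- a * (norm x)\<^sup>2) = (pi / a) powr (DIM('a) / 2) * heat_kernel t 0 x" for x :: 'a
    using a by (simp add: heat_kernel_def t_def)
  then have "(\<integral>\<^sup>+(x::'a). ennreal (exp (- a * (norm x)\<^sup>2)) \<partial>lborel)
      = (\<integral>\<^sup>+(x::'a). ennreal ((pi / a) powr (DIM('a) / 2)) * ennreal (heat_kernel t 0 x) \<partial>lborel)"
    by (simp add: ennreal_mult heat_kernel_nonneg)
  also have "\<dots> = ennreal ((pi / a) powr (DIM('a) / 2)) * (\<integral>\<^sup>+(x::'a). ennreal (heat_kernel t 0 x) \<partial>lborel)"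
    by (intro nn_integral_cmult) (simp add: heat_kernel_def)
  finally show ?thesis by (simp add: nn_integral_heat_kernel[OF t])
qed

text \<open>
  A Gaussian is a product weight, and its norm in the dual mixed space scales like
  \<open>a powr (- D / 2)\<close>, where \<open>D\<close> is the effective dimension formed with the
  exponents dual to those of the norm of \<open>u\<close>. This is how the effective dimension
  enters both the lower bound for the capacity and the Liouville property.
\<close>

lemma mixed_norm_gaussian_pairing:
  assumes p: "1 < p1" "1 < q1" "1 / p1 + 1 / q1 = 1" "1 < p2" "1 < q2" "1 / p2 + 1 / q2 = 1"
  shows "\<exists>C>0. \<forall>(u :: 'a::euclidean_space \<times> 'b::euclidean_space \<Rightarrow> real) a.
      u \<in> borel_measurable borel \<longrightarrow> 0 < a \<longrightarrow>
      (\<integral>\<^sup>+z. ennreal \<bar>u z\<bar> * ennreal (exp (- a * (norm z)\<^sup>2)) \<partial>lborel)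
        \<le> mixed_norm q1 q2 u * ennreal (C * a powr (- (DIM('a) / p1 + DIM('b) / p2) / 2))"
proof -
  define m1 m2 where "m1 = real DIM('a) / 2" and "m2 = real DIM('b) / 2"
  define C where "C = (pi / p1) powr (m1 / p1) * (pi / p2) powr (m2 / p2)"
  have "C > 0" using p by (simp add: C_def)
  moreover have "(\<integral>\<^sup>+z. ennreal \<bar>u z\<bar> * ennreal (exp (- a * (norm z)\<^sup>2)) \<partial>lborel)
        \<le> mixed_norm q1 q2 u * ennreal (C * a powr (- (DIM('a) / p1 + DIM('b) / p2) / 2))"
    if u: "u \<in> borel_measurable borel" and a: "0 < a" for u :: "'a \<times> 'b \<Rightarrow> real" and a
  proof -
    have W1: "(\<integral>\<^sup>+(x::'a). ennreal (exp (- a * (norm x)\<^sup>2) powr p1) \<partial>lborel) = ennreal ((pi / (p1 * a)) powr m1)"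
      using nn_integral_gaussian[of "p1 * a", where 'a = 'a] a p
      by (simp add: exp_powr_real m1_def ac_simps)
    have W2: "(\<integral>\<^sup>+(x::'b). ennreal (exp (- a * (norm x)\<^sup>2) powr p2) \<partial>lborel) = ennreal ((pi / (p2 * a)) powr m2)"
      using nn_integral_gaussian[of "p2 * a", where 'a = 'b] a p
      by (simp add: exp_powr_real m2_def ac_simps)
    have split: "exp (- a * (norm z)\<^sup>2) = exp (- a * (norm (fst z))\<^sup>2) * exp (- a * (norm (snd z))\<^sup>2)"
      for z :: "'a \<times> 'b"
      by (cases z) (simp add: norm_Pair exp_add[symmetric] algebra_simps)
    have eq: "((pi / (p1 * a)) powr m1) powr (1 / p1) * ((pi / (p2 * a)) powr m2) powr (1 / p2)
        = C * a powr (- (DIM('a) / p1 + DIM('b) / p2) / 2)"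
    proof -
      have "(pi / (c * a)) powr e = (pi / c) powr e * a powr (- e)" if "c > 0" for c e
        using that a by (simp add: powr_divide powr_mult powr_minus field_simps)
      then have "((pi / (p1 * a)) powr m1) powr (1 / p1) * ((pi / (p2 * a)) powr m2) powr (1 / p2)
        = C * (a powr (- (m1 / p1)) * a powr (- (m2 / p2)))"
        using p by (simp add: powr_powr powr_mult C_def)
      also have "a powr (- (m1 / p1)) * a powr (- (m2 / p2)) = a powr (- (DIM('a) / p1 + DIM('b) / p2) / 2)"
        unfolding powr_add[symmetric] by (rule arg_cong[where f = "(powr) a"]) (simp add: m1_def m2_def field_simps)
      finally show ?thesis .
    qed
    show ?thesis
      unfolding split eq[symmetric]
      by (rule mixed_Hoelder_product_weight[OF u _ _ _ _ p W1 _ W2]) (use p a in auto)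
  qed
  ultimately show ?thesis by blast
qed

lemma conjugate_exponent_divide:
  fixes c p q :: real
  assumes "1 / p + 1 / q = 1"
  shows "c / q = c - c / p"
proof -
  have "c / p + c / q = c * (1 / p + 1 / q)" unfolding distrib_left by simp
  also have "\<dots> = c" unfolding assms by simp
  finally show ?thesis by linarith
qed


section \<open>Positive capacity in large effective dimension\<close>

lemma measurable_heat_kernel [measurable (raw)]:
  fixes X Y :: "'m \<Rightarrow> 'a::euclidean_space"
  assumes [measurable]: "T \<in> borel_measurable M" "X \<in> borel_measurable M" "Y \<in> borel_measurable M"
  shows "(\<lambda>w. heat_kernel (T w) (X w) (Y w)) \<in> borel_measurable M"
  unfolding heat_kernel_def by measurable

lemma heat_kernel_semigroup:
  fixes y :: "'a::euclidean_space"
  assumes s: "0 < s" and t: "0 < t"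
  shows "(\<integral>\<^sup>+x. ennreal (heat_kernel s 0 x) * ennreal (heat_kernel t x y) \<partial>lborel)
    = ennreal (heat_kernel (s + t) 0 y)"
proof -
  have one_dim: "(\<integral>\<^sup>+x. ennreal (normal_density 0 (sqrt (2 * s)) x * normal_density x (sqrt (2 * t)) c) \<partial>lborel)
      = ennreal (normal_density 0 (sqrt (2 * (s + t))) c)" for c
  proof -
    have "normal_density x \<sigma> c = normal_density 0 \<sigma> (c - x)" for x \<sigma>
      by (simp add: normal_density_def)
    then have "(\<integral>\<^sup>+x. ennreal (normal_density 0 (sqrt (2 * s)) x * normal_density x (sqrt (2 * t)) c) \<partial>lborel)
       = (\<lambda>c. \<integral>\<^sup>+x. ennreal (normal_density 0 (sqrt (2 * t)) (c - x) * normal_density 0 (sqrt (2 * s)) x) \<partial>lborel) c"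
      by (simp add: mult.commute)
    also have "\<dots> = ennreal (normal_density 0 (sqrt ((sqrt (2 * t))\<^sup>2 + (sqrt (2 * s))\<^sup>2)) c)"
      using s t fun_cong[OF conv_normal_density_zero_mean[of "sqrt (2 * t)" "sqrt (2 * s)"], of c] by simp
    also have "(sqrt (2 * t))\<^sup>2 + (sqrt (2 * s))\<^sup>2 = 2 * (s + t)"
      using s t by simp
    finally show ?thesis .
  qed
  have "(\<integral>\<^sup>+x. ennreal (heat_kernel s 0 x) * ennreal (heat_kernel t x y) \<partial>lborel)
      = (\<integral>\<^sup>+x. (\<Prod>b\<in>Basis. ennreal (normal_density 0 (sqrt (2 * s)) (x \<bullet> b)
            * normal_density (x \<bullet> b) (sqrt (2 * t)) (y \<bullet> b))) \<partial>lborel)"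
    using s t by (simp add: heat_kernel_eq_prod_normal_density prod_ennreal prod.distrib
        ennreal_mult[symmetric] prod_nonneg)
  also have "\<dots> = (\<Prod>b\<in>Basis. \<integral>\<^sup>+r. ennreal (normal_density 0 (sqrt (2 * s)) r
            * normal_density r (sqrt (2 * t)) (y \<bullet> b)) \<partial>lborel)"
    by (rule nn_integral_lborel_prod) (auto simp: normal_density_def)
  also have "\<dots> = ennreal (heat_kernel (s + t) 0 y)"
    using s t by (simp add: one_dim heat_kernel_eq_prod_normal_density prod_ennreal)
  finally show ?thesis .
qed

text \<open>
  The heat kernel at time 1 is used as a smooth substitute for the indicator function of a ball:
  by the symmetry of the Green kernel and the semigroup law, its potential is the integral of the
  heat kernels over the times beyond 1, so that the singularity of the Green kernel disappears.
\<close>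

lemma nn_integral_heat_kernel_green_potential:
  fixes f :: "'a::euclidean_space \<Rightarrow> real"
  assumes [measurable]: "f \<in> borel_measurable borel"
  shows "(\<integral>\<^sup>+x. ennreal (heat_kernel 1 0 x) * green_potential f x \<partial>lborel)
    = (\<integral>\<^sup>+t\<in>{0<..}. (\<integral>\<^sup>+y. ennreal (heat_kernel (1 + t) 0 y) * ennreal (f y) \<partial>lborel) \<partial>lborel)"
proof -
  define k where "k x y t = ennreal (heat_kernel 1 0 x) * ennreal (heat_kernel t x y)
      * ennreal (f y) * indicator {0<..} t" for x y :: 'a and t :: real
  have [measurable]: "(\<lambda>w. k (X w) (Y w) (T w)) \<in> borel_measurable M"
    if [measurable]: "X \<in> borel_measurable M" "Y \<in> borel_measurable M" "T \<in> borel_measurable M"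
    for X Y T and M :: "'m measure"
    unfolding k_def by measurable
  have "(\<integral>\<^sup>+x. ennreal (heat_kernel 1 0 x) * green_potential f x \<partial>lborel)
      = (\<integral>\<^sup>+x. \<integral>\<^sup>+y. \<integral>\<^sup>+t. k x y t \<partial>lborel \<partial>lborel \<partial>lborel)"
  proof (intro nn_integral_cong)
    fix x :: 'a
    have "ennreal (heat_kernel 1 0 x) * green_potential f x
      = (\<integral>\<^sup>+y. ennreal (heat_kernel 1 0 x) * (green_kernel x y * ennreal (f y)) \<partial>lborel)"
      unfolding green_potential_def green_kernel_def by (subst nn_integral_cmult) auto
    also have "\<dots> = (\<integral>\<^sup>+y. \<integral>\<^sup>+t. k x y t \<partial>lborel \<partial>lborel)"
      unfolding green_kernel_def k_def
      by (intro nn_integral_cong, subst nn_integral_multc[symmetric], simp,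
        subst nn_integral_cmult[symmetric], simp) (auto intro!: nn_integral_cong simp: ac_simps)
    finally show "ennreal (heat_kernel 1 0 x) * green_potential f x = (\<integral>\<^sup>+y. \<integral>\<^sup>+t. k x y t \<partial>lborel \<partial>lborel)" .
  qed
  also have "\<dots> = (\<integral>\<^sup>+x. \<integral>\<^sup>+t. \<integral>\<^sup>+y. k x y t \<partial>lborel \<partial>lborel \<partial>lborel)"
    by (intro nn_integral_cong lborel_pair.Fubini') measurable
  also have "\<dots> = (\<integral>\<^sup>+t. \<integral>\<^sup>+x. \<integral>\<^sup>+y. k x y t \<partial>lborel \<partial>lborel \<partial>lborel)"
    by (intro lborel_pair.Fubini') measurable
  also have "\<dots> = (\<integral>\<^sup>+t. \<integral>\<^sup>+y. \<integral>\<^sup>+x. k x y t \<partial>lborel \<partial>lborel \<partial>lborel)"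
    by (intro nn_integral_cong lborel_pair.Fubini') measurable
  also have "\<dots> = (\<integral>\<^sup>+t\<in>{0<..}. (\<integral>\<^sup>+y. ennreal (heat_kernel (1 + t) 0 y) * ennreal (f y) \<partial>lborel) \<partial>lborel)"
  proof (intro nn_integral_cong)
    fix t :: real
    show "(\<integral>\<^sup>+y. \<integral>\<^sup>+x. k x y t \<partial>lborel \<partial>lborel)
      = (\<integral>\<^sup>+y. ennreal (heat_kernel (1 + t) 0 y) * ennreal (f y) \<partial>lborel) * indicator {0<..} t"
    proof (cases "0 < t")
      case True
      have "(\<integral>\<^sup>+x. k x y t \<partial>lborel) = ennreal (heat_kernel (1 + t) 0 y) * ennreal (f y)" for y
        using True heat_kernel_semigroup[of 1 t y]
        by (simp add: k_def nn_integral_multc)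
      then show ?thesis using True by simp
    next
      case False
      then show ?thesis by (simp add: k_def)
    qed
  qed
  finally show ?thesis .
qed

lemma nn_integral_powr_shifted:
  assumes "1 < e"
  shows "(\<integral>\<^sup>+t\<in>{0<..}. ennreal ((1 + t) powr (- e)) \<partial>lborel) = ennreal (1 / (e - 1))"
proof -
  have "(\<integral>\<^sup>+t\<in>{0<..}. ennreal ((1 + t) powr (- e)) \<partial>lborel)
      = (\<integral>\<^sup>+t. ennreal ((1 + t) powr (- e)) * indicator {0..} t \<partial>lborel)"
    using AE_lborel_singleton[of "0::real"]
    by (intro nn_integral_cong_AE) (auto elim!: eventually_mono simp: indicator_def)
  also have "\<dots> = ennreal (0 - (- ((1 + 0) powr (1 - e)) / (e - 1)))"
  proof (rule nn_integral_FTC_atLeast)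
    show "DERIV (\<lambda>t. - ((1 + t) powr (1 - e)) / (e - 1)) t :> (1 + t) powr (- e)" if "0 \<le> t" for t
    proof -
      have "((\<lambda>t. (1 + t) powr (1 - e)) has_real_derivative (1 - e) * (1 + t) powr (1 - e - 1) * 1) (at t)"
        by (rule DERIV_chain2[where g = "\<lambda>t. 1 + t" and f = "\<lambda>x. x powr (1 - e)", OF has_real_derivative_powr])
          (use that in \<open>auto intro!: derivative_eq_intros\<close>)
      from DERIV_cmult[OF this, of "- 1 / (e - 1)"]
      have "((\<lambda>t. - ((1 + t) powr (1 - e)) / (e - 1)) has_real_derivative
          (- 1 / (e - 1) * (1 - e)) * (1 + t) powr (1 - e - 1)) (at t)"
        by (simp add: mult.assoc)
      moreover have "- 1 / (e - 1) * (1 - e) = 1"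
        using assms by (simp add: divide_eq_eq)
      moreover have "1 - e - 1 = - e" by simp
      ultimately show ?thesis by (simp only: mult_1)
    qed
    have "((\<lambda>t. (1 + t) powr (1 - e)) \<longlongrightarrow> 0) at_top"
      using assms by (intro tendsto_neg_powr filterlim_tendsto_add_at_top[OF tendsto_const] filterlim_ident) auto
    then have "((\<lambda>t. - ((1 + t) powr (1 - e)) / (e - 1)) \<longlongrightarrow> - 0 / (e - 1)) at_top"
      using assms by (intro tendsto_intros) auto
    then show "((\<lambda>t. - ((1 + t) powr (1 - e)) / (e - 1)) \<longlongrightarrow> 0) at_top" by simp
  qed auto
  finally show ?thesis by simp
qed

text \<open>
  If the potential of \<open>f\<close> is at least 1 on the unit ball, then the pairing of this
  potential with the heat kernel at time 1 is bounded below. It is bounded above by the norm of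
  \<open>f\<close> times the integral of \<open>(1 + t) powr (- D / 2)\<close> over \<open>t > 0\<close>,
  which converges for \<open>D > 2\<close>. Hence the norm of \<open>f\<close> cannot be small.
\<close>

theorem not_mixed_parabolic:
  assumes p: "1 < p1" "1 < q1" "1 / p1 + 1 / q1 = 1" "1 < p2" "1 < q2" "1 / p2 + 1 / q2 = 1"
    and D: "2 < DIM('a) / p1 + DIM('b) / p2"
  shows "\<not> mixed_parabolic TYPE('a::euclidean_space \<times> 'b::euclidean_space) p1 p2"
proof
  assume para: "mixed_parabolic TYPE('a \<times> 'b) p1 p2"
  define D' where "D' = DIM('a) / p1 + DIM('b) / p2"
  define n where "n = real DIM('a \<times> 'b)"
  have dual: "DIM('a) / q1 + DIM('b) / q2 = n - D'"
  proof -
    have "DIM('a) / q1 + DIM('b) / q2 = (DIM('a) - DIM('a) / p1) + (DIM('b) - DIM('b) / p2)"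
      unfolding conjugate_exponent_divide[OF p(3)] conjugate_exponent_divide[OF p(6)] ..
    then show ?thesis
      unfolding D'_def n_def by simp
  qed
  have "1 / q1 + 1 / p1 = 1" "1 / q2 + 1 / p2 = 1" using p by auto
  note dual_exponents = p(2,1) this(1) p(5,4) this(2)
  obtain C where C: "0 < C" and pairing: "\<And>(f :: 'a \<times> 'b \<Rightarrow> real) a. f \<in> borel_measurable borel \<Longrightarrow> 0 < a \<Longrightarrow>
      (\<integral>\<^sup>+z. ennreal \<bar>f z\<bar> * ennreal (exp (- a * (norm z)\<^sup>2)) \<partial>lborel)
        \<le> mixed_norm p1 p2 f * ennreal (C * a powr (- (n - D') / 2))"
    using mixed_norm_gaussian_pairing[where 'a = 'a and 'b = 'b, OF dual_exponents, unfolded dual] by blast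
  define C' where "C' = C * (4 * pi) powr (- n / 2) * 4 powr ((n - D') / 2)"
  have C': "C' > 0" using C by (simp add: C'_def)
  define K where "K = C' * (1 / (D' / 2 - 1))"
  have D': "D' > 2" using D by (simp add: D'_def)
  then have K: "K > 0" using C' by (simp add: K_def)
  have decay: "(\<integral>\<^sup>+y. ennreal (heat_kernel s 0 y) * ennreal (f y) \<partial>lborel)
      \<le> mixed_norm p1 p2 f * ennreal (C' * s powr (- (D' / 2)))"
    if f: "f \<in> borel_measurable borel" and s: "0 < s" for f :: "'a \<times> 'b \<Rightarrow> real" and s
  proof -
    note [measurable] = f
    have hk: "heat_kernel s 0 y = (4 * pi * s) powr (- n / 2) * exp (- (1 / (4 * s)) * (norm y)\<^sup>2)" for y :: "'a \<times> 'b"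
    proof -
      have "- n / 2 = - (n / 2)" by simp
      then have 1: "(4 * pi * s) powr (- n / 2) = inverse ((4 * pi * s) powr (n / 2))"
        by (simp only: powr_minus)
      have 2: "- (dist 0 y)\<^sup>2 / (4 * s) = - (1 / (4 * s)) * (norm y)\<^sup>2"
        by simp
      show ?thesis
        unfolding heat_kernel_def 1 2 n_def[symmetric] by (simp only: divide_inverse mult.commute)
    qed
    have "(\<integral>\<^sup>+y. ennreal (heat_kernel s 0 y) * ennreal (f y) \<partial>lborel)
      \<le> (\<integral>\<^sup>+y. ennreal ((4 * pi * s) powr (- n / 2)) *
            (ennreal \<bar>f y\<bar> * ennreal (exp (- (1 / (4 * s)) * (norm y)\<^sup>2))) \<partial>lborel)"
    proof (intro nn_integral_mono)
      fix y
      have "ennreal (heat_kernel s 0 y) * ennreal (f y) \<le> ennreal (heat_kernel s 0 y) * ennreal \<bar>f y\<bar>"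
        by (intro mult_left_mono ennreal_leI) auto
      also have "\<dots> = ennreal ((4 * pi * s) powr (- n / 2)) *
            (ennreal \<bar>f y\<bar> * ennreal (exp (- (1 / (4 * s)) * (norm y)\<^sup>2)))"
        unfolding hk by (subst ennreal_mult) (simp_all only: powr_ge_zero exp_ge_zero ac_simps)
      finally show "ennreal (heat_kernel s 0 y) * ennreal (f y) \<le> ennreal ((4 * pi * s) powr (- n / 2)) *
            (ennreal \<bar>f y\<bar> * ennreal (exp (- (1 / (4 * s)) * (norm y)\<^sup>2)))" .
    qed
    also have "\<dots> = ennreal ((4 * pi * s) powr (- n / 2)) *
        (\<integral>\<^sup>+y. ennreal \<bar>f y\<bar> * ennreal (exp (- (1 / (4 * s)) * (norm y)\<^sup>2)) \<partial>lborel)"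
      by (intro nn_integral_cmult) measurable
    also have "\<dots> \<le> ennreal ((4 * pi * s) powr (- n / 2)) *
        (mixed_norm p1 p2 f * ennreal (C * (1 / (4 * s)) powr (- (n - D') / 2)))"
      using s by (intro mult_left_mono pairing f) auto
    also have "\<dots> = mixed_norm p1 p2 f * ennreal ((4 * pi * s) powr (- n / 2) * (C * (1 / (4 * s)) powr (- (n - D') / 2)))"
      using C by (simp add: ennreal_mult ac_simps)
    also have "(4 * pi * s) powr (- n / 2) * (C * (1 / (4 * s)) powr (- (n - D') / 2)) = C' * s powr (- (D' / 2))"
    proof -
      have 1: "(4 * pi * s) powr (- n / 2) = (4 * pi) powr (- n / 2) * s powr (- n / 2)"
        by (rule powr_mult)
      have "- (n - D') / 2 = - ((n - D') / 2)"
        by (rule minus_divide_left[symmetric])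
      then have "(1 / (4 * s)) powr (- (n - D') / 2) = inverse ((1 / (4 * s)) powr ((n - D') / 2))"
        by (simp only: powr_minus)
      also have "\<dots> = (4 * s) powr ((n - D') / 2)"
        using s by (simp add: powr_divide)
      also have "\<dots> = 4 powr ((n - D') / 2) * s powr ((n - D') / 2)"
        by (rule powr_mult)
      finally have 2: "(1 / (4 * s)) powr (- (n - D') / 2) = 4 powr ((n - D') / 2) * s powr ((n - D') / 2)" .
      have "s powr (- n / 2) * s powr ((n - D') / 2) = s powr (- (D' / 2))"
        unfolding powr_add[symmetric] by (rule arg_cong[where f = "(powr) s"]) argo
      then show ?thesis
        unfolding 1 2 C'_def by (simp add: ac_simps)
    qed
    finally show ?thesis .
  qed
  define B where "B = cball (0 :: 'a \<times> 'b) 1"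
  define d where "d = (\<integral>\<^sup>+x\<in>B. ennreal (heat_kernel 1 0 x) \<partial>lborel)"
  have [measurable]: "B \<in> sets borel" by (simp add: B_def)
  have lower: "d \<le> mixed_norm p1 p2 f * ennreal K"
    if f: "f \<in> borel_measurable borel" and pot: "\<And>x. indicator B x \<le> green_potential f x" for f
  proof -
    have "d \<le> (\<integral>\<^sup>+x. ennreal (heat_kernel 1 0 x) * green_potential f x \<partial>lborel)"
      unfolding d_def using pot by (intro nn_integral_mono mult_left_mono) auto
    also have "\<dots> = (\<integral>\<^sup>+t\<in>{0<..}. (\<integral>\<^sup>+y. ennreal (heat_kernel (1 + t) 0 y) * ennreal (f y) \<partial>lborel) \<partial>lborel)"
      by (rule nn_integral_heat_kernel_green_potential[OF f])
    also have "\<dots> \<le> (\<integral>\<^sup>+t. mixed_norm p1 p2 f * ennreal C' * (ennreal ((1 + t) powr (- (D' / 2))) * indicator {0<..} t) \<partial>lborel)"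
    proof (intro nn_integral_mono)
      fix t :: real
      show "(\<integral>\<^sup>+y. ennreal (heat_kernel (1 + t) 0 y) * ennreal (f y) \<partial>lborel) * indicator {0<..} t
        \<le> mixed_norm p1 p2 f * ennreal C' * (ennreal ((1 + t) powr (- (D' / 2))) * indicator {0<..} t)"
        using decay[OF f, of "1 + t"] C' by (cases "0 < t") (auto simp: ennreal_mult mult.assoc)
    qed
    also have "\<dots> = mixed_norm p1 p2 f * ennreal C' * (\<integral>\<^sup>+t\<in>{0<..}. ennreal ((1 + t) powr (- (D' / 2))) \<partial>lborel)"
      by (intro nn_integral_cmult) measurable
    also have "\<dots> = mixed_norm p1 p2 f * ennreal K"
      using D' C' by (subst nn_integral_powr_shifted) (auto simp: K_def ennreal_mult[symmetric] mult.assoc)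
    finally show ?thesis .
  qed
  have "d \<noteq> 0"
  proof
    assume "d = 0"
    then have "AE x in lborel. ennreal (heat_kernel 1 0 x) * indicator B x = 0"
      unfolding d_def by (subst (asm) nn_integral_0_iff_AE) auto
    then have "AE x in lborel. x \<notin> B"
      by eventually_elim (auto simp: heat_kernel_def indicator_def split: if_splits)
    then have "emeasure lborel B = 0"
      by (subst (asm) AE_iff_measurable[of B]) auto
    then show False
      using unit_ball_vol_pos[of "real DIM('a) + real DIM('b)"] by (simp add: B_def emeasure_cball)
  qed
  moreover have "d \<le> 1"
    unfolding d_def nn_integral_heat_kernel[of 1 "0 :: 'a \<times> 'b", OF zero_less_one, symmetric]
    by (intro nn_integral_mono) (auto simp: indicator_def)
  ultimately obtain d' where d': "d = ennreal d'" "0 < d'"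
    by (cases d) (auto simp: top_unique)
  have "ennreal ((d' / K) powr p2) \<le> mixed_capacity p1 p2 B"
    unfolding mixed_capacity_def
  proof (rule INF_greatest)
    fix f :: "'a \<times> 'b \<Rightarrow> real"
    assume "f \<in> {f \<in> mixed_Lp p1 p2. (AE x in lborel. 0 \<le> f x) \<and> (\<forall>x. indicator B x \<le> green_potential f x)}"
    then have le: "ennreal d' \<le> mixed_norm p1 p2 f * ennreal K"
      using lower[of f] by (auto simp: mixed_Lp_def d')
    show "ennreal ((d' / K) powr p2) \<le> ennreal_powr (mixed_norm p1 p2 f) p2"
    proof (cases "mixed_norm p1 p2 f")
      case (real r)
      with le K have "d' \<le> r * K" by (simp add: ennreal_mult[symmetric])
      then have "d' / K \<le> r" using K by (simp add: field_simps)
      then show ?thesis using real d' K p by (auto simp: ennreal_powr_ennreal intro!: ennreal_leI powr_mono2)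
    qed (simp add: ennreal_powr_def)
  qed
  moreover have "mixed_capacity p1 p2 B = 0"
    using para[unfolded mixed_parabolic_def, rule_format, of "ball 0 1"] by (simp add: B_def)
  ultimately show False using d' K by simp
qed


section \<open>Zero capacity in small effective dimension\<close>

text \<open>
  The times between \<open>L\<^sup>2\<close> and \<open>2 * L\<^sup>2\<close> alone contribute this much. The bound has the
  order of the Green kernel in dimensions above 2 and remains true where the Green kernel is
  infinite.
\<close>

lemma green_kernel_lower_bound:
  fixes x y :: "'a::euclidean_space"
  assumes L: "0 < L" and d: "dist x y \<le> L"
  shows "ennreal (exp (- (1 / 4)) / (8 * pi) powr (DIM('a) / 2) * (L\<^sup>2 / L ^ DIM('a))) \<le> green_kernel x y"
proof -
  define \<kappa> where "\<kappa> = exp (- (1 / 4)) / (8 * pi * L\<^sup>2) powr (DIM('a) / 2)"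
  have hk: "\<kappa> \<le> heat_kernel t x y" if t: "L\<^sup>2 \<le> t" "t \<le> 2 * L\<^sup>2" for t
  proof -
    have t0: "0 < t" using t(1) L by (meson less_le_trans zero_less_power)
    have "(dist x y)\<^sup>2 \<le> t"
      using t(1) power_mono[OF d, of 2] by simp
    then have "(dist x y)\<^sup>2 / (4 * t) \<le> t / (4 * t)"
      using t0 by (intro divide_right_mono) auto
    also have "t / (4 * t) = 1 / 4"
      using t0 by simp
    finally have "- (1 / 4) \<le> - ((dist x y)\<^sup>2 / (4 * t))"
      by (rule le_imp_neg_le)
    then have "- (1 / 4) \<le> - (dist x y)\<^sup>2 / (4 * t)"
      by (simp only: minus_divide_left)
    moreover have "(4 * pi * t) powr (DIM('a) / 2) \<le> (8 * pi * L\<^sup>2) powr (DIM('a) / 2)"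
      using mult_left_mono[OF t(2), of "4 * pi"] t0 by (intro powr_mono2) auto
    moreover have "0 < (4 * pi * t) powr (DIM('a) / 2)" using t0 by simp
    ultimately show ?thesis
      unfolding \<kappa>_def heat_kernel_def by (intro frac_le exp_ge_zero) (simp_all only: exp_le_cancel_iff)
  qed
  have "(L\<^sup>2) powr (DIM('a) / 2) = L ^ DIM('a)"
  proof -
    have "(L\<^sup>2) powr (DIM('a) / 2) = (L powr 2) powr (DIM('a) / 2)"
      using L by simp
    also have "\<dots> = L powr DIM('a)" unfolding powr_powr by simp
    also have "\<dots> = L ^ DIM('a)" using L by (rule powr_realpow)
    finally show ?thesis .
  qed
  then have "exp (- (1 / 4)) / (8 * pi) powr (DIM('a) / 2) * (L\<^sup>2 / L ^ DIM('a)) = \<kappa> * L\<^sup>2"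
    by (simp add: \<kappa>_def powr_mult)
  also have "ennreal (\<kappa> * L\<^sup>2) = (\<integral>\<^sup>+t. ennreal \<kappa> * indicator {L\<^sup>2..2 * L\<^sup>2} t \<partial>lborel)"
  proof -
    have "0 \<le> \<kappa>" by (simp add: \<kappa>_def)
    then show ?thesis by (simp add: nn_integral_cmult_indicator ennreal_mult)
  qed
  also have "\<dots> \<le> green_kernel x y"
    unfolding green_kernel_def
  proof (intro nn_integral_mono)
    fix t :: real
    have "0 < t" if "L\<^sup>2 \<le> t" using that L by (meson less_le_trans zero_less_power)
    then show "ennreal \<kappa> * indicator {L\<^sup>2..2 * L\<^sup>2} t \<le> ennreal (heat_kernel t x y) * indicator {0<..} t"
      using hk[of t] by (auto simp: indicator_def intro!: ennreal_leI)
  qed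
  finally show ?thesis .
qed

definition dyadic_annulus :: "nat \<Rightarrow> 'a::euclidean_space set" where
  "dyadic_annulus k = ball 0 (2 ^ Suc k) - ball 0 (2 ^ k)"

lemma borel_dyadic_annulus [measurable]: "dyadic_annulus k \<in> sets borel"
  unfolding dyadic_annulus_def by measurable

lemma dyadic_annulus_disjoint:
  assumes "x \<in> dyadic_annulus k" "x \<in> dyadic_annulus j"
  shows "k = j"
proof -
  have "k \<le> j" if "x \<in> dyadic_annulus k" "x \<in> dyadic_annulus j" for k j
  proof (rule ccontr)
    assume "\<not> k \<le> j"
    then have "(2::real) ^ Suc j \<le> 2 ^ k" by (intro power_increasing) auto
    then show False using that by (auto simp: dyadic_annulus_def)
  qed
  from this[OF assms] this[OF assms(2,1)] show ?thesis by simp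
qed

lemma emeasure_dyadic_annulus:
  "emeasure lborel (dyadic_annulus k :: 'a::euclidean_space set)
    = ennreal (unit_ball_vol DIM('a) * (2 ^ DIM('a) - 1) * (2 ^ k) ^ DIM('a))"
proof -
  have "emeasure lborel (dyadic_annulus k :: 'a set)
    = emeasure lborel (ball 0 (2 ^ Suc k) :: 'a set) - emeasure lborel (ball 0 (2 ^ k) :: 'a set)"
    unfolding dyadic_annulus_def
    by (intro emeasure_Diff) (auto simp: emeasure_ball intro!: subset_ball)
  also have "\<dots> = ennreal (unit_ball_vol DIM('a) * (2 ^ Suc k) ^ DIM('a) - unit_ball_vol DIM('a) * (2 ^ k) ^ DIM('a))"
    by (simp only: emeasure_ball zero_le_power zero_le_numeral) (simp add: ennreal_minus)
  also have "unit_ball_vol DIM('a) * (2 ^ Suc k) ^ DIM('a) - unit_ball_vol DIM('a) * (2 ^ k) ^ DIM('a)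
    = unit_ball_vol DIM('a) * (2 ^ DIM('a) - 1) * (2 ^ k) ^ DIM('a)"
    by (simp add: power_mult_distrib algebra_simps)
  finally show ?thesis .
qed

lemma emeasure_lborel_Times:
  assumes "A \<in> sets borel" "B \<in> sets borel"
  shows "emeasure lborel (A \<times> B :: ('a::euclidean_space \<times> 'b::euclidean_space) set)
    = emeasure lborel A * emeasure lborel B"
  using lborel.emeasure_pair_measure_Times[of A lborel B] assms by (simp add: lborel_prod)

text \<open>
  A superposition of \<open>N\<close> dyadic scales. The factor \<open>1 / 4 ^ k\<close> makes every scale
  contribute the same amount to the potential, so that the potential grows linearly in \<open>N\<close>.
  The supports are disjoint in the outer variable, so that the \<open>p2\<close>-th powers of the norms
  of the scales add up; for \<open>D \<le> 2\<close> each of them is bounded, and the norm grows at most like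
  \<open>N powr (1 / p2)\<close>.
\<close>

definition multiscale_profile ::
  "real \<Rightarrow> nat \<Rightarrow> nat \<Rightarrow> 'a::euclidean_space \<times> 'b::euclidean_space \<Rightarrow> real" where
  "multiscale_profile c m N z = (\<Sum>k\<in>{m..<m + N}. c / 4 ^ k * indicator (cball 0 (2 ^ k) \<times> dyadic_annulus k) z)"

lemma measurable_multiscale_profile [measurable]: "multiscale_profile c m N \<in> borel_measurable borel"
proof -
  have "cball 0 (2 ^ k) \<times> dyadic_annulus k \<in> sets (borel :: ('a \<times> 'b) measure)" for k
    unfolding borel_prod[symmetric] by measurable
  then show ?thesis unfolding multiscale_profile_def by measurable
qed

lemma multiscale_profile_nonneg: "0 \<le> c \<Longrightarrow> 0 \<le> multiscale_profile c m N z"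
  by (auto simp: multiscale_profile_def intro!: sum_nonneg)

lemma multiscale_profile_potential:
  "\<exists>\<kappa>>0. \<forall>c m N x. 0 \<le> c \<longrightarrow> norm x \<le> 2 ^ m \<longrightarrow>
    ennreal (\<kappa> * c * real N)
      \<le> green_potential (multiscale_profile c m N :: 'a::euclidean_space \<times> 'b::euclidean_space \<Rightarrow> real) x"
proof -
  define n where "n = DIM('a \<times> 'b)"
  define g where "g = exp (- (1 / 4)) / (8 * pi) powr (n / 2)"
  define V where "V = unit_ball_vol DIM('a) * (unit_ball_vol DIM('b) * (2 ^ DIM('b) - 1))"
  define \<kappa> where "\<kappa> = g * 16 / 4 ^ n * V"
  have "(1::real) < 2 ^ DIM('b)" by (rule one_less_power) auto
  then have V: "V > 0" by (simp add: V_def)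
  have g: "g > 0" by (simp add: g_def)
  have "\<kappa> > 0" using V g by (simp add: \<kappa>_def)
  moreover have "ennreal (\<kappa> * c * real N) \<le> green_potential (multiscale_profile c m N) x"
    if c: "0 \<le> c" and x: "norm x \<le> 2 ^ m" for c m N and x :: "'a \<times> 'b"
  proof -
    define S where "S k = (cball 0 (2 ^ k) \<times> dyadic_annulus k :: ('a \<times> 'b) set)" for k
    have S [measurable]: "S k \<in> sets borel" for k
      unfolding S_def borel_prod[symmetric] by measurable
    have vol: "emeasure lborel (S k) = ennreal (V * (2 ^ k) ^ n)" for k
      unfolding S_def using V
      by (subst emeasure_lborel_Times)
        (auto simp: emeasure_cball emeasure_dyadic_annulus V_def n_def power_add
           ennreal_mult[symmetric] mult_ac)
    have scale: "ennreal (\<kappa> * c) \<le> (\<integral>\<^sup>+y. green_kernel x y * (ennreal (c / 4 ^ k) * indicator (S k) y) \<partial>lborel)"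
      if k: "m \<le> k" for k
    proof -
      \<comment> \<open>A bound for the distance from \<open>x\<close> to every point of the \<open>k\<close>-th support.\<close>
      define L :: real where "L = 4 * 2 ^ k"
      have L: "L > 0" by (simp add: L_def)
      have near: "dist x y \<le> L" if "y \<in> S k" for y
      proof -
        have "dist x y \<le> norm x + norm y" by (simp add: dist_norm norm_triangle_ineq4)
        moreover have "norm y \<le> norm (fst y) + norm (snd y)"
          using norm_Pair_le[of "fst y" "snd y"] by simp
        moreover have "norm (fst y) \<le> 2 ^ k" "norm (snd y) \<le> 2 * 2 ^ k"
          using that by (auto simp: S_def dyadic_annulus_def)
        moreover have "norm x \<le> 2 ^ k"
          using x k power_increasing[of m k "2::real"] by linarith
        ultimately show ?thesis unfolding L_def by linarith
      qed
      have "c * \<kappa> = g * (L\<^sup>2 / L ^ n) * (c / 4 ^ k) * (V * (2 ^ k) ^ n)"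
      proof -
        have "(4::real) ^ k = 2 ^ k * 2 ^ k" by (simp add: power_mult_distrib[symmetric])
        then show ?thesis by (simp add: \<kappa>_def L_def power_mult_distrib power2_eq_square)
      qed
      then have "ennreal (\<kappa> * c) = ennreal (g * (L\<^sup>2 / L ^ n) * (c / 4 ^ k) * (V * (2 ^ k) ^ n))"
        by (simp only: mult.commute)
      also have "\<dots> = ennreal (g * (L\<^sup>2 / L ^ n) * (c / 4 ^ k)) * emeasure lborel (S k)"
        unfolding vol using g c V L by (subst ennreal_mult) auto
      also have "\<dots> = (\<integral>\<^sup>+y. ennreal (g * (L\<^sup>2 / L ^ n) * (c / 4 ^ k)) * indicator (S k) y \<partial>lborel)"
        by (simp add: nn_integral_cmult_indicator)
      also have "\<dots> \<le> (\<integral>\<^sup>+y. green_kernel x y * (ennreal (c / 4 ^ k) * indicator (S k) y) \<partial>lborel)"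
      proof (intro nn_integral_mono)
        fix y
        have "ennreal (g * (L\<^sup>2 / L ^ n) * (c / 4 ^ k)) \<le> green_kernel x y * ennreal (c / 4 ^ k)" if "y \<in> S k"
        proof -
          have "ennreal (g * (L\<^sup>2 / L ^ n) * (c / 4 ^ k)) = ennreal (g * (L\<^sup>2 / L ^ n)) * ennreal (c / 4 ^ k)"
            using g L c by (intro ennreal_mult) auto
          also have "ennreal (g * (L\<^sup>2 / L ^ n)) \<le> green_kernel x y"
            using green_kernel_lower_bound[OF L near[OF that]] by (simp add: g_def n_def)
          finally show ?thesis by (simp add: mult_right_mono)
        qed
        then show "ennreal (g * (L\<^sup>2 / L ^ n) * (c / 4 ^ k)) * indicator (S k) y
            \<le> green_kernel x y * (ennreal (c / 4 ^ k) * indicator (S k) y)"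
          by (auto simp: indicator_def)
      qed
      finally show ?thesis .
    qed
    have [measurable]: "(\<lambda>y. green_kernel x y) \<in> borel_measurable borel"
      unfolding green_kernel_def heat_kernel_def by measurable
    have prof: "ennreal (multiscale_profile c m N y) = (\<Sum>k\<in>{m..<m + N}. ennreal (c / 4 ^ k) * indicator (S k) y)" for y
    proof -
      have "ennreal (multiscale_profile c m N y) = (\<Sum>k\<in>{m..<m + N}. ennreal (c / 4 ^ k * indicator (S k) y))"
        unfolding multiscale_profile_def S_def[symmetric] using c by (intro sum_ennreal[symmetric]) auto
      also have "\<dots> = (\<Sum>k\<in>{m..<m + N}. ennreal (c / 4 ^ k) * indicator (S k) y)"
        by (intro sum.cong refl) (auto simp: indicator_def)
      finally show ?thesis .
    qed
    have "ennreal (\<kappa> * c * real N) = (\<Sum>k\<in>{m..<m + N}. ennreal (\<kappa> * c))"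
      using \<open>\<kappa> > 0\<close> c by (simp add: ennreal_of_nat_eq_real_of_nat ennreal_mult[symmetric] mult.commute)
    also have "\<dots> \<le> (\<Sum>k\<in>{m..<m + N}. \<integral>\<^sup>+y. green_kernel x y * (ennreal (c / 4 ^ k) * indicator (S k) y) \<partial>lborel)"
      using scale by (intro sum_mono) auto
    also have "\<dots> = (\<integral>\<^sup>+y. (\<Sum>k\<in>{m..<m + N}. green_kernel x y * (ennreal (c / 4 ^ k) * indicator (S k) y)) \<partial>lborel)"
      by (intro nn_integral_sum[symmetric]) measurable
    also have "\<dots> = green_potential (multiscale_profile c m N) x"
      unfolding green_potential_def prof sum_distrib_left ..
    finally show ?thesis .
  qed
  ultimately show ?thesis by blast
qed

text \<open>
  Up to a constant, the \<open>k\<close>-th scale contributes \<open>(2 ^ k) powr (p2 * (D - 2))\<close>, which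
  is at most 1 because \<open>k \<ge> 0\<close> and \<open>D \<le> 2\<close>.
\<close>

lemma multiscale_profile_norm:
  assumes p: "1 < p1" "1 < p2" and D: "DIM('a) / p1 + DIM('b) / p2 \<le> 2" and c: "0 < c"
  shows "ennreal_powr (mixed_norm p1 p2
      (multiscale_profile c m N :: 'a::euclidean_space \<times> 'b::euclidean_space \<Rightarrow> real)) p2
    \<le> ennreal (real N * (c powr p2 * (unit_ball_vol DIM('a) powr (p2 / p1)
          * (unit_ball_vol DIM('b) * (2 ^ DIM('b) - 1)))))"
proof -
  define V1 V2 where "V1 = unit_ball_vol DIM('a)" and "V2 = unit_ball_vol DIM('b) * (2 ^ DIM('b) - 1)"
  have "(1::real) < 2 ^ DIM('b)" by (rule one_less_power) auto
  then have V: "V1 > 0" "V2 > 0" by (simp_all add: V1_def V2_def)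
  let ?f = "multiscale_profile c m N :: 'a \<times> 'b \<Rightarrow> real"
  define a where "a k = (c / 4 ^ k) powr p1 * (V1 * (2 ^ k) ^ DIM('a))" for k :: nat
  have a: "a k > 0" for k using c V by (simp add: a_def)
  have slice: "(\<integral>\<^sup>+x. ennreal (\<bar>?f (x, y)\<bar> powr p1) \<partial>lborel)
      = (if \<exists>k\<in>{m..<m + N}. y \<in> dyadic_annulus k then ennreal (a (THE k. y \<in> dyadic_annulus k)) else 0)" for y
  proof (cases "\<exists>k\<in>{m..<m + N}. y \<in> dyadic_annulus k")
    case True
    then obtain k where k: "k \<in> {m..<m + N}" "y \<in> dyadic_annulus k" by blast
    have the: "(THE k. y \<in> dyadic_annulus k) = k"
      using k dyadic_annulus_disjoint by blast
    have single: "?f (x, y) = c / 4 ^ k * indicator (cball 0 (2 ^ k)) x" for x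
    proof -
      have "?f (x, y) = (\<Sum>j\<in>{m..<m + N}. if j = k then c / 4 ^ k * indicator (cball 0 (2 ^ k)) x else 0)"
        unfolding multiscale_profile_def
      proof (intro sum.cong refl)
        fix j
        show "c / 4 ^ j * indicator (cball 0 (2 ^ j) \<times> dyadic_annulus j) (x, y)
          = (if j = k then c / 4 ^ k * indicator (cball 0 (2 ^ k)) x else 0)"
        proof (cases "j = k")
          case True
          then show ?thesis using k(2) by (simp add: indicator_def)
        next
          case False
          then have "y \<notin> dyadic_annulus j" using k(2) dyadic_annulus_disjoint by blast
          then show ?thesis using False by simp
        qed
      qed
      then show ?thesis using k(1) by simp
    qed
    have "(\<integral>\<^sup>+x. ennreal (\<bar>?f (x, y)\<bar> powr p1) \<partial>lborel)
      = (\<integral>\<^sup>+(x::'a). ennreal ((c / 4 ^ k) powr p1) * indicator (cball 0 (2 ^ k)) x \<partial>lborel)"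
    proof (intro nn_integral_cong)
      fix x
      show "ennreal (\<bar>?f (x, y)\<bar> powr p1) = ennreal ((c / 4 ^ k) powr p1) * indicator (cball 0 (2 ^ k)) x"
        unfolding single
        using c by (auto simp: indicator_def)
    qed
    also have "\<dots> = ennreal (a k)"
      using V by (simp add: nn_integral_cmult_indicator emeasure_cball a_def V1_def ennreal_mult)
    finally show ?thesis using True the by simp
  next
    case False
    then have "?f (x, y) = 0" for x
      unfolding multiscale_profile_def by (intro sum.neutral) auto
    then show ?thesis using False by simp
  qed
  have term_le: "a k powr (p2 / p1) * (V2 * (2 ^ k) ^ DIM('b)) \<le> c powr p2 * (V1 powr (p2 / p1) * V2)" for k
  proof -
    define r :: real where "r = 2 ^ k"
    have r: "r \<ge> 1" by (simp add: r_def)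
    have r4: "(4::real) ^ k = r powr 2"
      by (simp add: r_def powr_numeral power_mult_distrib[symmetric] power2_eq_square)
    have "a k powr (p2 / p1) = (c / r powr 2) powr p2 * (V1 powr (p2 / p1) * r powr (DIM('a) * (p2 / p1)))"
    proof -
      have 1: "r ^ DIM('a) = r powr DIM('a)" using r by (simp add: powr_realpow)
      have 2: "p1 * (p2 / p1) = p2" using p by simp
      show ?thesis
        unfolding a_def r4 r_def[symmetric] powr_mult powr_powr 1 2 ..
    qed
    also have "(c / r powr 2) powr p2 = c powr p2 * r powr (- (2 * p2))"
    proof -
      have "(c / r powr 2) powr p2 = c powr p2 / r powr (2 * p2)"
        using c r by (simp add: powr_divide powr_powr del: powr_numeral)
      then show ?thesis by (simp only: powr_minus divide_inverse)
    qed
    finally have "a k powr (p2 / p1) * (V2 * r ^ DIM('b))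
      = c powr p2 * (V1 powr (p2 / p1) * V2) * (r powr (- (2 * p2)) * r powr (DIM('a) * (p2 / p1)) * r powr DIM('b))"
      using r by (simp add: powr_realpow)
    moreover have "r powr (- (2 * p2)) * r powr (DIM('a) * (p2 / p1)) * r powr DIM('b) \<le> 1"
    proof -
      have "r powr (- (2 * p2)) * r powr (DIM('a) * (p2 / p1)) * r powr DIM('b)
        = r powr (p2 * (DIM('a) / p1 + DIM('b) / p2 - 2))"
        unfolding powr_add[symmetric] using p by (intro arg_cong[where f = "(powr) r"]) (simp add: field_simps)
      also have "\<dots> \<le> r powr 0"
        using r p D by (intro powr_mono mult_nonneg_nonpos) auto
      finally show ?thesis using r by simp
    qed
    ultimately show ?thesis
      using c V by (simp add: r_def mult_left_le)
  qed
  have "ennreal_powr (mixed_norm p1 p2 ?f) p2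
     = (\<integral>\<^sup>+y. ennreal_powr (\<integral>\<^sup>+x. ennreal (\<bar>?f (x, y)\<bar> powr p1) \<partial>lborel) (p2 / p1) \<partial>lborel)"
    using p by (simp add: mixed_norm_def ennreal_powr_powr ennreal_powr_one)
  also have "\<dots> \<le> (\<integral>\<^sup>+(y::'b). (\<Sum>k\<in>{m..<m + N}. ennreal (a k powr (p2 / p1)) * indicator (dyadic_annulus k) y) \<partial>lborel)"
  proof (intro nn_integral_mono)
    fix y :: 'b
    show "ennreal_powr (\<integral>\<^sup>+x. ennreal (\<bar>?f (x, y)\<bar> powr p1) \<partial>lborel) (p2 / p1)
      \<le> (\<Sum>k\<in>{m..<m + N}. ennreal (a k powr (p2 / p1)) * indicator (dyadic_annulus k) y)"
    proof (cases "\<exists>k\<in>{m..<m + N}. y \<in> dyadic_annulus k")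
      case True
      then obtain k where k: "k \<in> {m..<m + N}" "y \<in> dyadic_annulus k" by blast
      have "(THE k. y \<in> dyadic_annulus k) = k"
        using k dyadic_annulus_disjoint by blast
      then have "ennreal_powr (\<integral>\<^sup>+x. ennreal (\<bar>?f (x, y)\<bar> powr p1) \<partial>lborel) (p2 / p1)
        = ennreal (a k powr (p2 / p1)) * indicator (dyadic_annulus k) y"
        using True k a[of k] by (simp add: slice ennreal_powr_ennreal less_imp_le)
      also have "\<dots> \<le> (\<Sum>k\<in>{m..<m + N}. ennreal (a k powr (p2 / p1)) * indicator (dyadic_annulus k) y)"
        using k(1) by (intro member_le_sum) auto
      finally show ?thesis .
    qed (simp add: slice ennreal_powr_0)
  qed
  also have "\<dots> = (\<Sum>k\<in>{m..<m + N}. ennreal (a k powr (p2 / p1)) * emeasure lborel (dyadic_annulus k :: 'b set))"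
    by (subst nn_integral_sum) (auto simp: nn_integral_cmult_indicator)
  also have "\<dots> \<le> (\<Sum>k\<in>{m..<m + N}. ennreal (c powr p2 * (V1 powr (p2 / p1) * V2)))"
  proof (intro sum_mono)
    fix k
    have "ennreal (a k powr (p2 / p1)) * emeasure lborel (dyadic_annulus k :: 'b set)
      = ennreal (a k powr (p2 / p1) * (V2 * (2 ^ k) ^ DIM('b)))"
      using V by (simp add: emeasure_dyadic_annulus V2_def ennreal_mult)
    then show "ennreal (a k powr (p2 / p1)) * emeasure lborel (dyadic_annulus k :: 'b set)
      \<le> ennreal (c powr p2 * (V1 powr (p2 / p1) * V2))"
      using term_le[of k] by (simp add: ennreal_leI)
  qed
  also have "\<dots> = ennreal (real N * (c powr p2 * (V1 powr (p2 / p1) * V2)))"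
    using V c by (simp add: ennreal_of_nat_eq_real_of_nat ennreal_mult)
  finally show ?thesis by (simp add: V1_def V2_def)
qed

text \<open>
  With \<open>c\<close> of order \<open>1 / N\<close> the potential of the profile is at least 1 on a ball
  containing \<open>E\<close>, whereas the \<open>p2\<close>-th power of its norm is of order
  \<open>N powr (1 - p2)\<close> and tends to 0.
\<close>

theorem mixed_parabolicI:
  assumes p: "1 < p1" "1 < p2" and D: "DIM('a) / p1 + DIM('b) / p2 \<le> 2"
  shows "mixed_parabolic TYPE('a::euclidean_space \<times> 'b::euclidean_space) p1 p2"
  unfolding mixed_parabolic_def
proof (intro allI impI)
  fix E :: "('a \<times> 'b) set"
  assume "open E \<and> compact (closure E)"
  then obtain R where R: "\<And>x. x \<in> closure E \<Longrightarrow> norm x \<le> R"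
    using compact_imp_bounded bounded_iff by metis
  obtain m where m: "R < 2 ^ m"
    using real_arch_pow[of 2 R] by auto
  obtain \<kappa> where \<kappa>: "\<kappa> > 0" "\<And>c m N x. 0 \<le> c \<Longrightarrow> norm x \<le> 2 ^ m \<Longrightarrow>
    ennreal (\<kappa> * c * real N) \<le> green_potential (multiscale_profile c m N :: 'a \<times> 'b \<Rightarrow> real) x"
    using multiscale_profile_potential[where 'a = 'a and 'b = 'b] by blast
  define K where "K = (1 / \<kappa>) powr p2 * (unit_ball_vol DIM('a) powr (p2 / p1)
          * (unit_ball_vol DIM('b) * (2 ^ DIM('b) - 1)))"
  have bound: "mixed_capacity p1 p2 (closure E) \<le> ennreal (K * real N powr (1 - p2))" if N: "0 < N" for N :: nat
  proof -
    define c where "c = 1 / (\<kappa> * real N)"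
    have c: "c > 0" using \<kappa> N by (simp add: c_def)
    let ?f = "multiscale_profile c m N :: 'a \<times> 'b \<Rightarrow> real"
    have "real N * c powr p2 = (1 / \<kappa>) powr p2 * real N powr (1 - p2)"
    proof -
      have "c powr p2 = (1 / \<kappa> * (1 / real N)) powr p2" by (simp add: c_def)
      also have "\<dots> = (1 / \<kappa>) powr p2 * (1 / real N) powr p2" by (rule powr_mult)
      also have "(1 / real N) powr p2 = real N powr (- p2)"
        by (simp add: powr_divide powr_minus_divide)
      finally have "real N * c powr p2 = (1 / \<kappa>) powr p2 * (real N powr 1 * real N powr (- p2))"
        using N by simp
      also have "real N powr 1 * real N powr (- p2) = real N powr (1 - p2)"
        unfolding powr_add[symmetric] by simp
      finally show ?thesis .
    qed
    then have K_eq': "real N * c powr p2 * W = (1 / \<kappa>) powr p2 * W * real N powr (1 - p2)" for W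
      by simp
    have K_eq: "real N * (c powr p2 * (unit_ball_vol DIM('a) powr (p2 / p1)
          * (unit_ball_vol DIM('b) * (2 ^ DIM('b) - 1)))) = K * real N powr (1 - p2)"
      unfolding K_def mult.assoc[of "real N", symmetric] by (rule K_eq')
    have norm: "ennreal_powr (mixed_norm p1 p2 ?f) p2 \<le> ennreal (K * real N powr (1 - p2))"
      using multiscale_profile_norm[OF p D c, of m N] unfolding K_eq .
    have "mixed_norm p1 p2 ?f < \<infinity>"
      using norm ennreal_powr_less_top_iff[of _ p2] by (metis ennreal_less_top infinity_ennreal_def order_le_less_trans)
    then have "?f \<in> mixed_Lp p1 p2"
      by (simp add: mixed_Lp_def)
    moreover have "indicator (closure E) x \<le> green_potential ?f x" for x
    proof (cases "x \<in> closure E")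
      case True
      have "\<kappa> * c * real N = 1" using \<kappa>(1) N by (simp add: c_def)
      then show ?thesis
        using \<kappa>(2)[of c x m N] c R[OF True] m True by simp
    qed simp
    ultimately have "mixed_capacity p1 p2 (closure E) \<le> ennreal_powr (mixed_norm p1 p2 ?f) p2"
      unfolding mixed_capacity_def using c by (intro INF_lower) (simp add: multiscale_profile_nonneg)
    with norm show ?thesis by (rule order_trans[rotated])
  qed
  have "(\<lambda>N. ennreal (K * real N powr (1 - p2))) \<longlonglongrightarrow> ennreal (K * 0)"
    using p by (intro tendsto_intros tendsto_ennrealI tendsto_neg_powr filterlim_real_sequentially) auto
  then have "mixed_capacity p1 p2 (closure E) \<le> ennreal (K * 0)"
    by (rule tendsto_lowerbound) (auto intro!: eventually_sequentiallyI[of 1] bound)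
  then show "mixed_capacity p1 p2 (closure E) = 0" by simp
qed


section \<open>Test functions of the squared norm\<close>

text \<open>
  The function \<open>d k\<close> is the \<open>k\<close>-th derivative. Only nonnegative arguments matter
  because the squared norm will be inserted; the derivatives at 0 are two-sided, so that the
  chain rule holds at the origin as well.
\<close>

definition smooth_on_nonneg :: "(real \<Rightarrow> real) \<Rightarrow> bool" where
  "smooth_on_nonneg h \<longleftrightarrow>
     (\<exists>d. d 0 = h \<and> (\<forall>k s. 0 \<le> s \<longrightarrow> (d k has_real_derivative d (Suc k) s) (at s)))"

lemma smooth_on_nonnegI:
  assumes "d 0 = h" "\<And>k s. 0 \<le> s \<Longrightarrow> (d k has_real_derivative d (Suc k) s) (at s)"
  shows "smooth_on_nonneg h"
  unfolding smooth_on_nonneg_def using assms by blast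

lemma smooth_on_nonneg_deriv:
  assumes "smooth_on_nonneg h"
  shows "\<exists>h'. smooth_on_nonneg h' \<and> (\<forall>s\<ge>0. (h has_real_derivative h' s) (at s))"
proof -
  obtain d where d: "d 0 = h" "\<And>k s. 0 \<le> s \<Longrightarrow> (d k has_real_derivative d (Suc k) s) (at s)"
    using assms unfolding smooth_on_nonneg_def by blast
  have "smooth_on_nonneg (d 1)"
    by (rule smooth_on_nonnegI[of "\<lambda>k. d (Suc k)"]) (auto intro: d(2))
  then show ?thesis using d(1) d(2)[of _ 0] by auto
qed

text \<open>
  An algebra that contains the smooth functions of the squared norm and is closed under
  directional derivatives. Differentiability of every order is then an induction on the order
  which needs no formula for higher derivatives of products and compositions.
\<close>

inductive_set radial_algebra :: "('a::euclidean_space \<Rightarrow> real) set" where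
  const: "(\<lambda>_. c) \<in> radial_algebra"
| inner: "(\<lambda>x. x \<bullet> v) \<in> radial_algebra"
| radial: "smooth_on_nonneg h \<Longrightarrow> (\<lambda>x. h (x \<bullet> x)) \<in> radial_algebra"
| add: "f \<in> radial_algebra \<Longrightarrow> g \<in> radial_algebra \<Longrightarrow> (\<lambda>x. f x + g x) \<in> radial_algebra"
| mult: "f \<in> radial_algebra \<Longrightarrow> g \<in> radial_algebra \<Longrightarrow> (\<lambda>x. f x * g x) \<in> radial_algebra"

lemma radial_has_derivative:
  fixes x :: "'a::euclidean_space"
  assumes "\<And>s. 0 \<le> s \<Longrightarrow> (h has_real_derivative h' s) (at s)"
  shows "((\<lambda>x. h (x \<bullet> x)) has_derivative (\<lambda>v. h' (x \<bullet> x) * (2 * (x \<bullet> v)))) (at x)"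
proof -
  have "(h has_derivative (\<lambda>t. h' (x \<bullet> x) * t)) (at (x \<bullet> x))"
    using assms[of "x \<bullet> x"] by (simp add: has_field_derivative_def)
  moreover have "((\<lambda>x. x \<bullet> x) has_derivative (\<lambda>v. 2 * (x \<bullet> v))) (at x)"
    by (auto intro!: derivative_eq_intros simp: inner_commute)
  ultimately show ?thesis
    by (rule has_derivative_compose[rotated])
qed

lemma radial_algebra_derivative:
  assumes "f \<in> radial_algebra"
  shows "\<exists>D. (\<forall>x. (f has_derivative D x) (at x)) \<and> (\<forall>v. (\<lambda>x. D x v) \<in> radial_algebra)"
  using assms
proof induction
  case (const c)
  show ?case
    by (intro exI[of _ "\<lambda>_ _. 0"]) (auto intro: radial_algebra.const)
next
  case (inner w)
  show ?case
    by (intro exI[of _ "\<lambda>_ v. v \<bullet> w"]) (auto intro: radial_algebra.const intro!: derivative_eq_intros)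
next
  case (radial h)
  then obtain h' where h': "smooth_on_nonneg h'" "\<And>s. 0 \<le> s \<Longrightarrow> (h has_real_derivative h' s) (at s)"
    using smooth_on_nonneg_deriv by blast
  show ?case
    by (intro exI[of _ "\<lambda>x v. h' (x \<bullet> x) * (2 * (x \<bullet> v))"])
      (auto intro!: radial_has_derivative h' radial_algebra.intros)
next
  case (add f g)
  then obtain Df Dg where "\<forall>x. (f has_derivative Df x) (at x)" "\<forall>v. (\<lambda>x. Df x v) \<in> radial_algebra"
     "\<forall>x. (g has_derivative Dg x) (at x)" "\<forall>v. (\<lambda>x. Dg x v) \<in> radial_algebra" by blast
  then show ?case
    by (intro exI[of _ "\<lambda>x v. Df x v + Dg x v"]) (auto intro!: radial_algebra.add derivative_eq_intros)
next
  case (mult f g)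
  then obtain Df Dg where "\<forall>x. (f has_derivative Df x) (at x)" "\<forall>v. (\<lambda>x. Df x v) \<in> radial_algebra"
     "\<forall>x. (g has_derivative Dg x) (at x)" "\<forall>v. (\<lambda>x. Dg x v) \<in> radial_algebra" by blast
  then show ?case
    using mult.hyps
    by (intro exI[of _ "\<lambda>x v. f x * Dg x v + Df x v * g x"])
      (auto intro!: radial_algebra.add radial_algebra.mult has_derivative_mult)
qed

lemma radial_algebra_differentiable: "f \<in> radial_algebra \<Longrightarrow> f differentiable (at x)"
  using radial_algebra_derivative unfolding differentiable_def by blast

lemma radial_algebra_frechet_derivative:
  assumes "f \<in> radial_algebra"
  shows "(\<lambda>x. frechet_derivative f (at x) v) \<in> radial_algebra"
proof -
  obtain D where D: "\<And>x. (f has_derivative D x) (at x)" "\<And>v. (\<lambda>x. D x v) \<in> radial_algebra"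
    using radial_algebra_derivative[OF assms] by blast
  have "frechet_derivative f (at x) = D x" for x
    using frechet_derivative_at[OF D(1)] by simp
  then show ?thesis using D(2) by simp
qed

lemma radial_algebra_continuous: "f \<in> radial_algebra \<Longrightarrow> continuous_on UNIV f"
  by (intro differentiable_imp_continuous_on differentiable_at_imp_differentiable_on
        radial_algebra_differentiable)

lemma radial_algebra_k_times_cont_diff: "f \<in> radial_algebra \<Longrightarrow> k_times_cont_diff k f"
  by (induction k arbitrary: f)
    (auto intro: radial_algebra_continuous radial_algebra_differentiable radial_algebra_frechet_derivative)

lemma test_functionI:
  assumes "\<And>k. k_times_cont_diff k \<phi>" "\<And>x. R < norm x \<Longrightarrow> \<phi> x = 0"
  shows "\<phi> \<in> test_functions"
proof -
  have "{x. \<phi> x \<noteq> 0} \<subseteq> cball 0 R"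
    using assms(2) by (force simp: not_less[symmetric])
  then have "bounded {x. \<phi> x \<noteq> 0}" using bounded_cball bounded_subset by blast
  then show ?thesis
    using assms(1) by (simp add: test_functions_def compact_closure)
qed

definition laplacian :: "('a::euclidean_space \<Rightarrow> real) \<Rightarrow> 'a \<Rightarrow> real" where
  "laplacian f x = (\<Sum>b\<in>Basis. frechet_derivative (\<lambda>y. frechet_derivative f (at y) b) (at x) b)"

lemma frechet_derivative_radial:
  assumes "\<And>s. 0 \<le> s \<Longrightarrow> (h has_real_derivative h' s) (at s)"
  shows "frechet_derivative (\<lambda>x::'a::euclidean_space. h (x \<bullet> x)) (at x) v = h' (x \<bullet> x) * (2 * (x \<bullet> v))"
  using frechet_derivative_at[OF radial_has_derivative[OF assms], of x] by metis

lemma laplacian_radial: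
  fixes x :: "'a::euclidean_space" and h h' h'' :: "real \<Rightarrow> real"
  assumes h: "\<And>s. 0 \<le> s \<Longrightarrow> (h has_real_derivative h' s) (at s)"
    and h': "\<And>s. 0 \<le> s \<Longrightarrow> (h' has_real_derivative h'' s) (at s)"
  shows "laplacian (\<lambda>x. h (x \<bullet> x)) x = 4 * (x \<bullet> x) * h'' (x \<bullet> x) + 2 * real DIM('a) * h' (x \<bullet> x)"
proof -
  have "frechet_derivative (\<lambda>y. h' (y \<bullet> y) * (2 * (y \<bullet> b))) (at x) b
      = h' (x \<bullet> x) * 2 + 4 * h'' (x \<bullet> x) * (x \<bullet> b)\<^sup>2" if "b \<in> Basis" for b
  proof -
    have "((\<lambda>y. h' (y \<bullet> y) * (2 * (y \<bullet> b))) has_derivative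
       (\<lambda>v. h' (x \<bullet> x) * (2 * (v \<bullet> b)) + h'' (x \<bullet> x) * (2 * (x \<bullet> v)) * (2 * (x \<bullet> b)))) (at x)"
      by (rule has_derivative_mult[OF radial_has_derivative[OF h']]) (auto intro!: derivative_eq_intros)
    from frechet_derivative_at[OF this, symmetric] show ?thesis
      using that by (simp add: power2_eq_square)
  qed
  moreover have "frechet_derivative (\<lambda>x. h (x \<bullet> x)) (at y) b = h' (y \<bullet> y) * (2 * (y \<bullet> b))" for y b :: 'a
    using h by (rule frechet_derivative_radial)
  ultimately have "laplacian (\<lambda>x. h (x \<bullet> x)) x = (\<Sum>b\<in>Basis. h' (x \<bullet> x) * 2 + 4 * h'' (x \<bullet> x) * (x \<bullet> b)\<^sup>2)"
    unfolding laplacian_def by (intro sum.cong refl) simp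
  also have "\<dots> = 2 * real DIM('a) * h' (x \<bullet> x) + 4 * h'' (x \<bullet> x) * (\<Sum>b\<in>Basis. (x \<bullet> b)\<^sup>2)"
    by (simp add: sum.distrib sum_distrib_left)
  also have "(\<Sum>b\<in>Basis. (x \<bullet> b)\<^sup>2) = x \<bullet> x"
    by (subst euclidean_inner[of x x]) (simp add: power2_eq_square)
  finally show ?thesis by (simp add: algebra_simps)
qed


text \<open>
  The cutoff functions come from the flat function which is \<open>exp (- 1 / s)\<close> for
  \<open>s > 0\<close> and 0 otherwise. Differentiating \<open>p (1 / s) * exp (- 1 / s)\<close> for a
  polynomial \<open>p\<close> yields the same expression with \<open>X\<^sup>2 * (p - p')\<close> in place of
  \<open>p\<close>, which explains the recursion; \<open>bump_deriv k\<close> is the \<open>k\<close>-th derivative.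
\<close>

primrec bump_poly :: "nat \<Rightarrow> real poly" where
  "bump_poly 0 = 1"
| "bump_poly (Suc k) = monom 1 2 * (bump_poly k - pderiv (bump_poly k))"

definition bump_deriv :: "nat \<Rightarrow> real \<Rightarrow> real" where
  "bump_deriv k s = (if 0 < s then poly (bump_poly k) (1 / s) * exp (- (1 / s)) else 0)"

lemma poly_times_exp_minus_tendsto_0: "((\<lambda>y. poly p y * exp (- y)) \<longlongrightarrow> (0::real)) at_top"
proof -
  have "((\<lambda>y. \<Sum>i\<le>degree p. coeff p i * (y ^ i / exp y)) \<longlongrightarrow> (\<Sum>i\<le>degree p. coeff p i * 0)) at_top"
    by (intro tendsto_intros tendsto_power_div_exp_0)
  then show ?thesis
    by (simp add: poly_altdef sum_distrib_right exp_minus divide_inverse mult.assoc)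
qed

lemma poly_bump_tendsto_0: "((\<lambda>s. poly p (1 / s) * exp (- (1 / s))) \<longlongrightarrow> (0::real)) (at_right 0)"
  using filterlim_compose[OF poly_times_exp_minus_tendsto_0[of p] filterlim_inverse_at_top_right]
  by (simp add: inverse_eq_divide)

lemma bump_deriv_has_derivative: "(bump_deriv k has_real_derivative bump_deriv (Suc k) s) (at s)"
proof -
  consider "s < 0" | "s = 0" | "0 < s" by linarith
  then show ?thesis
  proof cases
    case 1
    have "((\<lambda>_. 0) has_real_derivative 0) (at s)" by simp
    moreover have "eventually (\<lambda>t. bump_deriv k t = 0) (nhds s)"
      using eventually_nhds_in_open[of "{..<0}" s] 1 by (auto simp: bump_deriv_def elim!: eventually_mono)
    ultimately show ?thesis
      using 1 by (subst DERIV_cong_ev[OF refl, of _ "\<lambda>_. 0"]) (auto simp: bump_deriv_def)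
  next
    case 3
    have "((\<lambda>t. poly (bump_poly k) (1 / t) * exp (- (1 / t))) has_real_derivative
        (poly (pderiv (bump_poly k)) (1 / s) * (- (1 / s\<^sup>2))) * exp (- (1 / s))
          + exp (- (1 / s)) * (1 / s\<^sup>2) * poly (bump_poly k) (1 / s)) (at s)"
      using 3 by (auto intro!: derivative_eq_intros DERIV_chain2[OF poly_DERIV] simp: power2_eq_square)
    moreover have "(poly (pderiv (bump_poly k)) (1 / s) * (- (1 / s\<^sup>2))) * exp (- (1 / s))
          + exp (- (1 / s)) * (1 / s\<^sup>2) * poly (bump_poly k) (1 / s) = bump_deriv (Suc k) s"
      using 3 by (simp add: bump_deriv_def poly_monom power_divide algebra_simps)
    moreover have "eventually (\<lambda>t. bump_deriv k t = poly (bump_poly k) (1 / t) * exp (- (1 / t))) (nhds s)"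
      using eventually_nhds_in_open[of "{0<..}" s] 3 by (auto simp: bump_deriv_def elim!: eventually_mono)
    ultimately show ?thesis
      by (subst DERIV_cong_ev[OF refl, of _ "\<lambda>t. poly (bump_poly k) (1 / t) * exp (- (1 / t))"]) auto
  next
    case 2
    have "((\<lambda>h. bump_deriv k h / h) \<longlongrightarrow> 0) (at_right 0)"
      using poly_bump_tendsto_0[of "monom 1 1 * bump_poly k"]
    proof (rule Lim_transform_eventually)
      show "\<forall>\<^sub>F s in at_right 0. poly (monom 1 1 * bump_poly k) (1 / s) * exp (- (1 / s)) = bump_deriv k s / s"
        using eventually_at_right_less[of 0] by eventually_elim (simp add: bump_deriv_def poly_monom)
    qed
    moreover have "((\<lambda>h. bump_deriv k h / h) \<longlongrightarrow> 0) (at_left 0)"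
    proof (rule Lim_transform_eventually[OF tendsto_const])
      show "\<forall>\<^sub>F s in at_left 0. 0 = bump_deriv k s / s"
        using eventually_at_left_real[of "-1" 0] by (auto simp: bump_deriv_def elim!: eventually_mono)
    qed
    ultimately have "((\<lambda>h. bump_deriv k h / h) \<longlongrightarrow> 0) (at 0)"
      by (rule filterlim_split_at[rotated])
    then show ?thesis
      using 2 by (simp add: DERIV_def bump_deriv_def)
  qed
qed

lemma bump_deriv_nonpos: "s \<le> 0 \<Longrightarrow> bump_deriv k s = 0"
  by (simp add: bump_deriv_def)

lemma bump_pos: "0 < s \<Longrightarrow> 0 < bump_deriv 0 s"
  by (simp add: bump_deriv_def)

lemma bump_nonneg: "0 \<le> bump_deriv 0 s"
  by (simp add: bump_deriv_def)

lemma isCont_bump_deriv: "isCont (bump_deriv k) s"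
  using bump_deriv_has_derivative by (rule DERIV_isCont)

lemma bump_deriv_bounded: "\<exists>B\<ge>0. \<forall>s\<le>1. \<bar>bump_deriv k s\<bar> \<le> B"
proof -
  have "continuous_on {0..1} (bump_deriv k)"
    using isCont_bump_deriv by (auto intro: continuous_at_imp_continuous_on)
  then have "bounded (bump_deriv k ` {0..1})"
    by (intro compact_imp_bounded compact_continuous_image) auto
  then obtain B where "\<forall>s\<in>{0..1}. \<bar>bump_deriv k s\<bar> \<le> B"
    by (auto simp: bounded_iff)
  then have B: "\<bar>bump_deriv k s\<bar> \<le> B" if "s \<in> {0..1}" for s
    using that by blast
  have "\<bar>bump_deriv k s\<bar> \<le> B" if "s \<le> 1" for s
    using B[of s] B[of 0] that by (cases "0 \<le> s") (auto simp: bump_deriv_nonpos)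
  moreover have "B \<ge> 0" using B[of 0] by (auto simp: bump_deriv_nonpos)
  ultimately show ?thesis by blast
qed

lemma smooth_bump: "smooth_on_nonneg (\<lambda>r. bump_deriv 0 (1 - \<epsilon> * r))"
  by (rule smooth_on_nonnegI[of "\<lambda>k r. (- \<epsilon>) ^ k * bump_deriv k (1 - \<epsilon> * r)"])
    (auto intro!: derivative_eq_intros DERIV_chain2[OF bump_deriv_has_derivative])

lemma smooth_exp: "smooth_on_nonneg (\<lambda>r. exp (- a * r))"
  by (rule smooth_on_nonnegI[of "\<lambda>k r. (- a) ^ k * exp (- a * r)"])
    (auto intro!: derivative_eq_intros)

primrec falling_coeff :: "real \<Rightarrow> nat \<Rightarrow> real" where
  "falling_coeff e 0 = 1"
| "falling_coeff e (Suc k) = falling_coeff e k * (e - real k)"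

lemma smooth_powr: "smooth_on_nonneg (\<lambda>r. (1 + r) powr e)"
proof (rule smooth_on_nonnegI[of "\<lambda>k r. falling_coeff e k * (1 + r) powr (e - real k)"])
  fix k and s :: real
  assume "0 \<le> s"
  then have "((\<lambda>r. (1 + r) powr (e - real k)) has_real_derivative
      (e - real k) * (1 + s) powr (e - real k - 1) * 1) (at s)"
    by (intro DERIV_chain2[where g = "\<lambda>r. 1 + r" and f = "\<lambda>x. x powr (e - real k)", OF has_real_derivative_powr])
      (auto intro!: derivative_eq_intros)
  from DERIV_cmult[OF this, of "falling_coeff e k"]
  show "((\<lambda>r. falling_coeff e k * (1 + r) powr (e - real k)) has_real_derivative
      falling_coeff e (Suc k) * (1 + s) powr (e - real (Suc k))) (at s)"
    by (simp add: mult.assoc algebra_simps)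
qed simp


section \<open>Weak superharmonicity\<close>

lemma test_function_continuous: "\<phi> \<in> test_functions \<Longrightarrow> continuous_on UNIV \<phi>"
  unfolding test_functions_def using k_times_cont_diff.simps(1) by blast

lemma test_function_differentiable: "\<phi> \<in> test_functions \<Longrightarrow> \<phi> differentiable (at x)"
  unfolding test_functions_def using k_times_cont_diff.simps(2)[of 0] by blast

lemma test_function_support:
  assumes "\<phi> \<in> test_functions"
  obtains R where "0 \<le> R" "\<And>x. R < norm x \<Longrightarrow> \<phi> x = 0"
proof -
  have "bounded (closure {x. \<phi> x \<noteq> 0})"
    using assms by (auto simp: test_functions_def intro: compact_imp_bounded)
  then obtain R where R: "\<And>x. x \<in> closure {x. \<phi> x \<noteq> 0} \<Longrightarrow> norm x \<le> R"
    by (auto simp: bounded_iff)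
  have "\<phi> x = 0" if "max R 0 < norm x" for x
    using R[of x] closure_subset[of "{x. \<phi> x \<noteq> 0}"] that by force
  then show ?thesis using that[of "max R 0"] by auto
qed

lemma frechet_derivative_outside_support:
  assumes "\<And>x. R < norm x \<Longrightarrow> f x = 0" and "R < norm x"
  shows "frechet_derivative f (at x) v = 0"
proof -
  have "open {x::'a. R < norm x}" by (intro open_Collect_less continuous_intros)
  then have "(f has_derivative (\<lambda>_. 0)) (at x)"
    by (rule has_derivative_transform_within_open[OF has_derivative_const]) (use assms in auto)
  from frechet_derivative_at[OF this, symmetric] show ?thesis by simp
qed

lemma test_function_frechet_derivative:
  assumes "\<phi> \<in> test_functions"
  shows "(\<lambda>x. frechet_derivative \<phi> (at x) v) \<in> test_functions"
proof -
  obtain R where R: "\<And>x. R < norm x \<Longrightarrow> \<phi> x = 0" using test_function_support[OF assms] by blast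
  have "frechet_derivative \<phi> (at x) v = 0" if "R < norm x" for x
    using frechet_derivative_outside_support[OF R that] .
  moreover have "k_times_cont_diff k (\<lambda>x. frechet_derivative \<phi> (at x) v)" for k
    using assms unfolding test_functions_def using k_times_cont_diff.simps(2) by blast
  ultimately show ?thesis by (intro test_functionI)
qed

lemma test_function_bounded:
  assumes "\<phi> \<in> test_functions"
  obtains B where "0 \<le> B" "\<And>x. \<bar>\<phi> x\<bar> \<le> B"
proof -
  obtain R where R: "0 \<le> R" "\<And>x. R < norm x \<Longrightarrow> \<phi> x = 0" using test_function_support[OF assms] by blast
  have "compact (\<phi> ` cball 0 R)"
    using test_function_continuous[OF assms] continuous_on_subset
    by (intro compact_continuous_image) auto
  then obtain B where B: "\<And>x. norm x \<le> R \<Longrightarrow> \<bar>\<phi> x\<bar> \<le> B"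
    using compact_imp_bounded by (fastforce simp: bounded_iff)
  have "0 \<le> B" using B[of 0] R(1) by auto
  moreover have "\<bar>\<phi> x\<bar> \<le> B" for x
    using B[of x] R(2)[of x] \<open>0 \<le> B\<close> by (cases "norm x \<le> R") auto
  ultimately show ?thesis using that by blast
qed

lemma test_function_measurable: "\<phi> \<in> test_functions \<Longrightarrow> \<phi> \<in> borel_measurable borel"
  by (intro borel_measurable_continuous_onI test_function_continuous)

lemma integrable_L2_loc_test_function:
  fixes u :: "'a::euclidean_space \<Rightarrow> 'c::euclidean_space"
  assumes u: "u \<in> L2_loc" and \<phi>: "\<phi> \<in> test_functions"
  shows "integrable lborel (\<lambda>x. \<phi> x *\<^sub>R u x)"
proof -
  obtain R where R: "\<And>x. R < norm x \<Longrightarrow> \<phi> x = 0" using test_function_support[OF \<phi>] by blast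
  obtain B where B: "0 \<le> B" "\<And>x. \<bar>\<phi> x\<bar> \<le> B" using test_function_bounded[OF \<phi>] by blast
  have [measurable]: "u \<in> borel_measurable borel" "\<phi> \<in> borel_measurable borel"
    using u test_function_measurable[OF \<phi>] by (auto simp: L2_loc_def)
  have "integrable lborel (\<lambda>x. B * (indicator (cball 0 R) x + indicator (cball 0 R) x *\<^sub>R (norm (u x))\<^sup>2))"
    using u emeasure_lborel_cball_finite[of "0::'a" R] by (intro integrable_mult_right Bochner_Integration.integrable_add)
      (auto simp: L2_loc_def set_integrable_def integrable_indicator_iff)
  then show ?thesis
  proof (rule Bochner_Integration.integrable_bound)
    show "AE x in lborel. norm (\<phi> x *\<^sub>R u x)
      \<le> norm (B * (indicator (cball 0 R) x + indicator (cball 0 R) x *\<^sub>R (norm (u x))\<^sup>2))"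
    proof (intro AE_I2)
      fix x
      show "norm (\<phi> x *\<^sub>R u x) \<le> norm (B * (indicator (cball 0 R) x + indicator (cball 0 R) x *\<^sub>R (norm (u x))\<^sup>2))"
      proof (cases "norm x \<le> R")
        case True
        have "norm (u x) \<le> 1 + (norm (u x))\<^sup>2"
          using zero_le_power2[of "norm (u x) - 1"] norm_ge_zero[of "u x"]
          unfolding power2_diff power_one mult_1_right by linarith
        then have "\<bar>\<phi> x\<bar> * norm (u x) \<le> B * (1 + (norm (u x))\<^sup>2)"
          using B by (intro mult_mono) auto
        also have "\<dots> \<le> norm (B * (1 + (norm (u x))\<^sup>2))" by simp
        finally show ?thesis using True by simp
      qed (simp add: R)
    qed
  qed measurable
qed

lemma grad_inner: "b \<in> Basis \<Longrightarrow> grad \<phi> x \<bullet> b = frechet_derivative \<phi> (at x) b"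
  by (simp add: grad_def inner_sum_left inner_Basis if_distrib cong: if_cong)

text \<open>
  The definition of weak gradients applies to the partial derivatives of \<open>\<phi>\<close>, which are
  test functions themselves. So the gradient of \<open>u\<close> can be eliminated and only
  \<open>u\<close> itself has to be estimated from here on.
\<close>

lemma superharmonic_integral_laplacian:
  fixes u :: "'a::euclidean_space \<Rightarrow> real"
  assumes u: "superharmonic u" and \<phi>: "\<phi> \<in> test_functions" "\<And>x. 0 \<le> \<phi> x"
  shows "(\<integral>x. u x * laplacian \<phi> x \<partial>lborel) \<le> 0"
proof -
  define d where "d b = (\<lambda>x. frechet_derivative \<phi> (at x) b)" for b
  define dd where "dd b = (\<lambda>x. frechet_derivative (d b) (at x) b)" for b
  have d: "d b \<in> test_functions" for b
    unfolding d_def by (rule test_function_frechet_derivative[OF \<phi>(1)])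
  have dd: "dd b \<in> test_functions" for b
    unfolding dd_def by (rule test_function_frechet_derivative[OF d])
  obtain g where u2: "u \<in> L2_loc" and g: "g \<in> L2_loc" "weak_gradient u g"
      and pos: "0 \<le> (\<integral>x. g x \<bullet> grad \<phi> x \<partial>lborel)"
    using u \<phi> unfolding superharmonic_def by blast
  have gi: "integrable lborel (\<lambda>x. d b x *\<^sub>R g x)" for b
    by (rule integrable_L2_loc_test_function[OF g(1) d])
  have ui: "integrable lborel (\<lambda>x. u x * dd b x)" for b
    using integrable_L2_loc_test_function[OF u2 dd, of b] by (simp add: mult.commute)
  have parts: "(\<integral>x. u x * dd b x \<partial>lborel) = - (\<integral>x. d b x * (g x \<bullet> b) \<partial>lborel)" if b: "b \<in> Basis" for b
  proof -
    have "integrable lborel (\<lambda>x. u x *\<^sub>R grad (d b) x)"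
    proof -
      have "(\<lambda>x. u x *\<^sub>R grad (d b) x)
          = (\<lambda>x. \<Sum>c\<in>Basis. (frechet_derivative (d b) (at x) c * u x) *\<^sub>R c)"
        by (simp add: grad_def scaleR_sum_right mult.commute)
      moreover have "integrable lborel (\<lambda>x. frechet_derivative (d b) (at x) c * u x)" for c
        using integrable_L2_loc_test_function[OF u2 test_function_frechet_derivative[OF d]] by simp
      ultimately show ?thesis by simp
    qed
    then have "(\<integral>x. u x *\<^sub>R grad (d b) x \<partial>lborel) \<bullet> b = (\<integral>x. u x * dd b x \<partial>lborel)"
      by (subst integral_inner_left[symmetric]) (simp_all add: grad_inner[OF b] dd_def)
    moreover have "(- (\<integral>x. d b x *\<^sub>R g x \<partial>lborel)) \<bullet> b = - (\<integral>x. d b x * (g x \<bullet> b) \<partial>lborel)"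
      using gi by (simp add: integral_inner_left[symmetric])
    moreover have "(\<integral>x. u x *\<^sub>R grad (d b) x \<partial>lborel) = - (\<integral>x. d b x *\<^sub>R g x \<partial>lborel)"
      using g(2) d unfolding weak_gradient_def by blast
    ultimately show ?thesis by simp
  qed
  have "(\<integral>x. u x * laplacian \<phi> x \<partial>lborel) = (\<integral>x. (\<Sum>b\<in>Basis. u x * dd b x) \<partial>lborel)"
    by (simp add: laplacian_def dd_def d_def sum_distrib_left)
  also have "\<dots> = (\<Sum>b\<in>Basis. \<integral>x. u x * dd b x \<partial>lborel)"
    using ui by (intro Bochner_Integration.integral_sum)
  also have "\<dots> = - (\<Sum>b\<in>Basis. \<integral>x. d b x * (g x \<bullet> b) \<partial>lborel)"
    using parts by (simp add: sum_negf)
  also have "(\<Sum>b\<in>Basis. \<integral>x. d b x * (g x \<bullet> b) \<partial>lborel) = (\<integral>x. (\<Sum>b\<in>Basis. d b x * (g x \<bullet> b)) \<partial>lborel)"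
  proof (intro Bochner_Integration.integral_sum[symmetric])
    show "integrable lborel (\<lambda>x. d b x * (g x \<bullet> b))" for b
      using integrable_inner_left[OF gi[of b], of b] by simp
  qed
  also have "\<dots> = (\<integral>x. g x \<bullet> grad \<phi> x \<partial>lborel)"
    by (simp add: grad_def d_def inner_sum_right)
  finally show ?thesis using pos by simp
qed


lemma integral_translate:
  fixes f :: "'a::euclidean_space \<Rightarrow> real"
  assumes "f \<in> borel_measurable borel"
  shows "(\<integral>x. f (x + c) \<partial>lborel) = (\<integral>x. f x \<partial>lborel)"
proof -
  have "(\<integral>x. f x \<partial>lborel) = (\<integral>x. f x \<partial>distr lborel borel ((+) c))"
    by (simp add: lborel_distr_plus)
  also have "\<dots> = (\<integral>x. f (c + x) \<partial>lborel)"
    using assms by (intro integral_distr) auto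
  finally show ?thesis by (simp add: add.commute)
qed

lemma integrable_compact_support:
  fixes f :: "'a::euclidean_space \<Rightarrow> real"
  assumes "continuous_on UNIV f" "\<And>x. R < norm x \<Longrightarrow> f x = 0"
  shows "integrable lborel f"
proof -
  have "integrable lborel (\<lambda>x. indicator (cball 0 R) x *\<^sub>R f x)"
    using assms(1) continuous_on_subset by (intro borel_integrable_compact) auto
  also have "(\<lambda>x. indicator (cball 0 R) x *\<^sub>R f x) = f"
    using assms(2) by (auto simp: indicator_def fun_eq_iff not_le)
  finally show ?thesis .
qed

text \<open>
  The difference quotients have integral 0 by translation invariance. By the mean value theorem
  they are dominated by a multiple of the indicator function of a ball.
\<close>

lemma integral_frechet_derivative_eq_0:
  fixes f :: "'a::euclidean_space \<Rightarrow> real"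
  assumes diff: "\<And>x. f differentiable (at x)"
    and cont: "continuous_on UNIV (\<lambda>x. frechet_derivative f (at x) v)"
    and supp: "\<And>x. R < norm x \<Longrightarrow> f x = 0"
  shows "(\<integral>x. frechet_derivative f (at x) v \<partial>lborel) = 0"
proof -
  define D where "D x = frechet_derivative f (at x) v" for x
  have contf: "continuous_on UNIV f"
    using diff by (intro differentiable_imp_continuous_on differentiable_at_imp_differentiable_on)
  have [measurable]: "f \<in> borel_measurable borel" "D \<in> borel_measurable borel"
    using contf cont unfolding D_def by (auto intro: borel_measurable_continuous_onI)
  have along: "((\<lambda>t. f (x + t *\<^sub>R v)) has_real_derivative D (x + t *\<^sub>R v)) (at t)" for x t
  proof -
    have "(f has_derivative frechet_derivative f (at (x + t *\<^sub>R v))) (at (x + t *\<^sub>R v))"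
      using diff frechet_derivative_works by blast
    moreover have "((\<lambda>t. x + t *\<^sub>R v) has_derivative (\<lambda>s. s *\<^sub>R v)) (at t)"
      by (auto intro!: derivative_eq_intros)
    ultimately have "((\<lambda>t. f (x + t *\<^sub>R v)) has_derivative (\<lambda>s. frechet_derivative f (at (x + t *\<^sub>R v)) (s *\<^sub>R v))) (at t)"
      by (rule has_derivative_compose[rotated])
    moreover have "frechet_derivative f (at y) (s *\<^sub>R v) = D y * s" for y s
      using linear_frechet_derivative[OF diff[of y]] by (simp add: D_def linear_scale)
    ultimately show ?thesis by (simp add: has_field_derivative_def)
  qed
  have "compact (D ` cball 0 R)"
    using cont continuous_on_subset unfolding D_def by (intro compact_continuous_image) auto
  then obtain M where M: "\<forall>x\<in>cball 0 R. \<bar>D x\<bar> \<le> M"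
    using compact_imp_bounded by (fastforce simp: bounded_iff)
  have D_bound: "\<bar>D x\<bar> \<le> max M 0" for x
  proof (cases "norm x \<le> R")
    case True
    then show ?thesis using M by (simp add: max.coboundedI1)
  next
    case False
    then show ?thesis
      using frechet_derivative_outside_support[of R f x v] supp by (simp add: D_def)
  qed
  define q where "q i x = (f (x + (1 / Suc i) *\<^sub>R v) - f x) / (1 / Suc i)" for i :: nat and x
  have int_q: "(\<integral>x. q i x \<partial>lborel) = 0" for i
  proof -
    have 1: "integrable lborel f" by (rule integrable_compact_support[OF contf supp])
    have 2: "integrable lborel (\<lambda>x. f (x + (1 / Suc i) *\<^sub>R v))"
    proof (rule integrable_compact_support)
      show "continuous_on UNIV (\<lambda>x. f (x + (1 / Suc i) *\<^sub>R v))"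
        by (intro continuous_on_compose2[OF contf] continuous_intros) auto
      show "f (x + (1 / Suc i) *\<^sub>R v) = 0" if "R + norm ((1 / Suc i) *\<^sub>R v) < norm x" for x
        using that norm_triangle_ineq4[of "x + (1 / Suc i) *\<^sub>R v" "(1 / Suc i) *\<^sub>R v"] by (intro supp) simp
    qed
    show ?thesis
      unfolding q_def using 1 2 integral_translate[of f "(1 / Suc i) *\<^sub>R v"]
      by (subst integral_divide_zero, subst Bochner_Integration.integral_diff) simp_all
  qed
  have "(\<lambda>i. \<integral>x. q i x \<partial>lborel) \<longlonglongrightarrow> (\<integral>x. D x \<partial>lborel)"
  proof (rule integral_dominated_convergence[where w = "\<lambda>x. max M 0 * indicator (cball 0 (R + norm v)) x"])
    show "integrable lborel (\<lambda>x. max M 0 * indicator (cball (0::'a) (R + norm v)) x)"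
      using emeasure_lborel_cball_finite[of "0::'a" "R + norm v"]
      by (intro integrable_mult_right) (simp add: integrable_indicator_iff)
    show "AE x in lborel. (\<lambda>i. q i x) \<longlonglongrightarrow> D x"
    proof (intro AE_I2)
      fix x
      have "((\<lambda>h. (f (x + (0 + h) *\<^sub>R v) - f (x + 0 *\<^sub>R v)) / h) \<longlongrightarrow> D (x + 0 *\<^sub>R v)) (at 0)"
        using along[of x 0] unfolding DERIV_def .
      moreover have "filterlim (\<lambda>i. 1 / real (Suc i)) (at 0) sequentially"
        using LIMSEQ_Suc[OF lim_1_over_n] by (simp add: filterlim_at del: of_nat_Suc)
      ultimately show "(\<lambda>i. q i x) \<longlonglongrightarrow> D x"
        unfolding q_def by (auto dest: filterlim_compose)
    qed
    show "AE x in lborel. norm (q i x) \<le> max M 0 * indicator (cball 0 (R + norm v)) x" for i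
    proof (intro AE_I2)
      fix x
      define t where "t = 1 / real (Suc i)"
      have t: "0 < t" "t \<le> 1" by (auto simp: t_def)
      show "norm (q i x) \<le> max M 0 * indicator (cball 0 (R + norm v)) x"
      proof (cases "norm x \<le> R + norm v")
        case True
        obtain z where "f (x + t *\<^sub>R v) - f (x + 0 *\<^sub>R v) = (t - 0) * D (x + z *\<^sub>R v)"
          using MVT2[OF t(1), of "\<lambda>s. f (x + s *\<^sub>R v)" "\<lambda>s. D (x + s *\<^sub>R v)"] along by blast
        then have "q i x = D (x + z *\<^sub>R v)"
          using t unfolding q_def t_def[symmetric] by simp
        then show ?thesis using D_bound True by simp
      next
        case False
        have "t * norm v \<le> norm v" using t by (intro mult_left_le_one_le) auto
        then have "R < norm (x + t *\<^sub>R v)"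
          using False norm_triangle_ineq4[of "x + t *\<^sub>R v" "t *\<^sub>R v"] t by simp
        moreover have "R < norm x" using False norm_ge_zero[of v] by linarith
        ultimately show ?thesis using supp False unfolding q_def t_def[symmetric] by simp
      qed
    qed
    show "q i \<in> borel_measurable lborel" for i
      unfolding q_def by measurable
  qed measurable
  then have "(\<lambda>_. 0) \<longlonglongrightarrow> (\<integral>x. D x \<partial>lborel)" by (simp add: int_q)
  then show ?thesis unfolding D_def using LIMSEQ_unique tendsto_const by blast
qed

lemma continuous_L2_loc:
  assumes "continuous_on UNIV f"
  shows "f \<in> L2_loc"
  unfolding L2_loc_def
proof (intro CollectI conjI allI impI)
  show "f \<in> borel_measurable lborel"
    using borel_measurable_continuous_onI[OF assms] by simp
  show "set_integrable lborel K (\<lambda>x. (norm (f x))\<^sup>2)" if "compact K" for K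
    unfolding set_integrable_def using that
    by (rule borel_integrable_compact)
      (intro continuous_on_power continuous_on_norm continuous_on_subset[OF assms] subset_UNIV)
qed

lemmas radial_algebra_L2_loc = continuous_L2_loc[OF radial_algebra_continuous]

lemma integrable_radial_algebra_test_function:
  "w \<in> radial_algebra \<Longrightarrow> \<phi> \<in> test_functions \<Longrightarrow> integrable lborel (\<lambda>x. w x * \<phi> x)"
  using integrable_L2_loc_test_function[OF radial_algebra_L2_loc, of w \<phi>] by (simp add: mult.commute)

lemma integral_by_parts_test_function:
  assumes w: "w \<in> radial_algebra" and \<phi>: "\<phi> \<in> test_functions"
  shows "(\<integral>x. w x * frechet_derivative \<phi> (at x) v \<partial>lborel)
    = - (\<integral>x. frechet_derivative w (at x) v * \<phi> x \<partial>lborel)"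
proof -
  obtain R where R: "\<And>x. R < norm x \<Longrightarrow> \<phi> x = 0" using test_function_support[OF \<phi>] by blast
  have der: "((\<lambda>x. w x * \<phi> x) has_derivative
      (\<lambda>v. w x * frechet_derivative \<phi> (at x) v + frechet_derivative w (at x) v * \<phi> x)) (at x)" for x
    by (rule has_derivative_mult[OF
        frechet_derivative_works[THEN iffD1, OF radial_algebra_differentiable[OF w]]
        frechet_derivative_works[THEN iffD1, OF test_function_differentiable[OF \<phi>]]])
  have eq: "frechet_derivative (\<lambda>x. w x * \<phi> x) (at x) v
      = w x * frechet_derivative \<phi> (at x) v + frechet_derivative w (at x) v * \<phi> x" for x
    using frechet_derivative_at[OF der[of x], symmetric] by simp
  have "(\<integral>x. frechet_derivative (\<lambda>x. w x * \<phi> x) (at x) v \<partial>lborel) = 0"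
  proof (rule integral_frechet_derivative_eq_0)
    show "(\<lambda>x. w x * \<phi> x) differentiable (at x)" for x
      using der differentiable_def by blast
    show "continuous_on UNIV (\<lambda>x. frechet_derivative (\<lambda>x. w x * \<phi> x) (at x) v)"
      unfolding eq by (intro continuous_intros radial_algebra_continuous test_function_continuous
         radial_algebra_frechet_derivative test_function_frechet_derivative w \<phi>)
    show "w x * \<phi> x = 0" if "R < norm x" for x using R[OF that] by simp
  qed
  moreover have "integrable lborel (\<lambda>x. w x * frechet_derivative \<phi> (at x) v)"
    by (intro integrable_radial_algebra_test_function w test_function_frechet_derivative \<phi>)
  moreover have "integrable lborel (\<lambda>x. frechet_derivative w (at x) v * \<phi> x)"
    by (intro integrable_radial_algebra_test_function radial_algebra_frechet_derivative w \<phi>)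
  ultimately show ?thesis
    unfolding eq by (subst (asm) Bochner_Integration.integral_add) auto
qed

text \<open>
  Two integrations by parts against compactly supported functions move the derivatives onto
  \<open>u\<close>: the classical gradient is the weak gradient, and its pairing with the gradient of
  \<open>\<phi>\<close> is the integral of \<open>- laplacian u * \<phi>\<close>.
\<close>

lemma smooth_superharmonic:
  fixes u :: "'a::euclidean_space \<Rightarrow> real"
  assumes u: "u \<in> radial_algebra" and lap: "\<And>x. laplacian u x \<le> 0"
  shows "superharmonic u"
proof -
  have grad_cont: "continuous_on UNIV (grad u)"
    unfolding grad_def by (intro continuous_intros radial_algebra_continuous radial_algebra_frechet_derivative u)
  then have "grad u \<in> L2_loc"
    by (rule continuous_L2_loc)
  moreover have "weak_gradient u (grad u)"
    unfolding weak_gradient_def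
  proof (intro ballI, rule euclidean_eqI)
    fix \<phi> :: "'a \<Rightarrow> real" and b :: 'a
    assume \<phi>: "\<phi> \<in> test_functions" and b: "b \<in> Basis"
    have "integrable lborel (\<lambda>x. \<Sum>c\<in>Basis. (u x * frechet_derivative \<phi> (at x) c) *\<^sub>R c)"
      by (intro Bochner_Integration.integrable_sum integrable_scaleR_left
          integrable_radial_algebra_test_function u test_function_frechet_derivative \<phi>)
    then have "integrable lborel (\<lambda>x. u x *\<^sub>R grad \<phi> x)"
      by (simp add: grad_def scaleR_sum_right)
    then have "(\<integral>x. u x *\<^sub>R grad \<phi> x \<partial>lborel) \<bullet> b = (\<integral>x. u x * frechet_derivative \<phi> (at x) b \<partial>lborel)"
      by (subst integral_inner_left[symmetric]) (simp_all add: grad_inner[OF b])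
    also have "\<dots> = - (\<integral>x. frechet_derivative u (at x) b * \<phi> x \<partial>lborel)"
      by (rule integral_by_parts_test_function[OF u \<phi>])
    also have "(\<integral>x. frechet_derivative u (at x) b * \<phi> x \<partial>lborel) = (\<integral>x. \<phi> x *\<^sub>R grad u x \<partial>lborel) \<bullet> b"
      using integrable_L2_loc_test_function[OF \<open>grad u \<in> L2_loc\<close> \<phi>]
      by (subst integral_inner_left[symmetric]) (simp_all add: grad_inner[OF b] mult.commute)
    finally show "(\<integral>x. u x *\<^sub>R grad \<phi> x \<partial>lborel) \<bullet> b = (- (\<integral>x. \<phi> x *\<^sub>R grad u x \<partial>lborel)) \<bullet> b" by simp
  qed
  moreover have "0 \<le> (\<integral>x. grad u x \<bullet> grad \<phi> x \<partial>lborel)"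
    if \<phi>: "\<phi> \<in> test_functions" "\<forall>x. 0 \<le> \<phi> x" for \<phi>
  proof -
    let ?d = "\<lambda>f b x. frechet_derivative f (at x) b"
    have "(\<integral>x. grad u x \<bullet> grad \<phi> x \<partial>lborel) = (\<integral>x. (\<Sum>b\<in>Basis. ?d u b x * ?d \<phi> b x) \<partial>lborel)"
      by (subst euclidean_inner) (simp add: grad_inner)
    also have "\<dots> = (\<Sum>b\<in>Basis. \<integral>x. ?d u b x * ?d \<phi> b x \<partial>lborel)"
      by (intro Bochner_Integration.integral_sum integrable_radial_algebra_test_function
        radial_algebra_frechet_derivative u test_function_frechet_derivative \<phi>)
    also have "\<dots> = (\<Sum>b\<in>Basis. - (\<integral>x. ?d (?d u b) b x * \<phi> x \<partial>lborel))"
      by (intro sum.cong refl integral_by_parts_test_function radial_algebra_frechet_derivative u \<phi>)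
    also have "\<dots> = - (\<integral>x. (\<Sum>b\<in>Basis. ?d (?d u b) b x * \<phi> x) \<partial>lborel)"
      unfolding sum_negf
      by (intro arg_cong[where f = uminus] Bochner_Integration.integral_sum[symmetric]
        integrable_radial_algebra_test_function radial_algebra_frechet_derivative u \<phi>)
    also have "\<dots> = (\<integral>x. - (laplacian u x * \<phi> x) \<partial>lborel)"
      by (simp add: laplacian_def sum_distrib_right)
    also have "0 \<le> \<dots>"
      using lap \<phi>(2) by (intro integral_nonneg_AE AE_I2) (simp add: mult_nonpos_nonneg)
    finally show ?thesis .
  qed
  ultimately show ?thesis
    using radial_algebra_L2_loc[OF u] unfolding superharmonic_def by blast
qed


section \<open>Failure of the Liouville property in large effective dimension\<close>

lemma nn_integral_japanese_bracket_1d: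
  assumes c: "1 / 2 < c"
  shows "(\<integral>\<^sup>+t. ennreal ((1 + t\<^sup>2) powr (- c)) \<partial>lborel) < \<infinity>"
proof -
  define f where "f t = ennreal (2 powr c * (1 + t) powr (- (2 * c))) * indicator {0<..} t" for t :: real
  have [measurable]: "f \<in> borel_measurable borel" unfolding f_def by measurable
  have half: "(\<integral>\<^sup>+t. f t \<partial>lborel) < \<infinity>"
  proof -
    have "(\<integral>\<^sup>+t. f t \<partial>lborel) = ennreal (2 powr c) * (\<integral>\<^sup>+t\<in>{0<..}. ennreal ((1 + t) powr (- (2 * c))) \<partial>lborel)"
      unfolding f_def by (subst nn_integral_cmult[symmetric]) (auto simp: ennreal_mult mult.assoc)
    also have "\<dots> < \<infinity>"
      using c by (subst nn_integral_powr_shifted) (auto simp: ennreal_mult_less_top)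
    finally show ?thesis .
  qed
  have refl: "(\<integral>\<^sup>+t. f (- t) \<partial>lborel) = (\<integral>\<^sup>+t. f t \<partial>lborel)"
    using nn_integral_real_affine[of f "-1" 0] by simp
  have "(\<integral>\<^sup>+t. ennreal ((1 + t\<^sup>2) powr (- c)) \<partial>lborel) \<le> (\<integral>\<^sup>+t. f t + f (- t) \<partial>lborel)"
  proof (rule nn_integral_mono_AE)
    have pt: "(1 + t\<^sup>2) powr (- c) \<le> 2 powr c * (1 + \<bar>t\<bar>) powr (- (2 * c))" for t :: real
    proof -
      have "(1 + \<bar>t\<bar>)\<^sup>2 / 2 \<le> 1 + t\<^sup>2"
        using zero_le_power2[of "1 - \<bar>t\<bar>"] by (simp add: power2_diff power2_sum)
      then have "(1 + t\<^sup>2) powr (- c) \<le> ((1 + \<bar>t\<bar>)\<^sup>2 / 2) powr (- c)"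
        using c by (intro powr_mono2') auto
      also have "\<dots> = ((1 + \<bar>t\<bar>) powr 2) powr (- c) / 2 powr (- c)"
        by (simp add: powr_divide)
      also have "\<dots> = 2 powr c * (1 + \<bar>t\<bar>) powr (- (2 * c))"
        unfolding powr_powr by (simp add: powr_minus field_simps)
      finally show ?thesis .
    qed
    show "AE t in lborel. ennreal ((1 + t\<^sup>2) powr (- c)) \<le> f t + f (- t)"
      using AE_lborel_singleton[of "0::real"]
    proof eventually_elim
      case (elim t)
      then show ?case using pt[of t] by (cases "0 < t") (auto simp: f_def intro!: ennreal_leI)
    qed
  qed
  also have "\<dots> = (\<integral>\<^sup>+t. f t \<partial>lborel) + (\<integral>\<^sup>+t. f t \<partial>lborel)"
    by (subst nn_integral_add) (auto simp: refl)
  also have "\<dots> < \<infinity>" using half by simp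
  finally show ?thesis .
qed

text \<open>
  Since every squared coordinate is at most the squared norm, the integrand is bounded by a
  product of functions of one coordinate each.
\<close>

lemma nn_integral_japanese_bracket:
  assumes e: "real DIM('a) < e"
  shows "(\<integral>\<^sup>+(x::'a::euclidean_space). ennreal ((1 + x \<bullet> x) powr (- e / 2)) \<partial>lborel) < \<infinity>"
proof -
  define m where "m = real DIM('a)"
  define c where "c = e / (2 * m)"
  have m: "m > 0" by (simp add: m_def)
  have c: "c > 1 / 2" using e m by (simp add: c_def m_def field_simps)
  have pt: "(1 + x \<bullet> x) powr (- e / 2) \<le> (\<Prod>b\<in>Basis. (1 + (x \<bullet> b)\<^sup>2) powr (- c))" for x :: 'a
  proof -
    have "(1 + x \<bullet> x) powr (- e / 2) = ((1 + x \<bullet> x) powr (- c)) powr m"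
      unfolding powr_powr using m by (intro arg_cong[where f = "(powr) (1 + x \<bullet> x)"]) (simp add: c_def)
    also have "\<dots> = (\<Prod>b\<in>(Basis :: 'a set). (1 + x \<bullet> x) powr (- c))"
    proof -
      have "0 < 1 + x \<bullet> x" by (simp add: add_pos_nonneg)
      then show ?thesis by (simp add: m_def powr_realpow)
    qed
    also have "\<dots> \<le> (\<Prod>b\<in>Basis. (1 + (x \<bullet> b)\<^sup>2) powr (- c))"
    proof (intro prod_mono conjI)
      fix b :: 'a
      assume b: "b \<in> Basis"
      have "(x \<bullet> b)\<^sup>2 \<le> x \<bullet> x"
        using Basis_le_norm[OF b, of x] by (simp add: power2_norm_eq_inner[symmetric] abs_le_square_iff[symmetric])
      then show "(1 + x \<bullet> x) powr (- c) \<le> (1 + (x \<bullet> b)\<^sup>2) powr (- c)"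
        using c by (intro powr_mono2') (auto simp: add_pos_nonneg)
    qed auto
    finally show ?thesis .
  qed
  have "(\<integral>\<^sup>+(x::'a). ennreal ((1 + x \<bullet> x) powr (- e / 2)) \<partial>lborel)
    \<le> (\<integral>\<^sup>+(x::'a). (\<Prod>b\<in>Basis. ennreal ((1 + (x \<bullet> b)\<^sup>2) powr (- c))) \<partial>lborel)"
    using pt by (intro nn_integral_mono) (simp add: prod_ennreal ennreal_leI)
  also have "\<dots> = (\<Prod>b\<in>(Basis :: 'a set). \<integral>\<^sup>+t. ennreal ((1 + t\<^sup>2) powr (- c)) \<partial>lborel)"
    by (rule nn_integral_lborel_prod) auto
  also have "\<dots> < \<infinity>"
    using nn_integral_japanese_bracket_1d[OF c]
    by (cases "\<integral>\<^sup>+t. ennreal ((1 + t\<^sup>2) powr (- c)) \<partial>lborel") (auto simp: ennreal_power)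
  finally show ?thesis .
qed

text \<open>
  The function \<open>(1 + x \<bullet> x) powr (- (n - 2) / 2)\<close>, a smooth relative of the fundamental
  solution, is superharmonic on the \<open>n\<close>-dimensional product. It is bounded by a product of
  two such powers in the single variables whose decay rates \<open>a1\<close> and \<open>a2\<close> add up to
  \<open>n - 2\<close>. Their norms with exponents \<open>q1\<close> and \<open>q2\<close> are finite if \<open>a1 > n1 / q1\<close> and \<open>a2 > n2 / q2\<close>,
  and since \<open>n1 / q1 + n2 / q2 = n - D\<close> such a choice exists exactly for \<open>D > 2\<close>.
\<close>

theorem not_mixed_Liouville:
  assumes p: "1 < p1" "1 < q1" "1 / p1 + 1 / q1 = 1" "1 < p2" "1 < q2" "1 / p2 + 1 / q2 = 1"
    and D: "2 < DIM('a) / p1 + DIM('b) / p2"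
  shows "\<not> mixed_Liouville TYPE('a::euclidean_space \<times> 'b::euclidean_space) q1 q2"
proof
  assume Liou: "mixed_Liouville TYPE('a \<times> 'b) q1 q2"
  define n where "n = real DIM('a \<times> 'b)"
  define s where "s = (n - 2) / 2"
  define \<delta> where "\<delta> = (DIM('a) / p1 + DIM('b) / p2 - 2) / 2"
  \<comment> \<open>The surplus \<open>n - 2 - (n - D) = D - 2\<close> is shared equally by the two rates.\<close>
  define a1 where "a1 = DIM('a) / q1 + \<delta>"
  define a2 where "a2 = DIM('b) / q2 + \<delta>"
  have \<delta>: "\<delta> > 0" using D by (simp add: \<delta>_def)
  have sum: "a1 + a2 = n - 2"
    unfolding a1_def a2_def \<delta>_def n_def conjugate_exponent_divide[OF p(3)] conjugate_exponent_divide[OF p(6)] by (simp add: field_simps)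
  have a1: "a1 > 0" "real DIM('a) < a1 * q1"
    using \<delta> p by (simp_all add: a1_def distrib_right add_nonneg_pos)
  have a2: "a2 > 0" "real DIM('b) < a2 * q2"
    using \<delta> p by (simp_all add: a2_def distrib_right add_nonneg_pos)
  have s: "s > 0" "s = a1 / 2 + a2 / 2" using a1 a2 sum by (simp_all add: s_def)
  define u where "u = (\<lambda>x::'a \<times> 'b. (1 + x \<bullet> x) powr (- s))"
  have u: "u \<in> radial_algebra"
    unfolding u_def by (intro radial_algebra.radial smooth_powr)
  have "laplacian u x \<le> 0" for x
  proof -
    define r where "r = x \<bullet> x"
    have r: "r \<ge> 0" by (simp add: r_def)
    have der: "((\<lambda>r. (1 + r) powr e) has_real_derivative e * (1 + t) powr (e - 1)) (at t)" if "0 \<le> t" for t e :: real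
      using DERIV_chain2[OF has_real_derivative_powr, of "\<lambda>r. 1 + r" t 1 UNIV e] that
      by (auto intro!: derivative_eq_intros)
    have "laplacian u x = 4 * r * (- s * ((- s - 1) * (1 + r) powr (- s - 1 - 1)))
        + 2 * real DIM('a \<times> 'b) * (- s * (1 + r) powr (- s - 1))"
      unfolding u_def r_def
      by (rule laplacian_radial[OF der DERIV_cmult[OF der]])
    also have "(1 + r) powr (- s - 1) = (1 + r) * (1 + r) powr (- s - 1 - 1)"
    proof -
      have "1 + (- s - 1 - 1) = - s - 1" "0 \<le> 1 + r" using r by simp_all
      then show ?thesis using powr_mult_base[of "1 + r" "- s - 1 - 1"] by metis
    qed
    also have "4 * r * (- s * ((- s - 1) * (1 + r) powr (- s - 1 - 1)))
        + 2 * real DIM('a \<times> 'b) * (- s * ((1 + r) * (1 + r) powr (- s - 1 - 1)))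
      = - (2 * n * s * (1 + r) powr (- s - 1 - 1))"
    proof -
      have "n = 2 * s + 2" by (simp add: s_def field_simps)
      moreover have "real DIM('a \<times> 'b) = n" by (simp only: n_def)
      ultimately show ?thesis by (simp only:) (simp add: algebra_simps)
    qed
    also have "\<dots> \<le> 0" using s by (simp add: n_def)
    finally show ?thesis .
  qed
  then have "superharmonic u" by (rule smooth_superharmonic[OF u])
  moreover have "AE x in lborel. 0 \<le> u x" by (simp add: u_def)
  moreover have "u \<in> mixed_Lp q1 q2"
  proof -
    have [measurable]: "u \<in> borel_measurable borel"
      using radial_algebra_continuous[OF u] by (rule borel_measurable_continuous_onI)
    have bound: "\<bar>u (x, y)\<bar> \<le> (1 + x \<bullet> x) powr (- a1 / 2) * (1 + y \<bullet> y) powr (- a2 / 2)" for x y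
    proof -
      have "u (x, y) = (1 + (x \<bullet> x + y \<bullet> y)) powr (- a1 / 2) * (1 + (x \<bullet> x + y \<bullet> y)) powr (- a2 / 2)"
        by (simp add: u_def s powr_add[symmetric])
      also have "\<dots> \<le> (1 + x \<bullet> x) powr (- a1 / 2) * (1 + y \<bullet> y) powr (- a2 / 2)"
        using a1 a2 by (intro mult_mono powr_mono2') (auto simp: add_pos_nonneg)
      finally show ?thesis by (simp add: u_def)
    qed
    define I1 where "I1 = (\<integral>\<^sup>+(x::'a). ennreal ((1 + x \<bullet> x) powr (- (a1 * q1) / 2)) \<partial>lborel)"
    define I2 where "I2 = (\<integral>\<^sup>+(y::'b). ennreal ((1 + y \<bullet> y) powr (- (a2 * q2) / 2)) \<partial>lborel)"
    have I: "I1 < \<infinity>" "I2 < \<infinity>"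
      unfolding I1_def I2_def by (intro nn_integral_japanese_bracket a1 a2)+
    obtain i1 where i1: "I1 = ennreal i1" "0 \<le> i1" using I(1) by (cases I1) auto
    have inner: "ennreal_powr (\<integral>\<^sup>+x. ennreal (\<bar>u (x, y)\<bar> powr q1) \<partial>lborel) (q2 / q1)
        \<le> ennreal (i1 powr (q2 / q1)) * ennreal ((1 + y \<bullet> y) powr (- (a2 * q2) / 2))" for y
    proof -
      have "(\<integral>\<^sup>+x. ennreal (\<bar>u (x, y)\<bar> powr q1) \<partial>lborel)
        \<le> (\<integral>\<^sup>+(x::'a). ennreal ((1 + y \<bullet> y) powr (- (a2 * q1) / 2)) * ennreal ((1 + x \<bullet> x) powr (- (a1 * q1) / 2)) \<partial>lborel)"
      proof (intro nn_integral_mono)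
        fix x
        have "\<bar>u (x, y)\<bar> powr q1 \<le> ((1 + x \<bullet> x) powr (- a1 / 2) * (1 + y \<bullet> y) powr (- a2 / 2)) powr q1"
          using p by (intro powr_mono2 bound) auto
        also have "\<dots> = (1 + y \<bullet> y) powr (- (a2 * q1) / 2) * (1 + x \<bullet> x) powr (- (a1 * q1) / 2)"
          by (simp add: powr_mult powr_powr)
        finally show "ennreal (\<bar>u (x, y)\<bar> powr q1)
          \<le> ennreal ((1 + y \<bullet> y) powr (- (a2 * q1) / 2)) * ennreal ((1 + x \<bullet> x) powr (- (a1 * q1) / 2))"
          by (simp add: ennreal_mult[symmetric] ennreal_leI)
      qed
      also have "\<dots> = ennreal ((1 + y \<bullet> y) powr (- (a2 * q1) / 2)) * I1"
        unfolding I1_def by (intro nn_integral_cmult) measurable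
      also have "\<dots> = ennreal ((1 + y \<bullet> y) powr (- (a2 * q1) / 2) * i1)"
        using i1 by (simp add: ennreal_mult)
      finally have "ennreal_powr (\<integral>\<^sup>+x. ennreal (\<bar>u (x, y)\<bar> powr q1) \<partial>lborel) (q2 / q1)
         \<le> ennreal_powr (ennreal ((1 + y \<bullet> y) powr (- (a2 * q1) / 2) * i1)) (q2 / q1)"
        using p by (intro ennreal_powr_mono) auto
      also have "\<dots> = ennreal (((1 + y \<bullet> y) powr (- (a2 * q1) / 2) * i1) powr (q2 / q1))"
        using i1 by (intro ennreal_powr_ennreal) auto
      also have "((1 + y \<bullet> y) powr (- (a2 * q1) / 2) * i1) powr (q2 / q1)
          = i1 powr (q2 / q1) * (1 + y \<bullet> y) powr (- (a2 * q2) / 2)"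
        using p by (simp add: powr_mult powr_powr)
      finally show ?thesis by (simp add: ennreal_mult)
    qed
    have "(\<integral>\<^sup>+y. ennreal_powr (\<integral>\<^sup>+x. ennreal (\<bar>u (x, y)\<bar> powr q1) \<partial>lborel) (q2 / q1) \<partial>lborel)
      \<le> (\<integral>\<^sup>+(y::'b). ennreal (i1 powr (q2 / q1)) * ennreal ((1 + y \<bullet> y) powr (- (a2 * q2) / 2)) \<partial>lborel)"
      by (intro nn_integral_mono inner)
    also have "\<dots> = ennreal (i1 powr (q2 / q1)) * I2"
      unfolding I2_def by (intro nn_integral_cmult) measurable
    also have "\<dots> < \<infinity>" using I(2) by (simp add: ennreal_mult_less_top)
    finally show ?thesis
      by (simp add: mixed_Lp_def mixed_norm_def ennreal_powr_less_top_iff[unfolded infinity_ennreal_def])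
  qed
  ultimately obtain c where c: "AE x in lborel. u x = c"
    using Liou unfolding mixed_Liouville_def by blast
  have "u x = c" for x
  proof (rule ccontr)
    assume "u x \<noteq> c"
    have "open {x. u x \<noteq> c}"
      by (intro open_Collect_neq radial_algebra_continuous[OF u] continuous_intros)
    then have "{x. u x \<noteq> c} \<in> sets lborel" by simp
    then have "{x. u x \<noteq> c} \<in> null_sets lborel"
      using c AE_iff_null[of lborel "\<lambda>x. u x = c"] by simp
    then have "negligible {x. u x \<noteq> c}"
      by (simp add: negligible_iff_null_sets null_sets_completionI)
    then show False
      using open_not_negligible[OF \<open>open {x. u x \<noteq> c}\<close>] \<open>u x \<noteq> c\<close> by blast
  qed
  then have const: "u x = u y" for x y by simp
  obtain b :: "'a \<times> 'b" where b: "b \<in> Basis" using nonempty_Basis by blast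
  have "u b = 2 powr (- s)" "u 0 = 1" using b by (simp_all add: u_def)
  then have "2 powr (- s) = 1" using const[of b 0] by simp
  moreover have "2 powr (- s) < 2 powr (0::real)" using s by (intro powr_less_mono) auto
  ultimately show False by simp
qed


section \<open>The Liouville property in small effective dimension\<close>

text \<open>
  Both sides are pairings of \<open>u\<close> with the Laplacian of a Gaussian. The difference
  \<open>exp (- a * r) - exp (- b * r)\<close> of the Gaussians is nonnegative, so that the claim would be
  superharmonicity tested against it, if it had compact support. The cutoff
  \<open>bump_deriv 0 (1 - \<epsilon> * r)\<close> with \<open>\<epsilon>\<close> tending to 0 makes this rigorous; it tends to
  the constant \<open>bump_deriv 0 1\<close> instead of 1, which is harmless as this constant is positive.
\<close>

lemma superharmonic_gaussian_mono:
  fixes u :: "'a::euclidean_space \<Rightarrow> real" and a b :: real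
  assumes u: "superharmonic u" and ab: "0 < a" "a < b"
    and int0: "\<And>c. 0 < c \<Longrightarrow> integrable lborel (\<lambda>x. u x * exp (- c * (x \<bullet> x)))"
    and int1: "\<And>c. 0 < c \<Longrightarrow> integrable lborel (\<lambda>x. u x * ((x \<bullet> x) * exp (- c * (x \<bullet> x))))"
  shows "(\<integral>x. u x * ((4 * a\<^sup>2 * (x \<bullet> x) - 2 * real DIM('a) * a) * exp (- a * (x \<bullet> x))) \<partial>lborel)
    \<le> (\<integral>x. u x * ((4 * b\<^sup>2 * (x \<bullet> x) - 2 * real DIM('a) * b) * exp (- b * (x \<bullet> x))) \<partial>lborel)"
proof -
  define n where "n = real DIM('a)"
  \<comment> \<open>As functions of \<open>r = x \<bullet> x\<close>: the difference of the Gaussians, the cutoff, their product,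
    and the derivatives of these.\<close>
  define k0 where "k0 r = exp (- a * r) - exp (- b * r)" for r :: real
  define k1 where "k1 r = b * exp (- b * r) - a * exp (- a * r)" for r :: real
  define k2 where "k2 r = a\<^sup>2 * exp (- a * r) - b\<^sup>2 * exp (- b * r)" for r :: real
  define \<beta> where "\<beta> j \<epsilon> r = bump_deriv j (1 - \<epsilon> * r)" for j and \<epsilon> r :: real
  define h0 where "h0 \<epsilon> r = \<beta> 0 \<epsilon> r * k0 r" for \<epsilon> r :: real
  define h1 where "h1 \<epsilon> r = - \<epsilon> * \<beta> 1 \<epsilon> r * k0 r + \<beta> 0 \<epsilon> r * k1 r" for \<epsilon> r :: real
  define h2 where "h2 \<epsilon> r = \<epsilon>\<^sup>2 * \<beta> 2 \<epsilon> r * k0 r - 2 * \<epsilon> * \<beta> 1 \<epsilon> r * k1 r + \<beta> 0 \<epsilon> r * k2 r" for \<epsilon> r :: real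
  have dk0: "(k0 has_real_derivative k1 r) (at r)" for r
    unfolding k0_def k1_def by (auto intro!: derivative_eq_intros)
  have dk1: "(k1 has_real_derivative k2 r) (at r)" for r
    unfolding k1_def k2_def by (auto intro!: derivative_eq_intros simp: power2_eq_square)
  have d\<beta>: "(\<beta> j \<epsilon> has_real_derivative - \<epsilon> * \<beta> (Suc j) \<epsilon> r) (at r)" for j \<epsilon> r
    unfolding \<beta>_def
    by (rule DERIV_cong, rule DERIV_chain2[OF bump_deriv_has_derivative]) (auto intro!: derivative_eq_intros)
  have dh0: "(h0 \<epsilon> has_real_derivative h1 \<epsilon> r) (at r)" for \<epsilon> r
    unfolding h0_def h1_def
    by (rule DERIV_cong, rule DERIV_mult[OF d\<beta> dk0]) (simp add: algebra_simps)
  have dh1: "(h1 \<epsilon> has_real_derivative h2 \<epsilon> r) (at r)" for \<epsilon> r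
    unfolding h1_def h2_def
    by (rule DERIV_cong, rule DERIV_add[OF DERIV_mult[OF DERIV_cmult[OF d\<beta>] dk0] DERIV_mult[OF d\<beta> dk1]])
      (simp add: algebra_simps power2_eq_square numeral_2_eq_2)
  define \<epsilon> where "\<epsilon> i = 1 / real (Suc i)" for i
  have \<epsilon>: "0 < \<epsilon> i" "\<epsilon> i \<le> 1" for i by (auto simp: \<epsilon>_def)
  have \<epsilon>_lim: "\<epsilon> \<longlonglongrightarrow> 0" unfolding \<epsilon>_def by (rule LIMSEQ_Suc[OF lim_1_over_n])
  define \<phi> where "\<phi> i = (\<lambda>x::'a. h0 (\<epsilon> i) (x \<bullet> x))" for i
  have \<phi>_test: "\<phi> i \<in> test_functions" for i
  proof (rule test_functionI)
    have "(\<lambda>x::'a. bump_deriv 0 (1 - \<epsilon> i * (x \<bullet> x)) * (exp (- a * (x \<bullet> x)) + - 1 * exp (- b * (x \<bullet> x)))) \<in> radial_algebra"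
      by (intro radial_algebra.mult radial_algebra.add radial_algebra.const radial_algebra.radial smooth_bump smooth_exp)
    then have "\<phi> i \<in> radial_algebra"
      by (simp add: \<phi>_def h0_def \<beta>_def k0_def)
    then show "k_times_cont_diff k (\<phi> i)" for k
      by (rule radial_algebra_k_times_cont_diff)
    show "\<phi> i x = 0" if "sqrt (1 / \<epsilon> i) < norm x" for x
    proof -
      have "1 / \<epsilon> i < (norm x)\<^sup>2"
        using that \<epsilon>[of i] real_sqrt_less_iff[of "1 / \<epsilon> i" "(norm x)\<^sup>2"] by simp
      then have "1 - \<epsilon> i * (x \<bullet> x) \<le> 0"
        using \<epsilon>[of i] by (simp add: power2_norm_eq_inner divide_less_eq mult.commute)
      then show ?thesis by (simp add: \<phi>_def h0_def \<beta>_def bump_deriv_nonpos)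
    qed
  qed
  have \<phi>_nonneg: "0 \<le> \<phi> i x" for i x
    using ab by (auto simp: \<phi>_def h0_def \<beta>_def k0_def bump_nonneg mult_right_mono intro!: mult_nonneg_nonneg)
  \<comment> \<open>The Laplacian of the test function, as a function of \<open>r\<close>.\<close>
  define l where "l \<epsilon> r = 4 * r * h2 \<epsilon> r + 2 * n * h1 \<epsilon> r" for \<epsilon> r :: real
  have lap: "laplacian (\<phi> i) x = l (\<epsilon> i) (x \<bullet> x)" for i x
    unfolding \<phi>_def l_def n_def by (rule laplacian_radial[OF dh0 dh1])
  have le0: "(\<integral>x. u x * l (\<epsilon> i) (x \<bullet> x) \<partial>lborel) \<le> 0" for i
    using superharmonic_integral_laplacian[OF u \<phi>_test \<phi>_nonneg, of i] by (simp add: lap)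
  define l0 where "l0 r = bump_deriv 0 1 * (4 * r * k2 r + 2 * n * k1 r)" for r :: real
  have \<beta>_lim: "(\<lambda>i. \<beta> j (\<epsilon> i) r) \<longlonglongrightarrow> bump_deriv j 1" for j r
  proof -
    have "(\<lambda>i. 1 - \<epsilon> i * r) \<longlonglongrightarrow> 1 - 0 * r" by (intro tendsto_intros \<epsilon>_lim)
    then show ?thesis
      unfolding \<beta>_def using isCont_tendsto_compose[OF isCont_bump_deriv[of 1 j]] by simp
  qed
  have l_lim: "(\<lambda>i. l (\<epsilon> i) r) \<longlonglongrightarrow> l0 r" for r
  proof -
    have "(\<lambda>i. l (\<epsilon> i) r) \<longlonglongrightarrow> 4 * r * (0\<^sup>2 * bump_deriv 2 1 * k0 r - 2 * 0 * bump_deriv 1 1 * k1 r + bump_deriv 0 1 * k2 r)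
        + 2 * n * (- 0 * bump_deriv 1 1 * k0 r + bump_deriv 0 1 * k1 r)"
      unfolding l_def h1_def h2_def by (intro tendsto_intros \<beta>_lim \<epsilon>_lim)
    then show ?thesis by (simp add: l0_def algebra_simps)
  qed
  obtain B where B: "0 \<le> B" "\<And>j \<epsilon> r. j \<in> {0, 1, 2} \<Longrightarrow> 0 \<le> \<epsilon> \<Longrightarrow> 0 \<le> r \<Longrightarrow> \<bar>\<beta> j \<epsilon> r\<bar> \<le> B"
  proof -
    obtain B0 B1 B2 where "\<forall>s\<le>1. \<bar>bump_deriv 0 s\<bar> \<le> B0" "\<forall>s\<le>1. \<bar>bump_deriv 1 s\<bar> \<le> B1"
       "\<forall>s\<le>1. \<bar>bump_deriv 2 s\<bar> \<le> B2" "0 \<le> B0"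
      using bump_deriv_bounded by metis
    then show ?thesis
      by (intro that[of "max B0 (max B1 B2)"]) (auto simp: \<beta>_def le_max_iff_disj)
  qed
  define C where "C = 4 * (B * (2 + 4 * b + 2 * b\<^sup>2)) + 2 * n * (B * (2 + 2 * b))"
  have bound: "\<bar>l (\<epsilon> i) r\<bar> \<le> C * ((r + 1) * exp (- a * r))" if r: "0 \<le> r" for i r
  proof -
    define E where "E = exp (- a * r)"
    have E: "E > 0" "exp (- b * r) \<le> E"
      using ab r by (auto simp: E_def mult_right_mono)
    have K0: "\<bar>k0 r\<bar> \<le> 2 * E" unfolding k0_def E_def[symmetric] abs_le_iff using E exp_gt_zero[of "- b * r"] by linarith
    have K1: "\<bar>k1 r\<bar> \<le> 2 * b * E"
    proof -
      have "a * E \<le> b * E" "b * exp (- b * r) \<le> b * E" using ab E by (auto intro: mult_left_mono)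
      moreover have "0 \<le> a * E" "0 \<le> b * exp (- b * r)" using ab E by auto
      ultimately show ?thesis unfolding k1_def E_def[symmetric] by linarith
    qed
    have K2: "\<bar>k2 r\<bar> \<le> 2 * b\<^sup>2 * E"
    proof -
      have "a\<^sup>2 \<le> b\<^sup>2" using ab by (intro power_mono) auto
      then have "a\<^sup>2 * E \<le> b\<^sup>2 * E" "b\<^sup>2 * exp (- b * r) \<le> b\<^sup>2 * E" using ab E by (auto intro: mult_left_mono)
      moreover have "0 \<le> a\<^sup>2 * E" "0 \<le> b\<^sup>2 * exp (- b * r)" using ab E by auto
      ultimately show ?thesis unfolding k2_def E_def[symmetric] by linarith
    qed
    have \<beta>s: "\<bar>\<beta> 0 (\<epsilon> i) r\<bar> \<le> B" "\<bar>\<beta> 1 (\<epsilon> i) r\<bar> \<le> B" "\<bar>\<beta> 2 (\<epsilon> i) r\<bar> \<le> B"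
      using B(2) \<epsilon>[of i] r by (simp_all add: less_imp_le)
    have \<epsilon>B: "\<bar>\<epsilon> i * \<beta> 1 (\<epsilon> i) r\<bar> \<le> B" "\<bar>(\<epsilon> i)\<^sup>2 * \<beta> 2 (\<epsilon> i) r\<bar> \<le> B"
    proof -
      have "\<bar>\<epsilon> i\<bar> * \<bar>\<beta> 1 (\<epsilon> i) r\<bar> \<le> 1 * B" using \<epsilon>[of i] \<beta>s by (intro mult_mono) auto
      then show "\<bar>\<epsilon> i * \<beta> 1 (\<epsilon> i) r\<bar> \<le> B" by (simp add: abs_mult)
      have "\<bar>(\<epsilon> i)\<^sup>2\<bar> * \<bar>\<beta> 2 (\<epsilon> i) r\<bar> \<le> 1 * B" using \<epsilon>[of i] \<beta>s by (intro mult_mono) (auto simp: power_le_one)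
      then show "\<bar>(\<epsilon> i)\<^sup>2 * \<beta> 2 (\<epsilon> i) r\<bar> \<le> B" by (simp add: abs_mult)
    qed
    have prod: "\<bar>x * y\<bar> \<le> B * Y" if "\<bar>x\<bar> \<le> B" "\<bar>y\<bar> \<le> Y" for x y Y :: real
      using that B(1) by (auto simp: abs_mult intro!: mult_mono)
    have H1: "\<bar>h1 (\<epsilon> i) r\<bar> \<le> B * (2 + 2 * b) * E"
      using prod[OF \<epsilon>B(1) K0] prod[OF \<beta>s(1) K1] unfolding h1_def by (simp add: algebra_simps abs_le_iff)
    have H2: "\<bar>h2 (\<epsilon> i) r\<bar> \<le> B * (2 + 4 * b + 2 * b\<^sup>2) * E"
      using prod[OF \<epsilon>B(2) K0] prod[OF \<epsilon>B(1) K1] prod[OF \<beta>s(1) K2]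
      unfolding h2_def by (simp add: algebra_simps abs_le_iff)
    have n0: "n \<ge> 0" by (simp add: n_def)
    have "\<bar>l (\<epsilon> i) r\<bar> \<le> 4 * r * \<bar>h2 (\<epsilon> i) r\<bar> + 2 * n * \<bar>h1 (\<epsilon> i) r\<bar>"
      unfolding l_def using r n0 by (intro order_trans[OF abs_triangle_ineq]) (simp add: abs_mult)
    also have "\<dots> \<le> 4 * r * (B * (2 + 4 * b + 2 * b\<^sup>2) * E) + 2 * n * (B * (2 + 2 * b) * E)"
      using H1 H2 r n0 by (intro add_mono mult_left_mono) auto
    also have "\<dots> \<le> 4 * (r + 1) * (B * (2 + 4 * b + 2 * b\<^sup>2) * E) + 2 * n * (r + 1) * (B * (2 + 2 * b) * E)"
      using r n0 B(1) E(1) ab by (intro add_mono mult_right_mono mult_nonneg_nonneg add_nonneg_nonneg) (auto simp: mult_left_mono mult_le_cancel_left1 distrib_left)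
    also have "\<dots> = C * ((r + 1) * exp (- a * r))"
      unfolding C_def E_def[symmetric] by (simp only: distrib_left distrib_right ac_simps)
    finally show ?thesis .
  qed
  have [measurable]: "u \<in> borel_measurable borel"
    using u by (auto simp: superharmonic_def L2_loc_def)
  have "(\<lambda>i. \<integral>x. u x * l (\<epsilon> i) (x \<bullet> x) \<partial>lborel) \<longlonglongrightarrow> (\<integral>x. u x * l0 (x \<bullet> x) \<partial>lborel)"
  proof (rule integral_dominated_convergence[where
        w = "\<lambda>x. C * (norm (u x * ((x \<bullet> x) * exp (- a * (x \<bullet> x)))) + norm (u x * exp (- a * (x \<bullet> x))))"])
    show "integrable lborel (\<lambda>x. C * (norm (u x * ((x \<bullet> x) * exp (- a * (x \<bullet> x)))) + norm (u x * exp (- a * (x \<bullet> x)))))"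
      using int0[OF ab(1)] int1[OF ab(1)]
      by (intro integrable_mult_right Bochner_Integration.integrable_add integrable_norm)
    show "AE x in lborel. (\<lambda>i. u x * l (\<epsilon> i) (x \<bullet> x)) \<longlonglongrightarrow> u x * l0 (x \<bullet> x)"
      by (intro AE_I2 tendsto_mult tendsto_const l_lim)
    show "AE x in lborel. norm (u x * l (\<epsilon> i) (x \<bullet> x))
        \<le> C * (norm (u x * ((x \<bullet> x) * exp (- a * (x \<bullet> x)))) + norm (u x * exp (- a * (x \<bullet> x))))" for i
    proof (intro AE_I2)
      fix x :: 'a
      have "norm (u x * l (\<epsilon> i) (x \<bullet> x)) \<le> \<bar>u x\<bar> * (C * ((x \<bullet> x + 1) * exp (- a * (x \<bullet> x))))"
        using bound[of "x \<bullet> x" i] by (simp add: abs_mult mult_left_mono)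
      also have "\<dots> = C * (norm (u x * ((x \<bullet> x) * exp (- a * (x \<bullet> x)))) + norm (u x * exp (- a * (x \<bullet> x))))"
        by (simp add: abs_mult algebra_simps)
      finally show "norm (u x * l (\<epsilon> i) (x \<bullet> x))
        \<le> C * (norm (u x * ((x \<bullet> x) * exp (- a * (x \<bullet> x)))) + norm (u x * exp (- a * (x \<bullet> x))))" .
    qed
    have "(\<lambda>r. bump_deriv j r) \<in> borel_measurable borel" for j
      using isCont_bump_deriv by (intro borel_measurable_continuous_onI continuous_at_imp_continuous_on) auto
    note [measurable] = measurable_compose[OF _ this]
    show "(\<lambda>x. u x * l (\<epsilon> i) (x \<bullet> x)) \<in> borel_measurable lborel" for i
      unfolding l_def h1_def h2_def \<beta>_def k0_def k1_def k2_def by measurable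
    show "(\<lambda>x. u x * l0 (x \<bullet> x)) \<in> borel_measurable lborel"
      unfolding l0_def k1_def k2_def by measurable
  qed
  then have "(\<integral>x. u x * l0 (x \<bullet> x) \<partial>lborel) \<le> 0"
    using le0 by (intro LIMSEQ_le_const2) auto
  also have "(\<integral>x. u x * l0 (x \<bullet> x) \<partial>lborel)
     = (\<integral>x. bump_deriv 0 1 * (u x * (4 * (x \<bullet> x) * k2 (x \<bullet> x) + 2 * n * k1 (x \<bullet> x))) \<partial>lborel)"
    by (simp add: l0_def ac_simps)
  also have "\<dots> = bump_deriv 0 1 * (\<integral>x. u x * (4 * (x \<bullet> x) * k2 (x \<bullet> x) + 2 * n * k1 (x \<bullet> x)) \<partial>lborel)"
    by simp
  finally have "(\<integral>x. u x * (4 * (x \<bullet> x) * k2 (x \<bullet> x) + 2 * n * k1 (x \<bullet> x)) \<partial>lborel) \<le> 0"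
    using bump_pos[of 1] by (simp add: mult_le_0_iff)
  also have "(\<integral>x. u x * (4 * (x \<bullet> x) * k2 (x \<bullet> x) + 2 * n * k1 (x \<bullet> x)) \<partial>lborel)
    = (\<integral>x. u x * ((4 * a\<^sup>2 * (x \<bullet> x) - 2 * n * a) * exp (- a * (x \<bullet> x)))
          - u x * ((4 * b\<^sup>2 * (x \<bullet> x) - 2 * n * b) * exp (- b * (x \<bullet> x))) \<partial>lborel)"
    by (intro Bochner_Integration.integral_cong refl) (simp add: k1_def k2_def algebra_simps)
  also have "\<dots> = (\<integral>x. u x * ((4 * a\<^sup>2 * (x \<bullet> x) - 2 * n * a) * exp (- a * (x \<bullet> x))) \<partial>lborel)
        - (\<integral>x. u x * ((4 * b\<^sup>2 * (x \<bullet> x) - 2 * n * b) * exp (- b * (x \<bullet> x))) \<partial>lborel)"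
  proof (rule Bochner_Integration.integral_diff)
    have "integrable lborel (\<lambda>x. u x * ((4 * c\<^sup>2 * (x \<bullet> x) - 2 * n * c) * exp (- c * (x \<bullet> x))))" if "0 < c" for c
    proof -
      have "integrable lborel (\<lambda>x. 4 * c\<^sup>2 * (u x * ((x \<bullet> x) * exp (- c * (x \<bullet> x)))) - 2 * n * c * (u x * exp (- c * (x \<bullet> x))))"
        using int0[OF that] int1[OF that]
        by (intro Bochner_Integration.integrable_diff integrable_mult_right)
      then show ?thesis by (simp add: algebra_simps)
    qed
    then show "integrable lborel (\<lambda>x. u x * ((4 * a\<^sup>2 * (x \<bullet> x) - 2 * n * a) * exp (- a * (x \<bullet> x))))"
      "integrable lborel (\<lambda>x. u x * ((4 * b\<^sup>2 * (x \<bullet> x) - 2 * n * b) * exp (- b * (x \<bullet> x))))"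
      using ab by auto
  qed
  finally show ?thesis unfolding n_def by simp
qed

lemma tendsto_ennreal_powr_0:
  assumes F: "(F \<longlongrightarrow> 0) G" and r: "0 < r"
  shows "((\<lambda>i. ennreal_powr (F i) r) \<longlongrightarrow> 0) G"
proof -
  have fin: "eventually (\<lambda>i. F i < 1) G" using order_tendstoD(2)[OF F, of 1] by simp
  have "((\<lambda>i. enn2real (F i)) \<longlongrightarrow> enn2real 0) G"
    using F by (intro tendsto_enn2real) auto
  then have "((\<lambda>i. enn2real (F i) powr r) \<longlongrightarrow> 0) G"
    using r by (intro tendsto_zero_powrI[where b = r]) auto
  then have "((\<lambda>i. ennreal (enn2real (F i) powr r)) \<longlongrightarrow> ennreal 0) G"
    by (rule tendsto_ennrealI)
  moreover have "eventually (\<lambda>i. ennreal (enn2real (F i) powr r) = ennreal_powr (F i) r) G"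
    using fin by eventually_elim (auto simp: ennreal_powr_def)
  ultimately show ?thesis by (auto intro: Lim_transform_eventually)
qed

text \<open>
  Dominated convergence, first in the inner and then in the outer variable.
\<close>

lemma mixed_norm_tail:
  fixes u :: "'a::euclidean_space \<times> 'b::euclidean_space \<Rightarrow> real"
  assumes u: "u \<in> mixed_Lp q1 q2" and q: "0 < q1" "0 < q2"
  shows "(\<lambda>i. mixed_norm q1 q2 (\<lambda>z. u z * indicator (- cball 0 (real i)) z)) \<longlonglongrightarrow> 0"
proof -
  have [measurable]: "u \<in> borel_measurable borel" using u by (simp add: mixed_Lp_def)
  define F where "F y = (\<integral>\<^sup>+x. ennreal (\<bar>u (x, y)\<bar> powr q1) \<partial>lborel)" for y
  define v where "v i z = u z * indicator (- cball 0 (real i)) z" for i z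
  have [measurable]: "v i \<in> borel_measurable borel" for i unfolding v_def by measurable
  define Fi where "Fi i y = (\<integral>\<^sup>+x. ennreal (\<bar>v i (x, y)\<bar> powr q1) \<partial>lborel)" for i y
  have v_le: "\<bar>v i z\<bar> \<le> \<bar>u z\<bar>" for i z by (auto simp: v_def indicator_def)
  have [measurable]: "F \<in> borel_measurable borel" "Fi i \<in> borel_measurable borel" for i
    unfolding F_def Fi_def by measurable
  have Fi_le: "Fi i y \<le> F y" for i y
    unfolding F_def Fi_def using q v_le by (intro nn_integral_mono ennreal_leI powr_mono2) auto
  have finite: "(\<integral>\<^sup>+y. ennreal_powr (F y) (q2 / q1) \<partial>lborel) < \<infinity>"
    using u by (simp add: mixed_Lp_def mixed_norm_def F_def ennreal_powr_less_top_iff[unfolded infinity_ennreal_def])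
  have Fi_lim: "(\<lambda>i. Fi i y) \<longlonglongrightarrow> 0" if "F y < \<infinity>" for y
  proof -
    have "(\<lambda>i. Fi i y) \<longlonglongrightarrow> (\<integral>\<^sup>+(x::'a). 0 \<partial>lborel)"
      unfolding Fi_def
    proof (rule nn_integral_dominated_convergence[where w = "\<lambda>x. ennreal (\<bar>u (x, y)\<bar> powr q1)"])
      show "AE x in lborel. ennreal (\<bar>v i (x, y)\<bar> powr q1) \<le> ennreal (\<bar>u (x, y)\<bar> powr q1)" for i
        using q v_le by (intro AE_I2 ennreal_leI powr_mono2) auto
      show "(\<integral>\<^sup>+x. ennreal (\<bar>u (x, y)\<bar> powr q1) \<partial>lborel) < \<infinity>"
        using that by (simp add: F_def)
      show "AE x in lborel. (\<lambda>i. ennreal (\<bar>v i (x, y)\<bar> powr q1)) \<longlonglongrightarrow> 0"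
      proof (intro AE_I2 tendsto_eventually)
        fix x :: 'a
        obtain i0 :: nat where "norm (x, y) \<le> real i0" using real_arch_simple by blast
        then have "v i (x, y) = 0" if "i0 \<le> i" for i
          using that by (simp add: v_def)
        then show "eventually (\<lambda>i. ennreal (\<bar>v i (x, y)\<bar> powr q1) = 0) sequentially"
          by (intro eventually_sequentiallyI[of i0]) simp
      qed
    qed measurable
    then show ?thesis by simp
  qed
  have "(\<lambda>i. \<integral>\<^sup>+y. ennreal_powr (Fi i y) (q2 / q1) \<partial>lborel) \<longlonglongrightarrow> (\<integral>\<^sup>+(y::'b). 0 \<partial>lborel)"
  proof (rule nn_integral_dominated_convergence[where w = "\<lambda>y. ennreal_powr (F y) (q2 / q1)"])
    show "AE y in lborel. ennreal_powr (Fi i y) (q2 / q1) \<le> ennreal_powr (F y) (q2 / q1)" for i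
      using q Fi_le by (intro AE_I2 ennreal_powr_mono) auto
    have "AE y in lborel. ennreal_powr (F y) (q2 / q1) \<noteq> \<infinity>"
      using finite by (intro nn_integral_PInf_AE) auto
    then show "AE y in lborel. (\<lambda>i. ennreal_powr (Fi i y) (q2 / q1)) \<longlonglongrightarrow> 0"
    proof eventually_elim
      case (elim y)
      then have "F y < \<infinity>" by (auto simp: ennreal_powr_def less_top split: if_splits)
      then show ?case using q by (intro tendsto_ennreal_powr_0 Fi_lim) auto
    qed
  qed (use finite in measurable)
  then have "(\<lambda>i. ennreal_powr (\<integral>\<^sup>+y. ennreal_powr (Fi i y) (q2 / q1) \<partial>lborel) (1 / q2)) \<longlonglongrightarrow> 0"
    using q by (intro tendsto_ennreal_powr_0) auto
  then show ?thesis unfolding mixed_norm_def Fi_def v_def .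
qed


text \<open>
  With \<open>a = 1 / Suc i\<close>, the pairing of \<open>u\<close> with \<open>exp (- a / 2 * (x \<bullet> x))\<close> is
  of order \<open>a powr (- D / 2)\<close>, which after multiplication by \<open>a\<close> is merely bounded if
  \<open>D = 2\<close>. Convergence to 0 comes from splitting \<open>u\<close> at a large radius \<open>R\<close>: the
  outer part has a small norm, and the inner part is integrable, so that the factor \<open>a\<close>
  suffices.
\<close>

lemma scaled_gaussian_pairing_tendsto_0:
  fixes u :: "'a::euclidean_space \<times> 'b::euclidean_space \<Rightarrow> real"
  assumes p: "1 < p1" "1 < q1" "1 / p1 + 1 / q1 = 1" "1 < p2" "1 < q2" "1 / p2 + 1 / q2 = 1"
    and D: "DIM('a) / p1 + DIM('b) / p2 \<le> 2" and u: "u \<in> mixed_Lp q1 q2"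
    and int: "\<And>a. 0 < a \<Longrightarrow> integrable lborel (\<lambda>x. u x * exp (- a * (x \<bullet> x)))"
  shows "(\<lambda>i. 1 / real (Suc i) * (\<integral>x. \<bar>u x\<bar> * exp (- (1 / (2 * real (Suc i))) * (x \<bullet> x)) \<partial>lborel)) \<longlonglongrightarrow> 0"
proof -
  define D' where "D' = DIM('a) / p1 + DIM('b) / p2"
  have [measurable]: "u \<in> borel_measurable borel" using u by (simp add: mixed_Lp_def)
  have int': "integrable lborel (\<lambda>x. \<bar>u x\<bar> * exp (- a * (x \<bullet> x)))" if "0 < a" for a
    using integrable_abs[OF int[OF that]] by (simp add: abs_mult)
  obtain C where C: "0 < C" and pairing: "\<And>(v :: 'a \<times> 'b \<Rightarrow> real) a. v \<in> borel_measurable borel \<Longrightarrow> 0 < a \<Longrightarrow>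
      (\<integral>\<^sup>+z. ennreal \<bar>v z\<bar> * ennreal (exp (- a * (norm z)\<^sup>2)) \<partial>lborel)
        \<le> mixed_norm q1 q2 v * ennreal (C * a powr (- D' / 2))"
    using mixed_norm_gaussian_pairing[where 'a = 'a and 'b = 'b, OF p] unfolding D'_def by blast
  show ?thesis
  proof (rule LIMSEQ_I)
    fix \<eta> :: real
    assume \<eta>: "0 < \<eta>"
    define \<theta> where "\<theta> = \<eta> / (4 * (C * 2 powr (D' / 2)))"
    have \<theta>: "\<theta> > 0" using \<eta> C by (simp add: \<theta>_def)
    have "eventually (\<lambda>i. mixed_norm q1 q2 (\<lambda>z. u z * indicator (- cball 0 (real i)) z) < ennreal \<theta>) sequentially"
      using mixed_norm_tail[OF u] p \<theta> by (intro order_tendstoD(2)) auto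
    then obtain R :: nat where R: "mixed_norm q1 q2 (\<lambda>z. u z * indicator (- cball 0 (real R)) z) < ennreal \<theta>"
      using eventually_happens by force
    have [measurable]: "cball (0 :: 'a \<times> 'b) (real R) \<in> sets borel" by simp
    define v where "v z = u z * indicator (- cball 0 (real R)) z" for z
    have [measurable]: "v \<in> borel_measurable borel" unfolding v_def by measurable
    define w where "w z = \<bar>u z\<bar> * indicator (cball 0 (real R)) z" for z
    have [measurable]: "w \<in> borel_measurable borel" unfolding w_def by measurable
    have intw: "integrable lborel w"
    proof (rule Bochner_Integration.integrable_bound)
      show "integrable lborel (\<lambda>x. exp ((real R)\<^sup>2) * (\<bar>u x\<bar> * exp (- 1 * (x \<bullet> x))))"
        using int'[of 1] by (intro integrable_mult_right) simp
      show "AE x in lborel. norm (w x) \<le> norm (exp ((real R)\<^sup>2) * (\<bar>u x\<bar> * exp (- 1 * (x \<bullet> x))))"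
      proof (intro AE_I2)
        fix x :: "'a \<times> 'b"
        have "1 \<le> exp ((real R)\<^sup>2 - x \<bullet> x)" if "norm x \<le> real R"
          using power_mono[OF that norm_ge_zero, of 2] by (simp add: power2_norm_eq_inner)
        then have "\<bar>u x\<bar> * 1 \<le> \<bar>u x\<bar> * exp ((real R)\<^sup>2 - x \<bullet> x)" if "norm x \<le> real R"
          using that by (intro mult_left_mono) auto
        then show "norm (w x) \<le> norm (exp ((real R)\<^sup>2) * (\<bar>u x\<bar> * exp (- 1 * (x \<bullet> x))))"
          by (auto simp: w_def indicator_def abs_mult exp_diff exp_minus field_simps)
      qed
    qed simp
    define W where "W = (\<integral>x. w x \<partial>lborel)"
    have W: "W \<ge> 0" unfolding W_def w_def by (intro integral_nonneg_AE) auto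
    have tail: "(\<integral>x. \<bar>v x\<bar> * exp (- a * (x \<bullet> x)) \<partial>lborel) \<le> \<theta> * (C * a powr (- D' / 2))"
      if a: "0 < a" for a
    proof -
      have "(\<integral>\<^sup>+z. ennreal (\<bar>v z\<bar> * exp (- a * (z \<bullet> z))) \<partial>lborel) \<le> ennreal \<theta> * ennreal (C * a powr (- D' / 2))"
      proof -
        have "(\<integral>\<^sup>+z. ennreal (\<bar>v z\<bar> * exp (- a * (z \<bullet> z))) \<partial>lborel)
          = (\<integral>\<^sup>+z. ennreal \<bar>v z\<bar> * ennreal (exp (- a * (norm z)\<^sup>2)) \<partial>lborel)"
          by (simp add: ennreal_mult power2_norm_eq_inner)
        also have "\<dots> \<le> mixed_norm q1 q2 v * ennreal (C * a powr (- D' / 2))"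
          by (rule pairing) (use a in auto)
        also have "\<dots> \<le> ennreal \<theta> * ennreal (C * a powr (- D' / 2))"
          using R unfolding v_def[symmetric] by (intro mult_right_mono) auto
        finally show ?thesis .
      qed
      also have "\<dots> = ennreal (\<theta> * (C * a powr (- D' / 2)))"
        using \<theta> C by (simp add: ennreal_mult)
      finally have le: "(\<integral>\<^sup>+z. ennreal (\<bar>v z\<bar> * exp (- a * (z \<bullet> z))) \<partial>lborel) \<le> ennreal (\<theta> * (C * a powr (- D' / 2)))" .
      have "(\<integral>x. \<bar>v x\<bar> * exp (- a * (x \<bullet> x)) \<partial>lborel) = enn2real (\<integral>\<^sup>+z. ennreal (\<bar>v z\<bar> * exp (- a * (z \<bullet> z))) \<partial>lborel)"
        by (intro integral_eq_nn_integral) auto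
      also have "\<dots> \<le> \<theta> * (C * a powr (- D' / 2))"
        using \<theta> C by (intro enn2real_leI le) auto
      finally show ?thesis .
    qed
    have split: "(\<integral>x. \<bar>u x\<bar> * exp (- a * (x \<bullet> x)) \<partial>lborel) \<le> W + \<theta> * (C * a powr (- D' / 2))" if a: "0 < a" for a
    proof -
      have "integrable lborel (\<lambda>x. \<bar>v x\<bar> * exp (- a * (x \<bullet> x)))"
        by (rule Bochner_Integration.integrable_bound[OF int'[OF a]]) (auto simp: v_def indicator_def)
      note iv = this
      have "(\<integral>x. \<bar>u x\<bar> * exp (- a * (x \<bullet> x)) \<partial>lborel) \<le> (\<integral>x. w x + \<bar>v x\<bar> * exp (- a * (x \<bullet> x)) \<partial>lborel)"
      proof (rule integral_mono[OF int'[OF a] Bochner_Integration.integrable_add[OF intw iv]])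
        fix x :: "'a \<times> 'b"
        have "exp (- a * (x \<bullet> x)) \<le> 1" using a by simp
        then have "\<bar>u x\<bar> * exp (- a * (x \<bullet> x)) \<le> \<bar>u x\<bar>" by (intro mult_left_le) auto
        then show "\<bar>u x\<bar> * exp (- a * (x \<bullet> x)) \<le> w x + \<bar>v x\<bar> * exp (- a * (x \<bullet> x))"
          by (auto simp: w_def v_def indicator_def)
      qed
      also have "\<dots> = W + (\<integral>x. \<bar>v x\<bar> * exp (- a * (x \<bullet> x)) \<partial>lborel)"
        unfolding W_def by (rule Bochner_Integration.integral_add[OF intw iv])
      also have "\<dots> \<le> W + \<theta> * (C * a powr (- D' / 2))" using tail[OF a] by simp
      finally show ?thesis .
    qed
    obtain i0 :: nat where i0: "2 * W / \<eta> < real i0" using reals_Archimedean2 by blast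
    have "norm (1 / real (Suc i) * (\<integral>x. \<bar>u x\<bar> * exp (- (1 / (2 * real (Suc i))) * (x \<bullet> x)) \<partial>lborel) - 0) < \<eta>"
      if i: "i0 \<le> i" for i
    proof -
      define m where "m = real (Suc i)"
      have m: "m \<ge> 1" "2 * W / \<eta> < m" using i i0 by (auto simp: m_def)
      define J where "J = (\<integral>x. \<bar>u x\<bar> * exp (- (1 / (2 * m)) * (x \<bullet> x)) \<partial>lborel)"
      have J0: "J \<ge> 0" unfolding J_def by (intro integral_nonneg_AE) auto
      have "J \<le> W + \<theta> * (C * (1 / (2 * m)) powr (- D' / 2))"
        unfolding J_def using m by (intro split) auto
      also have "(1 / (2 * m)) powr (- D' / 2) = 2 powr (D' / 2) * m powr (D' / 2)"
      proof -
        have "- D' / 2 = - (D' / 2)" by (rule minus_divide_left[symmetric])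
        then have "(1 / (2 * m)) powr (- D' / 2) = inverse ((1 / (2 * m)) powr (D' / 2))"
          by (simp only: powr_minus)
        also have "\<dots> = (2 * m) powr (D' / 2)" using m by (simp add: powr_divide)
        also have "\<dots> = 2 powr (D' / 2) * m powr (D' / 2)" by (rule powr_mult)
        finally show ?thesis .
      qed
      also have "\<theta> * (C * (2 powr (D' / 2) * m powr (D' / 2))) = \<eta> / 4 * m powr (D' / 2)"
        using C by (simp add: \<theta>_def)
      also have "m powr (D' / 2) \<le> m powr 1"
        using m D by (intro powr_mono) (auto simp: D'_def)
      finally have "J \<le> W + \<eta> / 4 * m" using \<eta> m by simp
      moreover have "W < \<eta> / 2 * m" using m \<eta> by (simp add: field_simps)
      ultimately have "J < \<eta> * m" using \<eta> m by (simp add: field_simps) (smt (verit) mult_pos_pos)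
      then have "1 / m * J < \<eta>" using m by (simp add: field_simps)
      then show ?thesis using J0 m unfolding J_def m_def by simp
    qed
    then show "\<exists>no. \<forall>n\<ge>no. norm (1 / real (Suc n) * (\<integral>x. \<bar>u x\<bar> * exp (- (1 / (2 * real (Suc n))) * (x \<bullet> x)) \<partial>lborel) - 0) < \<eta>"
      by blast
  qed
qed

lemma mult_exp_minus_le:
  assumes "0 < a" "0 \<le> (r::real)"
  shows "r * exp (- a * r) \<le> 2 / a * exp (- (a / 2) * r)"
proof -
  have "a / 2 * r \<le> exp (a / 2 * r)" using exp_ge_add_one_self[of "a / 2 * r"] by linarith
  then have "a / 2 * r * exp (- a * r) \<le> exp (a / 2 * r) * exp (- a * r)"
    by (intro mult_right_mono) auto
  also have "\<dots> = exp (- (a / 2) * r)" by (simp add: exp_add[symmetric] algebra_simps)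
  finally show ?thesis using assms by (simp add: field_simps)
qed

text \<open>
  Write \<open>U a\<close> and \<open>K a\<close> for the integrals of \<open>u\<close> against \<open>exp (- a * r)\<close>
  and \<open>r * exp (- a * r)\<close>, where \<open>r = x \<bullet> x\<close>. The pairing
  \<open>L a = 4 * a\<^sup>2 * K a - 2 * n * a * U a\<close> of \<open>u\<close> with the Laplacian of the Gaussian is
  nondecreasing in \<open>a\<close> by superharmonicity and tends to 0 as \<open>a\<close> tends to 0, because
  \<open>D \<le> 2\<close>. So it is nonnegative, which is the differential inequality
  \<open>- U' a = K a \<ge> n / (2 * a) * U a\<close>: as \<open>a\<close> tends to 0, \<open>U a\<close> grows at least
  like \<open>a powr (- n / 2)\<close>, unless it vanishes. But the Hoelder inequality allows only
  \<open>a powr (- D / 2)\<close>, and \<open>D < n\<close>. Hence \<open>U\<close> vanishes, and so does \<open>u \<ge> 0\<close>.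
\<close>

theorem mixed_LiouvilleI:
  assumes p: "1 < p1" "1 < q1" "1 / p1 + 1 / q1 = 1" "1 < p2" "1 < q2" "1 / p2 + 1 / q2 = 1"
    and D: "DIM('a) / p1 + DIM('b) / p2 \<le> 2"
  shows "mixed_Liouville TYPE('a::euclidean_space \<times> 'b::euclidean_space) q1 q2"
  unfolding mixed_Liouville_def
proof (intro allI impI)
  fix u :: "'a \<times> 'b \<Rightarrow> real"
  assume "superharmonic u \<and> (AE x in lborel. 0 \<le> u x) \<and> u \<in> mixed_Lp q1 q2"
  then have sh: "superharmonic u" and nonneg: "AE x in lborel. 0 \<le> u x" and uL: "u \<in> mixed_Lp q1 q2" by auto
  define D' where "D' = DIM('a) / p1 + DIM('b) / p2"
  define n where "n = real DIM('a \<times> 'b)"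
  have n: "n > 0" unfolding n_def by (simp only: of_nat_0_less_iff DIM_positive)
  have Dn: "D' < n"
  proof -
    have "DIM('a) / p1 < DIM('a)" "DIM('b) / p2 < DIM('b)"
      using p by (simp_all add: divide_less_eq)
    then show ?thesis by (simp add: D'_def n_def)
  qed
  have [measurable]: "u \<in> borel_measurable borel" using uL by (simp add: mixed_Lp_def)
  obtain C where C: "0 < C" and pairing: "\<And>(v :: 'a \<times> 'b \<Rightarrow> real) a. v \<in> borel_measurable borel \<Longrightarrow> 0 < a \<Longrightarrow>
      (\<integral>\<^sup>+z. ennreal \<bar>v z\<bar> * ennreal (exp (- a * (norm z)\<^sup>2)) \<partial>lborel)
        \<le> mixed_norm q1 q2 v * ennreal (C * a powr (- D' / 2))"
    using mixed_norm_gaussian_pairing[where 'a = 'a and 'b = 'b, OF p] unfolding D'_def by blast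
  obtain N where N: "mixed_norm q1 q2 u = ennreal N" "0 \<le> N"
    using uL by (cases "mixed_norm q1 q2 u") (auto simp: mixed_Lp_def)
  have nn: "(\<integral>\<^sup>+z. ennreal (\<bar>u z\<bar> * exp (- a * (z \<bullet> z))) \<partial>lborel) \<le> ennreal (N * C * a powr (- D' / 2))"
    if a: "0 < a" for a
    using pairing[OF _ a, of u] N C by (simp add: ennreal_mult power2_norm_eq_inner mult.assoc)
  have int0: "integrable lborel (\<lambda>x. u x * exp (- a * (x \<bullet> x)))" if a: "0 < a" for a
  proof (rule integrableI_bounded)
    have "(\<integral>\<^sup>+x. ennreal (norm (u x * exp (- a * (x \<bullet> x)))) \<partial>lborel) \<le> ennreal (N * C * a powr (- D' / 2))"
      using nn[OF a] by (simp add: abs_mult)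
    also have "\<dots> < \<infinity>" by simp
    finally show "(\<integral>\<^sup>+x. ennreal (norm (u x * exp (- a * (x \<bullet> x)))) \<partial>lborel) < \<infinity>" .
  qed measurable
  have int1: "integrable lborel (\<lambda>x. u x * ((x \<bullet> x) * exp (- a * (x \<bullet> x))))" if a: "0 < a" for a
  proof (rule Bochner_Integration.integrable_bound)
    show "integrable lborel (\<lambda>x. 2 / a * (u x * exp (- (a / 2) * (x \<bullet> x))))"
      using int0[of "a / 2"] a by (intro integrable_mult_right) simp
    show "AE x in lborel. norm (u x * ((x \<bullet> x) * exp (- a * (x \<bullet> x)))) \<le> norm (2 / a * (u x * exp (- (a / 2) * (x \<bullet> x))))"
    proof (intro AE_I2)
      fix x :: "'a \<times> 'b"
      have "\<bar>u x\<bar> * ((x \<bullet> x) * exp (- a * (x \<bullet> x))) \<le> \<bar>u x\<bar> * (2 / a * exp (- (a / 2) * (x \<bullet> x)))"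
        using a by (intro mult_left_mono mult_exp_minus_le) auto
      then show "norm (u x * ((x \<bullet> x) * exp (- a * (x \<bullet> x)))) \<le> norm (2 / a * (u x * exp (- (a / 2) * (x \<bullet> x))))"
        using a by (simp add: abs_mult mult.left_commute)
    qed
  qed measurable
  define U where "U a = (\<integral>x. u x * exp (- a * (x \<bullet> x)) \<partial>lborel)" for a
  define K where "K a = (\<integral>x. u x * ((x \<bullet> x) * exp (- a * (x \<bullet> x))) \<partial>lborel)" for a
  define L where "L a = (\<integral>x. u x * ((4 * a\<^sup>2 * (x \<bullet> x) - 2 * n * a) * exp (- a * (x \<bullet> x))) \<partial>lborel)" for a
  have L_eq: "L a = 4 * a\<^sup>2 * K a - 2 * n * a * U a" if a: "0 < a" for a
  proof -
    have "L a = (\<integral>x. 4 * a\<^sup>2 * (u x * ((x \<bullet> x) * exp (- a * (x \<bullet> x)))) - 2 * n * a * (u x * exp (- a * (x \<bullet> x))) \<partial>lborel)"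
      unfolding L_def by (intro Bochner_Integration.integral_cong refl) (simp add: algebra_simps)
    also have "\<dots> = (\<integral>x. 4 * a\<^sup>2 * (u x * ((x \<bullet> x) * exp (- a * (x \<bullet> x)))) \<partial>lborel)
        - (\<integral>x. 2 * n * a * (u x * exp (- a * (x \<bullet> x))) \<partial>lborel)"
      using int0[OF a] int1[OF a] by (intro Bochner_Integration.integral_diff integrable_mult_right)
    finally show ?thesis by (simp add: U_def K_def)
  qed
  have L_mono: "L a \<le> L b" if "0 < a" "a < b" for a b
    unfolding L_def n_def by (rule superharmonic_gaussian_mono[OF sh that int0 int1])
  have L_bound: "\<bar>L a\<bar> \<le> (8 + 2 * n) * (a * (\<integral>x. \<bar>u x\<bar> * exp (- (a / 2) * (x \<bullet> x)) \<partial>lborel))"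
    if a: "0 < a" for a
  proof -
    have i2: "integrable lborel (\<lambda>x. \<bar>u x\<bar> * exp (- (a / 2) * (x \<bullet> x)))"
      using integrable_abs[OF int0[of "a / 2"]] a by (simp add: abs_mult)
    have "\<bar>L a\<bar> \<le> (\<integral>x. \<bar>u x * ((4 * a\<^sup>2 * (x \<bullet> x) - 2 * n * a) * exp (- a * (x \<bullet> x)))\<bar> \<partial>lborel)"
      unfolding L_def by (rule integral_abs_bound)
    also have "\<dots> \<le> (\<integral>x. ((8 + 2 * n) * a) * (\<bar>u x\<bar> * exp (- (a / 2) * (x \<bullet> x))) \<partial>lborel)"
    proof (rule integral_mono')
      show "integrable lborel (\<lambda>x. ((8 + 2 * n) * a) * (\<bar>u x\<bar> * exp (- (a / 2) * (x \<bullet> x))))"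
        using i2 by (rule integrable_mult_right)
      fix x :: "'a \<times> 'b"
      define r where "r = x \<bullet> x"
      have r: "r \<ge> 0" by (simp add: r_def)
      have "\<bar>(4 * a\<^sup>2 * r - 2 * n * a) * exp (- a * r)\<bar> = \<bar>4 * a\<^sup>2 * r - 2 * n * a\<bar> * exp (- a * r)"
        by (simp add: abs_mult)
      also have "\<dots> \<le> (4 * a\<^sup>2 * r + 2 * n * a) * exp (- a * r)"
        using a r n by (intro mult_right_mono) (auto simp: abs_le_iff)
      also have "\<dots> = 4 * a\<^sup>2 * (r * exp (- a * r)) + 2 * n * a * exp (- a * r)"
        by (simp add: algebra_simps)
      also have "\<dots> \<le> 4 * a\<^sup>2 * (2 / a * exp (- (a / 2) * r)) + 2 * n * a * exp (- (a / 2) * r)"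
        using a r n by (intro add_mono mult_left_mono mult_exp_minus_le) (auto simp: mult_right_mono)
      also have "\<dots> = (8 + 2 * n) * a * exp (- (a / 2) * r)"
        using a by (simp add: power2_eq_square algebra_simps)
      finally have "\<bar>u x\<bar> * \<bar>(4 * a\<^sup>2 * r - 2 * n * a) * exp (- a * r)\<bar> \<le> \<bar>u x\<bar> * ((8 + 2 * n) * a * exp (- (a / 2) * r))"
        by (intro mult_left_mono) auto
      then show "\<bar>u x * ((4 * a\<^sup>2 * (x \<bullet> x) - 2 * n * a) * exp (- a * (x \<bullet> x)))\<bar>
          \<le> ((8 + 2 * n) * a) * (\<bar>u x\<bar> * exp (- (a / 2) * (x \<bullet> x)))"
        unfolding r_def by (simp add: abs_mult ac_simps)
      show "0 \<le> ((8 + 2 * n) * a) * (\<bar>u x\<bar> * exp (- (a / 2) * (x \<bullet> x)))" using a n by simp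
    qed
    finally show ?thesis by simp
  qed
  have L_lim: "(\<lambda>i. L (1 / real (Suc i))) \<longlonglongrightarrow> 0"
  proof (rule tendsto_rabs_zero_cancel, rule tendsto_sandwich[OF _ _ tendsto_const])
    show "(\<lambda>i. (8 + 2 * n) * (1 / real (Suc i) * (\<integral>x. \<bar>u x\<bar> * exp (- (1 / (2 * real (Suc i))) * (x \<bullet> x)) \<partial>lborel))) \<longlonglongrightarrow> 0"
      by (rule tendsto_mult_right_zero[OF scaled_gaussian_pairing_tendsto_0[OF p D uL int0]])
    have "\<bar>L (1 / real (Suc i))\<bar>
      \<le> (8 + 2 * n) * (1 / real (Suc i) * (\<integral>x. \<bar>u x\<bar> * exp (- (1 / (2 * real (Suc i))) * (x \<bullet> x)) \<partial>lborel))" for i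
    proof -
      have "1 / real (Suc i) / 2 = 1 / (2 * real (Suc i))" by simp
      then show ?thesis using L_bound[of "1 / real (Suc i)"] by (simp only: zero_less_divide_iff) simp
    qed
    then show "\<forall>\<^sub>F i in sequentially. \<bar>L (1 / real (Suc i))\<bar>
      \<le> (8 + 2 * n) * (1 / real (Suc i) * (\<integral>x. \<bar>u x\<bar> * exp (- (1 / (2 * real (Suc i))) * (x \<bullet> x)) \<partial>lborel))"
      by (intro always_eventually allI)
  qed auto
  have L_nonneg: "0 \<le> L b" if b: "0 < b" for b
  proof (rule LIMSEQ_le_const2[OF L_lim])
    obtain m :: nat where m: "1 / b < real m" using reals_Archimedean2 by blast
    have "L (1 / real (Suc i)) \<le> L b" if "m \<le> i" for i
    proof (rule L_mono)
      have "1 / b < real (Suc i)" using m that by simp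
      then show "1 / real (Suc i) < b" using b by (simp add: field_simps)
    qed simp
    then show "\<exists>N. \<forall>i\<ge>N. L (1 / real (Suc i)) \<le> L b" by blast
  qed
  \<comment> \<open>A discrete form of the differential inequality, from the convexity of the exponential
    function; it avoids differentiating \<open>U\<close>.\<close>
  have growth: "U b * (1 + \<delta> * n / 2) \<le> U ((1 - \<delta>) * b)" if b: "0 < b" and \<delta>: "0 < \<delta>" "\<delta> < 1" for b \<delta>
  proof -
    have "0 \<le> 2 * b * (2 * b * K b - n * U b)"
      using L_nonneg[OF b] L_eq[OF b] by (simp add: power2_eq_square algebra_simps)
    then have K: "n * U b \<le> 2 * b * K b" using b by (simp add: zero_le_mult_iff)
    have "U b * (1 + \<delta> * n / 2) = U b + \<delta> / 2 * (n * U b)" by (simp add: algebra_simps)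
    also have "\<dots> \<le> U b + \<delta> / 2 * (2 * b * K b)" using K \<delta> by (intro add_left_mono mult_left_mono) auto
    also have "\<dots> = U b + \<delta> * b * K b" by simp
    also have "\<dots> = (\<integral>x. u x * exp (- b * (x \<bullet> x)) + \<delta> * b * (u x * ((x \<bullet> x) * exp (- b * (x \<bullet> x)))) \<partial>lborel)"
      unfolding U_def K_def using int0[OF b] int1[OF b]
      by (subst Bochner_Integration.integral_add) (auto intro!: integrable_mult_right)
    also have "\<dots> \<le> U ((1 - \<delta>) * b)"
      unfolding U_def
    proof (rule integral_mono_AE)
      show "integrable lborel (\<lambda>x. u x * exp (- b * (x \<bullet> x)) + \<delta> * b * (u x * ((x \<bullet> x) * exp (- b * (x \<bullet> x)))))"
        using int0[OF b] int1[OF b] by (intro Bochner_Integration.integrable_add integrable_mult_right)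
      show "integrable lborel (\<lambda>x. u x * exp (- ((1 - \<delta>) * b) * (x \<bullet> x)))"
        using b \<delta> by (intro int0) auto
      show "AE x in lborel. u x * exp (- b * (x \<bullet> x)) + \<delta> * b * (u x * ((x \<bullet> x) * exp (- b * (x \<bullet> x))))
          \<le> u x * exp (- ((1 - \<delta>) * b) * (x \<bullet> x))"
        using nonneg
      proof eventually_elim
        case (elim x)
        define r where "r = x \<bullet> x"
        have "exp (- b * r) * (1 + \<delta> * b * r) \<le> exp (- b * r) * exp (\<delta> * b * r)"
          using exp_ge_add_one_self[of "\<delta> * b * r"] by (intro mult_left_mono) auto
        also have "\<dots> = exp (- ((1 - \<delta>) * b) * r)"
          by (simp add: exp_add[symmetric] algebra_simps)
        finally have "u x * (exp (- b * r) * (1 + \<delta> * b * r)) \<le> u x * exp (- ((1 - \<delta>) * b) * r)"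
          using elim by (intro mult_left_mono)
        then show ?case unfolding r_def by (simp add: algebra_simps)
      qed
    qed
    finally show ?thesis .
  qed
  have upper: "U a \<le> N * C * a powr (- D' / 2)" if a: "0 < a" for a
  proof -
    have "U a \<le> (\<integral>x. \<bar>u x\<bar> * exp (- a * (x \<bullet> x)) \<partial>lborel)"
      unfolding U_def using int0[OF a] integrable_abs[OF int0[OF a]]
      by (intro integral_mono) (auto simp: abs_mult mult_right_mono)
    also have "\<dots> = enn2real (\<integral>\<^sup>+x. ennreal (\<bar>u x\<bar> * exp (- a * (x \<bullet> x))) \<partial>lborel)"
      by (intro integral_eq_nn_integral) auto
    also have "\<dots> \<le> N * C * a powr (- D' / 2)"
      using N C by (intro enn2real_leI nn[OF a]) auto
    finally show ?thesis .
  qed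
  \<comment> \<open>At \<open>\<delta> = 0\<close> the right-hand side equals 1 and has the derivative \<open>(n - D') / 2 > 0\<close>.\<close>
  obtain \<delta> where \<delta>: "0 < \<delta>" "\<delta> < 1" "1 < (1 + \<delta> * n / 2) * (1 - \<delta>) powr (D' / 2)"
  proof -
    define f where "f = (\<lambda>\<delta>. (1 + \<delta> * n / 2) * (1 - \<delta>) powr (D' / 2))"
    have "((\<lambda>\<delta>. (1 - \<delta>) powr (D' / 2)) has_real_derivative D' / 2 * (1 - 0) powr (D' / 2 - 1) * (- 1)) (at 0)"
      by (rule DERIV_chain2[where g = "\<lambda>\<delta>. 1 - \<delta>" and f = "\<lambda>x. x powr (D' / 2)", OF has_real_derivative_powr])
        (auto intro!: derivative_eq_intros)
    moreover have "((\<lambda>\<delta>. 1 + \<delta> * n / 2) has_real_derivative n / 2) (at 0)"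
      by (auto intro!: derivative_eq_intros)
    ultimately have "(f has_real_derivative n / 2 * (1 - 0) powr (D' / 2) + D' / 2 * (1 - 0) powr (D' / 2 - 1) * (- 1) * (1 + 0 * n / 2)) (at 0)"
      unfolding f_def by (intro DERIV_mult)
    then have "(f has_real_derivative (n - D') / 2) (at 0)" by (simp add: diff_divide_distrib)
    then obtain d where d: "d > 0" "\<And>h. 0 < h \<Longrightarrow> h < d \<Longrightarrow> f 0 < f (0 + h)"
      using DERIV_pos_inc_right[of f "(n - D') / 2" 0] Dn by auto
    have "f 0 < f (0 + min d 1 / 2)" using d by (intro d(2)) auto
    then show ?thesis using d(1) by (intro that[of "min d 1 / 2"]) (auto simp: f_def)
  qed
  have iter: "U 1 * (1 + \<delta> * n / 2) ^ k \<le> U ((1 - \<delta>) ^ k)" for k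
  proof (induction k)
    case (Suc k)
    have "U 1 * (1 + \<delta> * n / 2) ^ Suc k = U 1 * (1 + \<delta> * n / 2) ^ k * (1 + \<delta> * n / 2)" by simp
    also have "\<dots> \<le> U ((1 - \<delta>) ^ k) * (1 + \<delta> * n / 2)"
      using Suc \<delta> n by (intro mult_right_mono) auto
    also have "\<dots> \<le> U ((1 - \<delta>) * (1 - \<delta>) ^ k)" using \<delta> by (intro growth) auto
    finally show ?case by simp
  qed simp
  have "U 1 \<le> 0"
  proof (rule ccontr)
    assume "\<not> U 1 \<le> 0"
    then have U1: "U 1 > 0" by simp
    define \<rho> where "\<rho> = (1 + \<delta> * n / 2) * (1 - \<delta>) powr (D' / 2)"
    obtain k where k: "N * C / U 1 < \<rho> ^ k" using real_arch_pow \<delta>(3) unfolding \<rho>_def by blast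
    define a where "a = (1 - \<delta>) ^ k"
    have a: "a > 0" using \<delta> by (simp add: a_def)
    have "((1 - \<delta>) powr (D' / 2)) ^ k = a powr (D' / 2)"
      using \<delta> by (simp add: a_def powr_powr powr_realpow[symmetric] mult.commute)
    then have "U 1 * \<rho> ^ k = U 1 * (1 + \<delta> * n / 2) ^ k * a powr (D' / 2)"
      by (simp add: \<rho>_def power_mult_distrib)
    also have "\<dots> \<le> N * C * a powr (- D' / 2) * a powr (D' / 2)"
      using iter[of k] upper[OF a] unfolding a_def[symmetric] by (intro mult_right_mono) auto
    also have "\<dots> = N * C * (a powr (- D' / 2 + D' / 2))" by (simp only: powr_add mult.assoc)
    also have "\<dots> = N * C" using a by simp
    finally show False using k U1 by (simp add: field_simps)
  qed
  moreover have "0 \<le> U 1"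
    unfolding U_def using nonneg by (intro integral_nonneg_AE) (auto elim!: eventually_mono)
  ultimately have "(\<integral>x. u x * exp (- 1 * (x \<bullet> x)) \<partial>lborel) = 0" by (simp add: U_def)
  then have "AE x in lborel. u x * exp (- 1 * (x \<bullet> x)) = 0"
    using nonneg by (subst (asm) integral_nonneg_eq_0_iff_AE[OF int0]) (auto elim!: eventually_mono)
  then have "AE x in lborel. u x = 0" by simp
  then show "\<exists>c. AE x in lborel. u x = c" by blast
qed


section \<open>The equivalence\<close>

theorem corollary6p4:
  fixes p1 p2 q1 q2 :: real
  assumes "1 < p1" and "1 < p2"
    and "1 / p1 + 1 / q1 = 1" and "1 / p2 + 1 / q2 = 1"
  shows "(mixed_parabolic TYPE((real ^ 'n1::finite) \<times> (real ^ 'n2::finite)) p1 p2 \<longleftrightarrow>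
            mixed_Liouville TYPE((real ^ 'n1) \<times> (real ^ 'n2)) q1 q2) \<and>
         (mixed_Liouville TYPE((real ^ 'n1) \<times> (real ^ 'n2)) q1 q2 \<longleftrightarrow>
            real CARD('n1) / p1 + real CARD('n2) / p2 \<le> 2)"
proof -
  have q: "1 < q" if "1 < p" "1 / p + 1 / q = 1" for p q :: real
  proof -
    have "0 < 1 / p" "1 / p < 1" using that(1) by simp_all
    then have "0 < 1 / q" "1 / q < 1" using that(2) by linarith+
    then show ?thesis by (simp add: divide_less_eq)
  qed
  note exponents = assms(1) q[OF assms(1,3)] assms(3) assms(2) q[OF assms(2,4)] assms(4)
  have "mixed_parabolic TYPE((real ^ 'n1) \<times> (real ^ 'n2)) p1 p2 \<longleftrightarrow>
      real CARD('n1) / p1 + real CARD('n2) / p2 \<le> 2"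
    using mixed_parabolicI[OF assms(1,2), where 'a = "real ^ 'n1" and 'b = "real ^ 'n2"]
      not_mixed_parabolic[OF exponents, where 'a = "real ^ 'n1" and 'b = "real ^ 'n2"]
    by (force simp: not_le)
  moreover have "mixed_Liouville TYPE((real ^ 'n1) \<times> (real ^ 'n2)) q1 q2 \<longleftrightarrow>
      real CARD('n1) / p1 + real CARD('n2) / p2 \<le> 2"
    using mixed_LiouvilleI[OF exponents, where 'a = "real ^ 'n1" and 'b = "real ^ 'n2"]
      not_mixed_Liouville[OF exponents, where 'a = "real ^ 'n1" and 'b = "real ^ 'n2"]
    by (force simp: not_le)
  ultimately show ?thesis by simp
qed

end
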